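(* Let $r,m,\ell\ge1$, let $\mathfrak q_1,\dots,\mathfrak q_\ell\in A=\mathbb F_q[T]$ be distinct monic irreducible polynomials of degree $m$, none equal to $T$, and let $\phi$ be the Drinfeld module over $k=\mathbb F_{q^r}$ (with $T\mapsto0$) given by $\phi_T=\tau^r$. Put $R=\mathbb F_{q^r}\{\tau\}$, $Q_i=\mathfrak q_i(\tau^r)$, $\Pi=\prod_iQ_i$, $\mathsf N=\deg_\tau(\Pi)=m\ell r$, let $1\le t\le\ell r$ be an integer and $K=mt$. Then the skew CRT decoder described in the context corrects every sum-rank error of weight at most $$\left\lfloor\frac{\ell r-t}{2}\right\rfloor:$$ run with $\varepsilon=\lfloor(\ell r-t)/2\rfloor$, on input $\boldsymbol Y=\Theta(\operatorname{CRT}_\Gamma(u))+\boldsymbol E$ with $u\in R$, $\deg_\tau(u)<K$ and $\operatorname{wt}_{SR}(\boldsymbol E)\le\lfloor(\ell r-t)/2\rfloor$, it returns $u$. After the CRT data and the maps $\Theta_i$ have been precomputed, its key-equation step (the filter step) costs $O(\mathsf N^\omega)$ operations over $\mathbb F_{q^r}$, where $\omega$ denotes the exponent of matrix multiplication.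
   Context: $q$ is a prime power. $R=\mathbb F_{q^r}\{\tau\}$ is the skew polynomial ring with $\tau\alpha=\alpha^q\tau$ for $\alpha\in\mathbb F_{q^r}$; it is Euclidean on both sides. An element $\sum a_i\tau^i$ acts on an algebraic closure $\overline k$ by $x\mapsto\sum a_ix^{q^i}$. The elements $Q_i$ and $\Pi$ are central in $R$, so $(Q_i)=RQ_i$ and $(\Pi)=R\Pi$ are two-sided ideals. Put $\mathcal R_\Gamma=\prod_{i=1}^\ell R/(Q_i)$. The map $\operatorname{CRT}_\Gamma:R/(\Pi)\to\mathcal R_\Gamma$ taking $u$ to its right remainders modulo the $Q_i$ is an isomorphism; the CRT lift of $\boldsymbol y\in\mathcal R_\Gamma$ is the unique $Y\in R$ with $\deg_\tau(Y)<\mathsf N$ and $\operatorname{CRT}_\Gamma(Y)=\boldsymbol y$. The Drinfeld module is $\phi:A\to k\{\tau\}$, $a\mapsto\phi_a=a(\tau^r)$; its endomorphism ring is $R$. $\phi[a]=\{\alpha\in\overline k:\phi_a(\alpha)=0\}$ is an $A$-module via $b\cdot\alpha=\phi_b(\alpha)$, and $\phi[\mathfrak q_i]\cong(A/\mathfrak q_i)^r\cong\mathbb F_{q^m}^r$. Restriction of $u\in R$ to $\phi[\mathfrak q_i]$ induces an isomorphism $\Theta_i:R/(Q_i)\to\operatorname{End}_{A/(\mathfrak q_i)}(\phi[\mathfrak q_i])\cong\operatorname{Mat}_{r\times r}(\mathbb F_{q^m})$ (after fixing isomorphisms $A/\mathfrak q_i\cong\mathbb F_{q^m}$ and bases), and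 $\Theta:\mathcal R_\Gamma\to\operatorname{Mat}_{r\times r}(\mathbb F_{q^m})^\ell$ is $(y_i)_i\mapsto(\Theta_i(y_i))_i$. For a tuple $X=(X_1,\dots,X_\ell)$ of matrices, $\operatorname{wt}_{SR}(X)=\sum_i\operatorname{rk}_{\mathbb F_{q^m}}(X_i)$. Skew CRT decoder, with a fixed $\varepsilon\in\mathbb Z_{\ge0}$ such that $2\varepsilon+t\le\ell r$. Input: $\boldsymbol Y\in\operatorname{Mat}_{r\times r}(\mathbb F_{q^m})^\ell$. Output: a skew polynomial $\widehat u$ with $\deg_\tau(\widehat u)<K$, or failure. (1) CRT-lifting step: compute $\boldsymbol y=\Theta^{-1}(\boldsymbol Y)$ and its CRT lift $Y$. (2) Filter step: find a nonzero solution $(v,N)\in R^2$ of $vY\equiv N\pmod\Pi$, $\deg_\tau(v)\le m\varepsilon$, $\deg_\tau(N)\le m\varepsilon+K-1$ (a homogeneous linear system over $\mathbb F_{q^r}$). Fail if none exists or if $v=0$. (3) Message recovery: divide $N=v\widehat u+\Delta$ with $\deg_\tau(\Delta)<\deg_\tau(v)$; fail if $\Delta\ne0$ or $\deg_\tau(\widehat u)\ge K$. (4) Verification: fail if $\operatorname{wt}_{SR}(\boldsymbol Y-\Theta(\operatorname{CRT}_\Gamma(\widehat u)))>\varepsilon$; otherwise return $\widehat u$. *)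

theory Defs
  imports
    "Jordan_Normal_Form.DL_Rank"
    "HOL-Computational_Algebra.Polynomial"
    "HOL-Algebra.Ring_Divisibility"
    "HOL-Library.Landau_Symbols"
    "HOL-Library.Cardinality"
begin

hide_const (open) up_ring.coeff up_ring.monom

section \<open>Finite fields, F_q[T] and skew polynomials\<close>

text \<open>
  All finite fields of characteristic p except the abstract copy of F_{q^m} live inside one
  algebraic closure, the type \<open>'c\<close>.  For a power n of the characteristic, \<open>gf n\<close> is the
  subfield with n elements.
\<close>

definition gf :: "nat \<Rightarrow> 'c::field set" where
  "gf n = {x. x ^ n = x}"

definition poly_over :: "'c::field set \<Rightarrow> 'c poly set" where
  "poly_over F = {f. \<forall>i. coeff f i \<in> F}"

text \<open>
  Algebraic closedness is part of the type class.  An algebraic closure of the prime field is one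
  of every finite field of the same characteristic.
\<close>
definition is_algebraic_closure_of :: "'c::alg_closed_field itself \<Rightarrow> 'c set \<Rightarrow> bool" where
  "is_algebraic_closure_of _ F \<longleftrightarrow> (\<forall>x. \<exists>f \<in> poly_over F. f \<noteq> 0 \<and> poly f x = 0)"

definition poly_A :: "nat \<Rightarrow> 'c::field poly ring" where
  "poly_A q = \<lparr>carrier = poly_over (gf q), monoid.mult = (*), one = 1, zero = 0, add = (+)\<rparr>"

text \<open>
  A skew polynomial \<open>\<Sum>i. a i \<tau>^i\<close> is stored as the ordinary polynomial with the same
  coefficients; only the multiplication differs, by \<open>a \<tau>^i b \<tau>^j = a b^(q^i) \<tau>^(i+j)\<close>.  The
  degree in \<open>\<tau>\<close> is \<^const>\<open>degree\<close>; since \<^term>\<open>degree 0 = 0\<close>, strict degree bounds that 0 must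
  satisfy are written with an explicit alternative where this matters.
\<close>

definition skew_mult :: "nat \<Rightarrow> 'c::field poly \<Rightarrow> 'c poly \<Rightarrow> 'c poly" where
  "skew_mult q f g =
     (\<Sum>i\<le>degree f. \<Sum>j\<le>degree g. monom (coeff f i * coeff g j ^ (q ^ i)) (i + j))"

definition skew_R :: "nat \<Rightarrow> nat \<Rightarrow> 'c::field poly ring" where
  "skew_R q r = \<lparr>carrier = poly_over (gf (q ^ r)), monoid.mult = skew_mult q, one = 1, zero = 0, add = (+)\<rparr>"

definition skew_eval :: "nat \<Rightarrow> 'c::field poly \<Rightarrow> 'c \<Rightarrow> 'c" where
  "skew_eval q f x = (\<Sum>i\<le>degree f. coeff f i * x ^ (q ^ i))"

definition right_rem :: "nat \<Rightarrow> nat \<Rightarrow> 'c::field poly \<Rightarrow> 'c poly \<Rightarrow> 'c poly" where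
  "right_rem q r f g =
     (THE b. b \<in> carrier (skew_R q r) \<and> (b = 0 \<or> degree b < degree g) \<and>
             (\<exists>a \<in> carrier (skew_R q r). f = skew_mult q a g + b))"

definition left_divmod :: "nat \<Rightarrow> nat \<Rightarrow> 'c::field poly \<Rightarrow> 'c poly \<Rightarrow> 'c poly \<times> 'c poly" where
  "left_divmod q r f g =
     (THE ab. fst ab \<in> carrier (skew_R q r) \<and> snd ab \<in> carrier (skew_R q r) \<and>
              (snd ab = 0 \<or> degree (snd ab) < degree g) \<and>
              f = skew_mult q g (fst ab) + snd ab)"


section \<open>The Drinfeld module and the isomorphism \<open>\<Theta>\<close>\<close>

text \<open>\<open>\<phi>_a = a(\<tau>^r)\<close>\<close>
definition drinfeld :: "nat \<Rightarrow> 'c::field poly \<Rightarrow> 'c poly" where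
  "drinfeld r a = (\<Sum>j\<le>degree a. monom (coeff a j) (r * j))"

definition torsion :: "nat \<Rightarrow> nat \<Rightarrow> 'c::field poly \<Rightarrow> 'c set" where
  "torsion q r a = {x. skew_eval q (drinfeld r a) x = 0}"

text \<open>
  \<open>h\<close> induces an isomorphism \<open>A/(a) \<cong> F_{q^m}\<close>, where \<open>F_{q^m}\<close> is the whole type \<open>'e\<close>.
\<close>
definition residue_map :: "nat \<Rightarrow> 'c::field poly \<Rightarrow> ('c poly \<Rightarrow> 'e::field) \<Rightarrow> bool" where
  "residue_map q a h \<longleftrightarrow>
     h \<in> Ring.ring_hom (poly_A q) (class_ring :: 'e ring) \<and>
     h ` carrier (poly_A q) = UNIV \<and>
     a_kernel (poly_A q) (class_ring :: 'e ring) h = PIdl\<^bsub>poly_A q\<^esub> a"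

text \<open>
  The scalar multiplication of \<open>F_{q^m} \<cong> A/(a)\<close> on the a-torsion: the class of b acts as
  \<open>\<phi>_b\<close>, whichever representative b is taken.
\<close>
definition residue_scale ::
  "nat \<Rightarrow> nat \<Rightarrow> ('c::field poly \<Rightarrow> 'e::field) \<Rightarrow> 'e \<Rightarrow> 'c \<Rightarrow> 'c" where
  "residue_scale q r h c x = skew_eval q (drinfeld r (SOME b. b \<in> carrier (poly_A q) \<and> h b = c)) x"

definition residue_comb ::
  "nat \<Rightarrow> nat \<Rightarrow> ('c::field poly \<Rightarrow> 'e::field) \<Rightarrow> (nat \<Rightarrow> 'c) \<Rightarrow> 'e vec \<Rightarrow> 'c" where
  "residue_comb q r h e v = (\<Sum>s<r. residue_scale q r h (v $ s) (e s))"

definition torsion_basis ::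
  "nat \<Rightarrow> nat \<Rightarrow> 'c::field poly \<Rightarrow> ('c poly \<Rightarrow> 'e::field) \<Rightarrow> (nat \<Rightarrow> 'c) \<Rightarrow> bool" where
  "torsion_basis q r a h e \<longleftrightarrow>
     (\<forall>s<r. e s \<in> torsion q r a) \<and>
     (\<forall>x \<in> torsion q r a. \<exists>!v. v \<in> carrier_vec r \<and> x = residue_comb q r h e v)"

text \<open>Column j holds the coordinates of the image of the j-th basis vector.\<close>
definition Theta_comp ::
  "nat \<Rightarrow> nat \<Rightarrow> ('c::field poly \<Rightarrow> 'e::field) \<Rightarrow> (nat \<Rightarrow> 'c) \<Rightarrow> 'c poly \<Rightarrow> 'e mat" where
  "Theta_comp q r h e y =
     (THE M. M \<in> carrier_mat r r \<and>
             (\<forall>j<r. skew_eval q y (e j) = residue_comb q r h e (col M j)))"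

text \<open>
  The moduli \<open>\<qq>_1, \<dots>, \<qq>_\<ell>\<close> are given as a list \<open>qs\<close>, the maps and bases as families
  indexed by \<open>{..<length qs}\<close>.
\<close>
definition Theta ::
  "nat \<Rightarrow> nat \<Rightarrow> (nat \<Rightarrow> 'c::field poly \<Rightarrow> 'e::field) \<Rightarrow> (nat \<Rightarrow> nat \<Rightarrow> 'c) \<Rightarrow> 'c poly list
     \<Rightarrow> 'e mat list" where
  "Theta q r h e ys = map (\<lambda>i. Theta_comp q r (h i) (e i) (ys ! i)) [0..<length ys]"

definition mat_tuples :: "nat \<Rightarrow> nat \<Rightarrow> 'e mat list set" where
  "mat_tuples r l = {Xs. length Xs = l \<and> set Xs \<subseteq> carrier_mat r r}"

definition wt_SR :: "nat \<Rightarrow> 'e::field mat list \<Rightarrow> nat" where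
  "wt_SR r Xs = (\<Sum>X\<leftarrow>Xs. vec_space.rank r X)"


section \<open>The skew CRT code and its decoder\<close>

definition code_params :: "nat \<Rightarrow> nat \<Rightarrow> nat \<Rightarrow> 'c::field poly list \<Rightarrow> nat \<Rightarrow> bool" where
  "code_params q r m qs t \<longleftrightarrow>
     (\<exists>n\<ge>1. q = CHAR('c) ^ n) \<and> r \<ge> 1 \<and> m \<ge> 1 \<and> length qs \<ge> 1 \<and> distinct qs \<and>
     (\<forall>a \<in> set qs. a \<in> carrier (poly_A q) \<and> lead_coeff a = 1 \<and>
        ring_irreducible\<^bsub>poly_A q\<^esub> a \<and> degree a = m \<and> a \<noteq> [:0, 1:]) \<and>
     1 \<le> t \<and> t \<le> length qs * r"

definition Pi_mod :: "nat \<Rightarrow> nat \<Rightarrow> 'c::field poly list \<Rightarrow> 'c poly" where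
  "Pi_mod q r qs = foldr (skew_mult q) (map (drinfeld r) qs) 1"

text \<open>\<open>R/(Q_i)\<close> is represented by the right remainders modulo \<open>Q_i = \<phi>_{\<qq>_i}\<close>.\<close>
definition R_Gamma :: "nat \<Rightarrow> nat \<Rightarrow> 'c::field poly list \<Rightarrow> 'c poly list set" where
  "R_Gamma q r qs =
     {ys. length ys = length qs \<and>
          (\<forall>i < length qs. ys ! i \<in> carrier (skew_R q r) \<and>
             (ys ! i = 0 \<or> degree (ys ! i) < degree (drinfeld r (qs ! i))))}"

definition CRT :: "nat \<Rightarrow> nat \<Rightarrow> 'c::field poly list \<Rightarrow> 'c poly \<Rightarrow> 'c poly list" where
  "CRT q r qs u = map (\<lambda>a. right_rem q r u (drinfeld r a)) qs"

definition CRT_lift :: "nat \<Rightarrow> nat \<Rightarrow> 'c::field poly list \<Rightarrow> 'c poly list \<Rightarrow> 'c poly" where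
  "CRT_lift q r qs ys =
     (THE Y. Y \<in> carrier (skew_R q r) \<and> degree Y < degree (Pi_mod q r qs) \<and> CRT q r qs Y = ys)"

text \<open>In this section \<open>d\<close> stands for the degree bound \<open>m \<epsilon>\<close> on v, and \<open>K\<close> for \<open>m t\<close>.\<close>

definition key_solution ::
  "nat \<Rightarrow> nat \<Rightarrow> 'c::field poly list \<Rightarrow> nat \<Rightarrow> nat \<Rightarrow> 'c poly \<Rightarrow> 'c poly \<times> 'c poly \<Rightarrow> bool" where
  "key_solution q r qs d K Y vN \<longleftrightarrow>
     (case vN of (v, N) \<Rightarrow>
        v \<in> carrier (skew_R q r) \<and> N \<in> carrier (skew_R q r) \<and> (v, N) \<noteq> (0, 0) \<and>
        (\<exists>w \<in> carrier (skew_R q r). skew_mult q v Y - N = skew_mult q w (Pi_mod q r qs)) \<and>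
        degree v \<le> d \<and> degree N \<le> d + K - 1)"

text \<open>
  The filter step may find any nonzero solution, so it is a relation between the CRT lift and
  the possible results; \<^const>\<open>None\<close> is failure.
\<close>
definition filter_step ::
  "nat \<Rightarrow> nat \<Rightarrow> 'c::field poly list \<Rightarrow> nat \<Rightarrow> nat \<Rightarrow> 'c poly \<Rightarrow> ('c poly \<times> 'c poly) option \<Rightarrow> bool"
  where
  "filter_step q r qs d K Y res \<longleftrightarrow>
     (case res of
        None \<Rightarrow> (\<nexists>vN. key_solution q r qs d K Y vN) \<or> (\<exists>N. key_solution q r qs d K Y (0, N))
      | Some (v, N) \<Rightarrow> key_solution q r qs d K Y (v, N) \<and> v \<noteq> 0)"

definition message_recovery ::
  "nat \<Rightarrow> nat \<Rightarrow> nat \<Rightarrow> 'c::field poly \<times> 'c poly \<Rightarrow> 'c poly option" where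
  "message_recovery q r K vN =
     (case vN of (v, N) \<Rightarrow>
       (let (u, \<Delta>) = left_divmod q r N v
        in if \<Delta> \<noteq> 0 \<or> degree u \<ge> K then None else Some u))"

definition verification ::
  "nat \<Rightarrow> nat \<Rightarrow> 'c::field poly list \<Rightarrow> (nat \<Rightarrow> 'c poly \<Rightarrow> 'e::field) \<Rightarrow> (nat \<Rightarrow> nat \<Rightarrow> 'c) \<Rightarrow> nat
     \<Rightarrow> 'e mat list \<Rightarrow> 'c poly \<Rightarrow> 'c poly option" where
  "verification q r qs h e \<epsilon> Ys u =
     (if wt_SR r (map2 (-) Ys (Theta q r h e (CRT q r qs u))) > \<epsilon> then None else Some u)"

text \<open>The possible outputs of the decoder; the only freedom is the choice in the filter step.\<close>
definition decoder_outputs ::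
  "nat \<Rightarrow> nat \<Rightarrow> nat \<Rightarrow> 'c::field poly list \<Rightarrow> (nat \<Rightarrow> 'c poly \<Rightarrow> 'e::field) \<Rightarrow> (nat \<Rightarrow> nat \<Rightarrow> 'c) \<Rightarrow> nat
     \<Rightarrow> nat \<Rightarrow> 'e mat list \<Rightarrow> 'c poly option set" where
  "decoder_outputs q r m qs h e \<epsilon> K Ys =
     (let y = inv_into (R_Gamma q r qs) (Theta q r h e) Ys;
          Y = CRT_lift q r qs y
      in {Option.bind (Option.bind res (message_recovery q r K)) (verification q r qs h e \<epsilon> Ys)
            | res. filter_step q r qs (m * \<epsilon>) K Y res})"


section \<open>Counting field operations\<close>

text \<open>
  Registers are indexed by natural numbers.  Field constants may be used as operands for free;
  this models precomputed data.
\<close>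
datatype (operand_consts: 'a) operand = Reg nat | Con 'a

datatype (op_consts: 'a) field_op =
    Add "'a operand" "'a operand"
  | Sub "'a operand" "'a operand"
  | Mul "'a operand" "'a operand"
  | Div "'a operand" "'a operand"
  | Frob "'a operand"

fun operand_val :: "(nat \<Rightarrow> 'a) \<Rightarrow> 'a operand \<Rightarrow> 'a" where
  "operand_val \<sigma> (Reg i) = \<sigma> i"
| "operand_val \<sigma> (Con c) = c"

fun op_val :: "nat \<Rightarrow> (nat \<Rightarrow> 'a::field) \<Rightarrow> 'a field_op \<Rightarrow> 'a" where
  "op_val q \<sigma> (Add x y) = operand_val \<sigma> x + operand_val \<sigma> y"
| "op_val q \<sigma> (Sub x y) = operand_val \<sigma> x - operand_val \<sigma> y"
| "op_val q \<sigma> (Mul x y) = operand_val \<sigma> x * operand_val \<sigma> y"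
| "op_val q \<sigma> (Div x y) = operand_val \<sigma> x / operand_val \<sigma> y"
| "op_val q \<sigma> (Frob x) = operand_val \<sigma> x ^ q"

text \<open>
  Algebraic computation trees: every field operation (an application of the q-Frobenius
  counts as one) and every zero test has cost 1.  Division by 0 yields 0, as everywhere in HOL.
\<close>
datatype (prog_consts: 'a) prog =
    Assign nat "'a field_op" "'a prog"
  | If_Zero "'a operand" "'a prog" "'a prog"
  | Return "'a operand list"
  | Fail

fun run :: "nat \<Rightarrow> 'a::field prog \<Rightarrow> (nat \<Rightarrow> 'a) \<Rightarrow> 'a list option" where
  "run q (Assign i f P) \<sigma> = run q P (\<sigma>(i := op_val q \<sigma> f))"
| "run q (If_Zero x P P') \<sigma> = (if operand_val \<sigma> x = 0 then run q P \<sigma> else run q P' \<sigma>)"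
| "run q (Return xs) \<sigma> = Some (map (operand_val \<sigma>) xs)"
| "run q Fail \<sigma> = None"

fun run_cost :: "nat \<Rightarrow> 'a::field prog \<Rightarrow> (nat \<Rightarrow> 'a) \<Rightarrow> nat" where
  "run_cost q (Assign i f P) \<sigma> = Suc (run_cost q P (\<sigma>(i := op_val q \<sigma> f)))"
| "run_cost q (If_Zero x P P') \<sigma> =
     Suc (if operand_val \<sigma> x = 0 then run_cost q P \<sigma> else run_cost q P' \<sigma>)"
| "run_cost q (Return xs) \<sigma> = 0"
| "run_cost q Fail \<sigma> = 0"

text \<open>
  A program performs the filter step if it maps the coefficients of Y, stored in registers
  \<open>0, 1, \<dots>\<close>, to the \<open>d + 1\<close> coefficients of v followed by those of N.
\<close>
definition performs_filter_step ::
  "nat \<Rightarrow> nat \<Rightarrow> 'c::field poly list \<Rightarrow> nat \<Rightarrow> nat \<Rightarrow> 'c prog \<Rightarrow> bool" where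
  "performs_filter_step q r qs d K P \<longleftrightarrow>
     prog_consts P \<subseteq> gf (q ^ r) \<and>
     (\<forall>Y \<in> carrier (skew_R q r). degree Y < degree (Pi_mod q r qs) \<longrightarrow>
        filter_step q r qs d K Y
          (map_option (\<lambda>xs. (Poly (take (d + 1) xs), Poly (drop (d + 1) xs)))
            (run q P (coeff Y))))"

text \<open>
  The exponent of matrix multiplication over a field \<open>F\<close>.  Correctness of a straight-line
  program over \<open>F\<close> is tested on matrices over the (infinite) algebraic closure \<open>'c\<close>, so the
  program computes the entries of the product as polynomials and not merely as functions
  on \<open>F\<close>, which may be finite.
\<close>
fun is_ring_op :: "'a field_op \<Rightarrow> bool" where
  "is_ring_op (Add x y) = True"
| "is_ring_op (Sub x y) = True"
| "is_ring_op (Mul x y) = True"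
| "is_ring_op (Div x y) = False"
| "is_ring_op (Frob x) = False"

text \<open>The parameter of \<^const>\<open>op_val\<close> only concerns Frobenius steps, which are excluded here.\<close>
definition run_slp :: "(nat \<times> 'a::field field_op) list \<Rightarrow> (nat \<Rightarrow> 'a) \<Rightarrow> (nat \<Rightarrow> 'a)" where
  "run_slp S = fold (\<lambda>(i, f) \<sigma>. \<sigma>(i := op_val 1 \<sigma> f)) S"

definition load_mats :: "nat \<Rightarrow> 'a::zero mat \<Rightarrow> 'a mat \<Rightarrow> nat \<Rightarrow> 'a" where
  "load_mats n A B k =
     (if k < n * n then A $$ (k div n, k mod n)
      else if k < 2 * (n * n) then B $$ ((k - n * n) div n, (k - n * n) mod n)
      else 0)"

definition slp_multiplies :: "'c::field set \<Rightarrow> nat \<Rightarrow> (nat \<times> 'c field_op) list \<Rightarrow> bool" where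
  "slp_multiplies F n S \<longleftrightarrow>
     (\<forall>f \<in> snd ` set S. is_ring_op f \<and> op_consts f \<subseteq> F) \<and>
     (\<exists>out :: nat \<Rightarrow> nat \<Rightarrow> nat. \<forall>A \<in> carrier_mat n n. \<forall>B \<in> carrier_mat n n. \<forall>i<n. \<forall>j<n.
        run_slp S (load_mats n A B) (out i j) = (A * B) $$ (i, j))"

definition matmul_cost :: "'c::field set \<Rightarrow> nat \<Rightarrow> nat" where
  "matmul_cost F n = (LEAST c. \<exists>S. slp_multiplies F n S \<and> length S = c)"

definition matmul_exponent :: "'c::field set \<Rightarrow> real" where
  "matmul_exponent F = Inf {\<tau>. (\<lambda>n. real (matmul_cost F n)) \<in> O(\<lambda>n. real n powr \<tau>)}"

end

theory Submission
  imports Defs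
begin

text \<open>
  Decoding. Restriction to the torsion makes \<open>\<Theta>\<close> multiplicative, and it is injective on skew
  polynomials of degree below \<open>N\<close> because a nonzero skew polynomial of degree \<open>d\<close> has at most
  \<open>q^d\<close> roots; by cardinality it is bijective onto the tuples of matrices.  If \<open>D = Y - u\<close>
  represents the error \<open>E\<close>, then \<open>v D\<close> represents \<open>(X_i E_i)_i\<close>, and there are only
  \<open>q^(m r wt(E))\<close> such tuples.  The pigeonhole principle yields a nonzero \<open>v\<close> of degree at most
  \<open>m wt(E)\<close> with \<open>v D = 0\<close> modulo \<open>\<Pi>\<close>, hence the solution \<open>(v, v u)\<close>.  Conversely, for any solution
  \<open>(v, n)\<close> the polynomial \<open>n - v u\<close> has degree below \<open>N - m wt(E)\<close> and represents such a tuple too;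
  were it nonzero, its left multiples would produce too many of them.

  Cost. No fast linear algebra is needed: the half-way stopped left Euclidean scheme applied to
  \<open>\<Pi>\<close> and \<open>Y\<close> solves the key equation with \<open>O(N^2)\<close> operations, and the exponent of matrix
  multiplication is at least 2 since the \<open>n^2\<close> entries of a product need as many registers.
\<close>

section \<open>Finite subfields and skew polynomials\<close>

text \<open>Coefficients lie in F_{q^r} but matrix entries in F_{q^m}, so no dimension count over
  one of these fields covers both sides of the key equation. Cardinalities replace dimensions,
  always in the same comparison: polynomials with n free coefficients number q^(r n), while the left
  multiples (X_i E_i)_i of an error of weight w number at most q^(m r w). A locator exists because n
  = m k + 1 exceeds m w. Uniqueness uses n = N - deg(D) for a difference D of degree below m k + m
  t; that this still exceeds m w is where 2 k + t \<le> l r enters. Since the filter step may return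
  any solution, every solution has to be controlled, not just one of least degree.

  For the cost, the program must be right for every \<open>Y\<close> of degree below N, also when
  the correct answer is failure. Degrees are parameters of the construction and not run-time data: a
  run only tests whether the next leading coefficient vanishes. The tree branches over all degree
  sequences and may be huge, but each path is short, and cost is measured along paths.\<close>

text \<open>The derivative of x^n - x is -1, because n is a multiple of the characteristic. Hence no
  root is repeated, and the linear factors over the algebraically closed field give n distinct
  roots.\<close>

lemma card_gf:
  assumes "CHAR('c::alg_closed_field) > 0" "n = CHAR('c) ^ k" "k \<ge> 1"
  shows "finite (gf n :: 'c set)" "card (gf n :: 'c set) = n"
proof -
  have "Factorial_Ring.prime CHAR('c)" by (rule prime_CHAR_semidom) fact
  from prime_ge_2_nat[OF this] have n2: "n \<ge> 2"
    using assms by (metis one_le_numeral order_trans power_increasing power_one_right)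
  define P :: "'c poly" where "P = monom 1 n - monom 1 1"
  have poly_P: "poly P x = x ^ n - x" for x by (simp add: P_def poly_monom)
  have degP: "degree P = n"
    unfolding P_def diff_conv_add_uminus
    using n2 by (subst degree_add_eq_left) (auto simp: degree_monom_eq)
  have P0: "P \<noteq> 0" using degP n2 by auto
  have gf: "gf n = {x. poly P x = 0}" by (auto simp: gf_def poly_P)
  have "of_nat n = (0::'c)" using assms(2,3) by (auto simp: of_nat_eq_0_iff_char_dvd)
  then have pd: "pderiv P = -1"
    by (simp add: P_def pderiv_diff pderiv_monom one_pCons monom_0)
  obtain A where A: "size A = degree P" "P = Polynomial.smult (lead_coeff P) (\<Prod>x\<in>#A. [:-x, 1:])"
    using alg_closed_imp_factorization[OF P0] by blast
  have "proots P = proots (\<Prod>p\<in>#image_mset (\<lambda>x. [:-x, 1:]) A. p)"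
    by (subst A(2)) (use P0 in simp)
  also have "\<dots> = A" by (subst proots_prod_mset) (auto simp: image_mset.compositionality o_def)
  finally have A_eq: "proots P = A" .
  have le1: "count A x \<le> 1" for x
  proof (rule ccontr)
    assume "\<not> count A x \<le> 1"
    then have "\<not> order x P \<le> 1" using P0 by (simp flip: A_eq)
    then have "[:-x,1:]^2 dvd P" by (subst order_divides) auto
    then obtain B where "P = [:-x,1:] * ([:-x,1:] * B)"
      by (auto simp only: power2_eq_square mult.assoc elim: dvdE)
    then have "poly (pderiv P) x = 0" by (simp only: pderiv_mult poly_add poly_mult) simp
    then show False by (simp add: pd)
  qed
  have "A = mset_set (set_mset A)"
  proof (rule multiset_eqI)
    fix x
    show "count A x = count (mset_set (set_mset A)) x"
      using le1[of x] by (cases "x \<in># A") (auto simp: not_in_iff le_Suc_eq simp flip: count_greater_zero_iff)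
  qed
  then have "card (set_mset A) = n" using A(1) degP by (metis size_mset_set)
  then show "finite (gf n :: 'c set)" "card (gf n :: 'c set) = n"
    using P0 by (simp_all add: gf poly_roots_finite flip: A_eq)
qed

locale skew_ring =
  fixes q r :: nat and ty :: "'c::field itself"
  assumes char_pos: "CHAR('c) > 0"
    and q_eq: "\<exists>n\<ge>1. q = CHAR('c) ^ n"
    and r_pos: "r \<ge> 1"
begin

abbreviation skm :: "'c poly \<Rightarrow> 'c poly \<Rightarrow> 'c poly" (infixl "\<star>" 70) where
  "f \<star> g \<equiv> skew_mult q f g"

abbreviation Fq :: "'c set" where "Fq \<equiv> gf q"
abbreviation Fqr :: "'c set" where "Fqr \<equiv> gf (q ^ r)"
abbreviation A :: "'c poly set" where "A \<equiv> poly_over Fq"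
abbreviation R :: "'c poly set" where "R \<equiv> poly_over Fqr"

lemma q_ge_2: "q \<ge> 2"
proof -
  have "Factorial_Ring.prime CHAR('c)" by (rule prime_CHAR_semidom) (rule char_pos)
  from prime_ge_2_nat[OF this] show ?thesis
    using q_eq by (metis one_le_numeral order_trans power_increasing power_one_right)
qed

lemma q_pos [simp]: "0 < q"
  using q_ge_2 by simp

lemma q_power_char: "\<exists>n. q ^ i = CHAR('c) ^ n"
  using q_eq by (metis power_mult)

lemma frob_add: "(x + y :: 'c) ^ q ^ i = x ^ q ^ i + y ^ q ^ i"
  using q_power_char[of i] freshmans_dream'[OF prime_CHAR_semidom[OF char_pos]] by blast

lemma frob_sum: "(sum f B :: 'c) ^ q ^ i = (\<Sum>x\<in>B. f x ^ q ^ i)"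
  using q_power_char[of i] freshmans_dream_sum'[OF prime_CHAR_semidom[OF char_pos]] by blast

lemma frob_zero [simp]: "(0::'c) ^ q ^ i = 0"
  using q_ge_2 by (simp add: zero_power)

lemma frob_uminus: "(- x :: 'c) ^ q ^ i = - (x ^ q ^ i)"
  using frob_add[of x "- x" i] by (simp add: eq_neg_iff_add_eq_0 add.commute)

lemma frob_diff: "(x - y :: 'c) ^ q ^ i = x ^ q ^ i - y ^ q ^ i"
  using frob_add[of x "- y" i] by (simp add: frob_uminus)

lemma frob_frob: "((x::'c) ^ q ^ i) ^ q ^ j = x ^ q ^ (i + j)"
  by (simp add: power_add power_mult)

text \<open>Removes the degree bounds from the defining double sum. With this twisted convolution
  the ring laws become comparisons of coefficients without case distinctions on degrees.\<close>

lemma coeff_skm: "coeff (f \<star> g) n = (\<Sum>i\<le>n. coeff f i * coeff g (n - i) ^ q ^ i)"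
proof -
  have "coeff (f \<star> g) n = (\<Sum>i\<le>degree f. \<Sum>j\<le>degree g.
      if i + j = n then coeff f i * coeff g j ^ q ^ i else 0)"
    by (simp add: skew_mult_def coeff_sum coeff_monom)
  also have "\<dots> = (\<Sum>i\<le>degree f. if i \<le> n then coeff f i * coeff g (n - i) ^ q ^ i else 0)"
  proof (intro sum.cong refl)
    fix i
    have "(\<Sum>j\<le>degree g. if i + j = n then coeff f i * coeff g j ^ q ^ i else 0)
        = (\<Sum>j\<le>degree g. if j = n - i then if i \<le> n then coeff f i * coeff g j ^ q ^ i else 0 else 0)"
      by (intro sum.cong) auto
    also have "\<dots> = (if i \<le> n then coeff f i * coeff g (n - i) ^ q ^ i else 0)"
      by (auto simp: coeff_eq_0 not_le)
    finally show "(\<Sum>j\<le>degree g. if i + j = n then coeff f i * coeff g j ^ q ^ i else 0)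
      = (if i \<le> n then coeff f i * coeff g (n - i) ^ q ^ i else 0)" .
  qed
  also have "\<dots> = (\<Sum>i\<in>{..degree f} \<inter> {..n}. coeff f i * coeff g (n - i) ^ q ^ i)"
    by (simp only: sum.inter_restrict finite_atMost atMost_iff)
  also have "\<dots> = (\<Sum>i\<le>n. coeff f i * coeff g (n - i) ^ q ^ i)"
    by (intro sum.mono_neutral_left) (auto simp: coeff_eq_0)
  finally show ?thesis .
qed

lemma skm_add_left: "(f + g) \<star> h = f \<star> h + g \<star> h"
  by (rule poly_eqI) (simp add: coeff_skm distrib_right sum.distrib)

lemma skm_add_right: "h \<star> (f + g) = h \<star> f + h \<star> g"
  by (rule poly_eqI) (simp add: coeff_skm frob_add distrib_left sum.distrib)

lemma skm_diff_left: "(f - g) \<star> h = f \<star> h - g \<star> h"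
  by (rule poly_eqI) (simp add: coeff_skm left_diff_distrib sum_subtractf)

lemma skm_diff_right: "h \<star> (f - g) = h \<star> f - h \<star> g"
  by (rule poly_eqI) (simp add: coeff_skm frob_diff right_diff_distrib sum_subtractf)

lemma skm_zero [simp]: "0 \<star> f = 0" "f \<star> 0 = 0"
  by (auto intro!: poly_eqI simp: coeff_skm)

lemma coeff_monom_skm: "coeff (monom c k \<star> f) n = (if k \<le> n then c * coeff f (n - k) ^ q ^ k else 0)"
proof -
  have "coeff (monom c k \<star> f) n = (\<Sum>i\<le>n. if i = k then c * coeff f (n - k) ^ q ^ k else 0)"
    unfolding coeff_skm by (intro sum.cong) (auto simp: coeff_monom)
  then show ?thesis by auto
qed

lemma coeff_skm_monom: "coeff (f \<star> monom c k) n = (if k \<le> n then coeff f (n - k) * c ^ q ^ (n - k) else 0)"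
proof -
  have "coeff (f \<star> monom c k) n = (\<Sum>i\<le>n. if i = n - k \<and> k \<le> n then coeff f i * c ^ q ^ i else 0)"
    unfolding coeff_skm by (intro sum.cong) (auto simp: coeff_monom)
  also have "\<dots> = (if k \<le> n then coeff f (n - k) * c ^ q ^ (n - k) else 0)"
    by (cases "k \<le> n") auto
  finally show ?thesis .
qed

lemma skm_one [simp]: "1 \<star> f = f" "f \<star> 1 = f"
  using coeff_monom_skm[of 1 0 f] coeff_skm_monom[of f 1 0] by (auto intro!: poly_eqI)

text \<open>Both sides are sums over i + j + k = n of f_i g_j^(q^i) h_k^(q^(i+j)); triangle
  reindexing and the additivity of Frobenius bring them to this form.\<close>

lemma skm_assoc: "(f \<star> g) \<star> h = f \<star> (g \<star> h)"
proof (rule poly_eqI)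
  fix n
  have "coeff ((f \<star> g) \<star> h) n = (\<Sum>j\<le>n. \<Sum>i\<le>j. coeff f i * coeff g (j - i) ^ q ^ i *
      coeff h (n - j) ^ q ^ (i + (j - i)))"
    by (simp add: coeff_skm sum_distrib_right)
  also have "\<dots> = (\<Sum>j\<le>n. \<Sum>i\<le>n - j. coeff f j * coeff g i ^ q ^ j * coeff h (n - j - i) ^ q ^ (j + i))"
  proof -
    define F where "F i j = coeff f i * coeff g j ^ q ^ i * coeff h (n - i - j) ^ q ^ (i + j)" for i j
    have "(\<Sum>j\<le>n. \<Sum>i\<le>j. F i (j - i)) = (\<Sum>(i,j)\<in>{(i,j). i + j \<le> n}. F i j)"
      by (rule sum.triangle_reindex_eq[symmetric])
    also have "{(i,j). i + j \<le> n} = Sigma {..n} (\<lambda>i. {..n - i})" by auto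
    also have "(\<Sum>(i,j)\<in>Sigma {..n} (\<lambda>i. {..n - i}). F i j) = (\<Sum>i\<le>n. \<Sum>j\<le>n - i. F i j)"
      by (simp add: sum.Sigma)
    finally show ?thesis by (simp add: F_def)
  qed
  also have "\<dots> = coeff (f \<star> (g \<star> h)) n"
    by (simp add: coeff_skm frob_sum sum_distrib_left power_mult_distrib frob_frob mult.assoc add.commute)
  finally show "coeff ((f \<star> g) \<star> h) n = coeff (f \<star> (g \<star> h)) n" .
qed

lemma coeff_skm_degree_sum:
  "coeff (f \<star> g) (degree f + degree g) = lead_coeff f * lead_coeff g ^ q ^ degree f"
proof -
  have "coeff (f \<star> g) (degree f + degree g) =
      (\<Sum>i\<le>degree f + degree g. if i = degree f then lead_coeff f * lead_coeff g ^ q ^ degree f else 0)"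
    unfolding coeff_skm
  proof (intro sum.cong refl)
    fix i
    show "coeff f i * coeff g (degree f + degree g - i) ^ q ^ i
      = (if i = degree f then lead_coeff f * lead_coeff g ^ q ^ degree f else 0)"
      by (cases i "degree f" rule: linorder_cases) (auto simp: coeff_eq_0)
  qed
  then show ?thesis by simp
qed

lemma degree_skm_le: "degree (f \<star> g) \<le> degree f + degree g"
proof (rule degree_le, intro allI impI)
  fix n assume n: "degree f + degree g < n"
  have "coeff f i * coeff g (n - i) ^ q ^ i = 0" if "i \<le> n" for i
    using n that by (cases "i \<le> degree f") (auto simp: coeff_eq_0)
  then show "coeff (f \<star> g) n = 0" unfolding coeff_skm by (intro sum.neutral) auto
qed

lemma degree_skm: "f \<noteq> 0 \<Longrightarrow> g \<noteq> 0 \<Longrightarrow> degree (f \<star> g) = degree f + degree g"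
  using coeff_skm_degree_sum[of f g] by (intro antisym degree_skm_le le_degree) simp

lemma skm_eq_0_iff [simp]: "f \<star> g = 0 \<longleftrightarrow> f = 0 \<or> g = 0"
  using coeff_skm_degree_sum[of f g] by fastforce

section \<open>The finite subfields and the coefficient-restricted rings \<open>A\<close> and
  \<open>R\<close>\<close>

lemma gf_zero [simp]: "(0::'c) \<in> gf (q ^ k)" and gf_one [simp]: "(1::'c) \<in> gf (q ^ k)"
  and gf_add: "(x::'c) \<in> gf (q ^ k) \<Longrightarrow> y \<in> gf (q ^ k) \<Longrightarrow> x + y \<in> gf (q ^ k)"
  and gf_diff: "(x::'c) \<in> gf (q ^ k) \<Longrightarrow> y \<in> gf (q ^ k) \<Longrightarrow> x - y \<in> gf (q ^ k)"
  and gf_mult: "(x::'c) \<in> gf (q ^ k) \<Longrightarrow> y \<in> gf (q ^ k) \<Longrightarrow> x * y \<in> gf (q ^ k)"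
  and gf_divide: "(x::'c) \<in> gf (q ^ k) \<Longrightarrow> y \<in> gf (q ^ k) \<Longrightarrow> x / y \<in> gf (q ^ k)"
  and gf_power: "(x::'c) \<in> gf (q ^ k) \<Longrightarrow> x ^ j \<in> gf (q ^ k)"
  by (simp_all add: gf_def frob_add frob_diff power_mult_distrib power_divide)
    (metis mult.commute power_mult)

lemma gf_sum: "(\<And>i. i \<in> B \<Longrightarrow> (f i::'c) \<in> gf (q ^ k)) \<Longrightarrow> sum f B \<in> gf (q ^ k)"
  by (induction B rule: infinite_finite_induct) (auto intro: gf_add)

lemma Fq_frob: "x \<in> Fq \<Longrightarrow> x ^ q ^ i = x"
  by (induction i) (auto simp: gf_def power_mult)

lemma Fqr_frob: "x \<in> Fqr \<Longrightarrow> x ^ q ^ (r * j) = x"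
  by (induction j) (auto simp: gf_def power_add power_mult)

lemma Fq_subset: "Fq \<subseteq> Fqr"
  using Fq_frob by (auto simp: gf_def)

lemma A_subset_R: "A \<subseteq> R"
  using Fq_subset by (auto simp: poly_over_def)

lemma R_coeff: "f \<in> R \<Longrightarrow> coeff f i \<in> Fqr"
  by (simp add: poly_over_def)

lemma R_closed [intro, simp]:
  "0 \<in> R" "1 \<in> R" "f \<in> R \<Longrightarrow> g \<in> R \<Longrightarrow> f + g \<in> R" "f \<in> R \<Longrightarrow> g \<in> R \<Longrightarrow> f - g \<in> R"
  "f \<in> R \<Longrightarrow> g \<in> R \<Longrightarrow> f \<star> g \<in> R" "c \<in> Fqr \<Longrightarrow> monom c k \<in> R"
  by (auto simp: poly_over_def coeff_skm coeff_monom coeff_1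
      intro!: gf_add gf_diff gf_sum gf_mult gf_power)

lemma R_uminus [intro, simp]: "f \<in> R \<Longrightarrow> - f \<in> R"
  using R_closed(4)[of 0 f] by simp

lemma A_closed [intro, simp]:
  "0 \<in> A" "1 \<in> A" "f \<in> A \<Longrightarrow> g \<in> A \<Longrightarrow> f + g \<in> A" "f \<in> A \<Longrightarrow> g \<in> A \<Longrightarrow> f - g \<in> A"
  "f \<in> A \<Longrightarrow> g \<in> A \<Longrightarrow> f * g \<in> A"
  using gf_zero[of 1] gf_one[of 1] gf_add[of _ 1] gf_diff[of _ 1] gf_mult[of _ 1] gf_sum[of _ _ 1]
  by (auto simp: poly_over_def coeff_mult coeff_1 intro!: gf_sum[where k = 1, simplified])

lemma A_prod_list: "set fs \<subseteq> A \<Longrightarrow> prod_list fs \<in> A"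
  by (induction fs) auto

lemma carriers [simp]: "carrier (skew_R q r) = R" "carrier (poly_A q) = A"
  by (simp_all add: skew_R_def poly_A_def)

text \<open>Leading terms are cancelled by c \<tau>^k g. Moving \<tau>^k past the leading
  coefficient of g raises it to the power q^k, so c has to be divided by that power.\<close>

lemma right_division:
  assumes "f \<in> R" "g \<in> R" "g \<noteq> 0"
  shows "\<exists>a\<in>R. \<exists>b\<in>R. f = a \<star> g + b \<and> (b = 0 \<or> degree b < degree g)"
  using assms(1)
proof (induction "degree f" arbitrary: f rule: less_induct)
  case less
  show ?case
  proof (cases "f = 0 \<or> degree f < degree g")
    case True
    then show ?thesis using less.prems by (intro bexI[of _ 0] bexI[of _ f]) auto
  next
    case False
    define k where "k = degree f - degree g"
    define c where "c = lead_coeff f / lead_coeff g ^ q ^ k"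
    define f' where "f' = f - monom c k \<star> g"
    have c: "c \<in> Fqr" unfolding c_def using less.prems assms(2) by (auto intro!: gf_divide gf_power R_coeff)
    have f': "f' \<in> R" unfolding f'_def using less.prems assms(2) c by auto
    have "degree (monom c k \<star> g) \<le> degree f"
      using degree_skm_le[of "monom c k" g] degree_monom_le[of c k] False by (auto simp: k_def)
    then have d: "degree f' \<le> degree f" unfolding f'_def by (intro degree_diff_le) auto
    have lc0: "coeff f' (degree f) = 0"
      using False assms(3) by (auto simp: f'_def coeff_monom_skm k_def c_def)
    have "f' = 0 \<or> degree f' < degree f"
    proof (cases "degree f' = degree f")
      case True
      then show ?thesis using lc0 by (metis leading_coeff_0_iff)
    qed (use d in simp)
    then obtain a b where ab: "a \<in> R" "b \<in> R" "f' = a \<star> g + b" "b = 0 \<or> degree b < degree g"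
    proof
      assume "f' = 0" then show ?thesis using that[of 0 0] by auto
    next
      assume "degree f' < degree f"
      then show ?thesis using less.hyps[of f'] f' that by blast
    qed
    then show ?thesis using c
      by (intro bexI[of _ "a + monom c k"] bexI[of _ b]) (auto simp: f'_def skm_add_left algebra_simps)
  qed
qed

lemma right_division_unique:
  assumes "a \<star> g + b = a' \<star> g + b'" "g \<noteq> 0"
    "b = 0 \<or> degree b < degree g" "b' = 0 \<or> degree b' < degree g"
  shows "a = a'" "b = b'"
proof -
  have eq: "(a - a') \<star> g = b' - b" using assms(1) by (simp add: skm_diff_left algebra_simps)
  show "a = a'"
  proof (rule ccontr)
    assume ne: "a \<noteq> a'"
    then have "b' - b \<noteq> 0" using eq assms(2) by (metis eq_iff_diff_eq_0 skm_eq_0_iff)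
    then have "degree (b' - b) < degree g"
      using assms(3,4) degree_diff_less[of b' "degree g" b] by (cases "b = 0"; cases "b' = 0") auto
    moreover have "degree g \<le> degree (b' - b)"
      unfolding eq[symmetric] using ne assms(2) by (simp add: degree_skm)
    ultimately show False by simp
  qed
  then show "b = b'" using assms(1) by simp
qed

lemma right_rem:
  assumes "f \<in> R" "g \<in> R" "g \<noteq> 0"
  shows "right_rem q r f g \<in> R" "right_rem q r f g = 0 \<or> degree (right_rem q r f g) < degree g"
    "\<exists>a\<in>R. f = a \<star> g + right_rem q r f g"
proof -
  have "\<exists>!b. b \<in> R \<and> (b = 0 \<or> degree b < degree g) \<and> (\<exists>a\<in>R. f = a \<star> g + b)"
    using right_division[OF assms] right_division_unique(2)[OF _ assms(3)] by metis
  from theI'[OF this] show "right_rem q r f g \<in> R"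
    "right_rem q r f g = 0 \<or> degree (right_rem q r f g) < degree g"
    "\<exists>a\<in>R. f = a \<star> g + right_rem q r f g"
    unfolding right_rem_def carriers by auto
qed

text \<open>Solutions of the key equation turn out to be of the form
  \<open>(v, v \<star> u)\<close>, so message recovery always meets an exact left multiple.
  Comparing degrees shows that no other pair fits the description.\<close>

lemma left_divmod_mult:
  assumes "v \<in> R" "v \<noteq> 0" "u \<in> R"
  shows "left_divmod q r (v \<star> u) v = (u, 0)"
  unfolding left_divmod_def
proof (rule the_equality)
  fix ab
  assume *: "fst ab \<in> carrier (skew_R q r) \<and> snd ab \<in> carrier (skew_R q r) \<and>
    (snd ab = 0 \<or> degree (snd ab) < degree v) \<and> v \<star> u = v \<star> fst ab + snd ab"
  then have eq: "v \<star> (u - fst ab) = snd ab" by (simp add: skm_diff_right)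
  have "u = fst ab"
  proof (rule ccontr)
    assume ne: "u \<noteq> fst ab"
    then have "snd ab \<noteq> 0" using eq assms(2) by (metis eq_iff_diff_eq_0 skm_eq_0_iff)
    then show False using * ne assms(2) degree_skm[of v "u - fst ab"] by (simp add: eq)
  qed
  then show "ab = (u, 0)" using * by (cases ab) auto
qed (use assms in auto)

section \<open>Central elements and the action on the algebraic closure\<close>

lemma coeff_drinfeld:
  "coeff (drinfeld r a) n = (if r dvd n then coeff a (n div r) else 0)"
proof -
  have "coeff (drinfeld r a) n = (\<Sum>j\<le>degree a. if j = n div r \<and> r dvd n then coeff a j else 0)"
    using r_pos by (auto simp: drinfeld_def coeff_sum coeff_monom intro!: sum.cong)
  also have "\<dots> = (if r dvd n then coeff a (n div r) else 0)"
    by (auto simp: coeff_eq_0)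
  finally show ?thesis .
qed

lemma drinfeld_in_R [intro, simp]: "a \<in> A \<Longrightarrow> drinfeld r a \<in> R"
  using A_subset_R by (auto simp: poly_over_def coeff_drinfeld)

lemma drinfeld_add: "drinfeld r (a + b) = drinfeld r a + drinfeld r b"
  by (rule poly_eqI) (simp add: coeff_drinfeld)

lemma drinfeld_diff: "drinfeld r (a - b) = drinfeld r a - drinfeld r b"
  by (rule poly_eqI) (simp add: coeff_drinfeld)

lemma drinfeld_one [simp]: "drinfeld r 1 = 1"
  by (rule poly_eqI) (use r_pos in \<open>auto simp: coeff_drinfeld coeff_1\<close>)

lemma drinfeld_0 [simp]: "drinfeld r 0 = 0"
  by (rule poly_eqI) (auto simp: coeff_drinfeld)

lemma degree_drinfeld: "degree (drinfeld r a) = r * degree a"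
proof (cases "a = 0")
  case False
  show ?thesis
  proof (rule antisym)
    show "degree (drinfeld r a) \<le> r * degree a"
      using r_pos by (intro degree_le allI impI) (auto simp: coeff_drinfeld coeff_eq_0)
    show "r * degree a \<le> degree (drinfeld r a)"
      using r_pos False by (intro le_degree) (auto simp: coeff_drinfeld)
  qed
qed simp

lemma drinfeld_eq_0_iff [simp]: "drinfeld r a = 0 \<longleftrightarrow> a = 0"
proof
  assume *: "drinfeld r a = 0"
  have "coeff a n = coeff (drinfeld r a) (r * n)" for n
    using r_pos by (simp add: coeff_drinfeld)
  then show "a = 0" using * by (simp add: poly_eqI)
qed simp

text \<open>Together with its mirror image below: both products become sums over the same index j of
  multiples r j, so that centrality can be checked term by term.\<close>

lemma coeff_drinfeld_skm:
  "coeff (drinfeld r a \<star> f) n = (\<Sum>j\<le>n div r. coeff a j * coeff f (n - r * j) ^ q ^ (r * j))"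
proof -
  have "coeff (drinfeld r a \<star> f) n = (\<Sum>i\<in>{i. i \<le> n \<and> r dvd i}. coeff a (i div r) * coeff f (n - i) ^ q ^ i)"
    unfolding coeff_skm by (intro sum.mono_neutral_cong_right) (auto simp: coeff_drinfeld)
  also have "\<dots> = (\<Sum>j\<le>n div r. coeff a j * coeff f (n - r * j) ^ q ^ (r * j))"
    by (rule sum.reindex_bij_witness[of _ "\<lambda>j. r * j" "\<lambda>i. i div r"])
      (use r_pos in \<open>auto simp: div_le_mono less_eq_div_iff_mult_less_eq mult.commute\<close>)
  finally show ?thesis .
qed

lemma coeff_skm_drinfeld:
  "coeff (f \<star> drinfeld r a) n = (\<Sum>j\<le>n div r. coeff f (n - r * j) * coeff a j ^ q ^ (n - r * j))"
proof -
  have "coeff (f \<star> drinfeld r a) n = (\<Sum>i\<le>n. coeff f (n - i) * coeff (drinfeld r a) i ^ q ^ (n - i))"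
    unfolding coeff_skm by (rule sum.reindex_bij_witness[of _ "\<lambda>i. n - i" "\<lambda>i. n - i"]) auto
  also have "\<dots> = (\<Sum>i\<in>{i. i \<le> n \<and> r dvd i}. coeff f (n - i) * coeff a (i div r) ^ q ^ (n - i))"
    by (intro sum.mono_neutral_cong_right) (auto simp: coeff_drinfeld)
  also have "\<dots> = (\<Sum>j\<le>n div r. coeff f (n - r * j) * coeff a j ^ q ^ (n - r * j))"
    by (rule sum.reindex_bij_witness[of _ "\<lambda>j. r * j" "\<lambda>i. i div r"])
      (use r_pos in \<open>auto simp: div_le_mono less_eq_div_iff_mult_less_eq mult.commute\<close>)
  finally show ?thesis .
qed

text \<open>Two invariances meet here: the coefficients of a lie in F_q and are fixed by every power
  of \<tau>, and \<tau>^(r j) fixes the coefficients of f in F_{q^r}.\<close>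

lemma drinfeld_central: "a \<in> A \<Longrightarrow> f \<in> R \<Longrightarrow> drinfeld r a \<star> f = f \<star> drinfeld r a"
  by (rule poly_eqI, unfold coeff_drinfeld_skm coeff_skm_drinfeld, intro sum.cong)
    (auto simp: poly_over_def Fq_frob Fqr_frob mult.commute[of "coeff a _"])

text \<open>Frobenius powers fix the coefficients of b, so the twisted convolution is the ordinary
  one. At exponents not divisible by r one of the two factors in each term vanishes.\<close>

lemma drinfeld_mult:
  assumes "a \<in> A" "b \<in> A"
  shows "drinfeld r (a * b) = drinfeld r a \<star> drinfeld r b"
proof (rule poly_eqI)
  fix n
  show "coeff (drinfeld r (a * b)) n = coeff (drinfeld r a \<star> drinfeld r b) n"
  proof (cases "r dvd n")
    case True
    then obtain k where n: "n = r * k" by auto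
    have "n - r * j = r * (k - j)" for j by (simp add: n diff_mult_distrib2)
    then show ?thesis using r_pos assms
      by (auto simp: coeff_drinfeld_skm coeff_drinfeld coeff_mult n poly_over_def Fq_frob intro!: sum.cong)
  next
    case False
    have "\<not> r dvd n - r * j" if "j \<le> n div r" for j
    proof -
      have "r * j \<le> n" using that by (metis dual_order.trans mult_le_mono2 times_div_less_eq_dividend)
      then show ?thesis using False by (metis dvd_add_right_iff dvd_triv_left le_add_diff_inverse)
    qed
    then show ?thesis using False by (simp add: coeff_drinfeld_skm coeff_drinfeld)
  qed
qed

text \<open>Moves the modulus into the commutative ring F_q[T], where factors can be reordered and
  degrees simply add.\<close>

lemma Pi_mod_eq: "set qs \<subseteq> A \<Longrightarrow> Pi_mod q r qs = drinfeld r (prod_list qs)"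
  by (induction qs) (auto simp: Pi_mod_def drinfeld_mult A_prod_list)

lemma degree_Pi_mod:
  assumes "set qs \<subseteq> A" "\<forall>a\<in>set qs. degree a = m \<and> a \<noteq> 0"
  shows "degree (Pi_mod q r qs) = m * length qs * r"
proof -
  have "degree (prod_list qs) = m * length qs"
    using assms(2) by (induction qs) (auto simp: degree_mult_eq prod_list_zero_iff)
  then show ?thesis by (simp add: Pi_mod_eq[OF assms(1)] degree_drinfeld)
qed

section \<open>Skew polynomials as additive maps on the field\<close>

lemma skew_eval_extend: "degree f \<le> n \<Longrightarrow> skew_eval q f x = (\<Sum>i\<le>n. coeff f i * x ^ q ^ i)" for x :: 'c
  unfolding skew_eval_def by (intro sum.mono_neutral_left) (auto simp: coeff_eq_0)

lemma eval_add_left: "skew_eval q (f + g) (x::'c) = skew_eval q f x + skew_eval q g x"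
  using skew_eval_extend[of _ "max (degree f) (degree g)" x] degree_add_le_max[of f g]
  by (simp add: distrib_right sum.distrib)

lemma eval_diff_left: "skew_eval q (f - g) (x::'c) = skew_eval q f x - skew_eval q g x"
  using eval_add_left[of "f - g" g x] by simp

lemma eval_add: "skew_eval q f (x + y :: 'c) = skew_eval q f x + skew_eval q f y"
  by (simp add: skew_eval_def frob_add distrib_left sum.distrib)

lemma eval_zero [simp]: "skew_eval q f (0::'c) = 0" "skew_eval q 0 (x::'c) = 0"
  by (simp_all add: skew_eval_def)

lemma eval_sum: "skew_eval q f (sum g B :: 'c) = (\<Sum>x\<in>B. skew_eval q f (g x))"
  by (induction B rule: infinite_finite_induct) (auto simp: eval_add)

lemma eval_monom: "skew_eval q (monom c k) (x::'c) = c * x ^ q ^ k"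
proof -
  have "skew_eval q (monom c k) x = (\<Sum>i\<le>k. if i = k then c * x ^ q ^ k else 0)"
    unfolding skew_eval_extend[OF degree_monom_le[of c k]] by (intro sum.cong) (auto simp: coeff_monom)
  then show ?thesis by simp
qed

text \<open>The twist in the product is the one produced by composing x \<mapsto> a x^(q^i) with x
  \<mapsto> b x^(q^j); additivity of Frobenius extends this from monomials to sums.\<close>

lemma eval_skm: "skew_eval q (f \<star> g) (x::'c) = skew_eval q f (skew_eval q g x)"
proof -
  let ?a = "degree f" and ?b = "degree g"
  have "skew_eval q (f \<star> g) x = (\<Sum>i\<le>?a. \<Sum>j\<le>?b. skew_eval q (monom (coeff f i * coeff g j ^ q ^ i) (i + j)) x)"
  proof -
    have *: "skew_eval q (sum F B) x = (\<Sum>i\<in>B. skew_eval q (F i) x)" for F and B :: "nat set"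
      by (induction B rule: infinite_finite_induct) (auto simp: eval_add_left)
    show ?thesis by (simp add: skew_mult_def *)
  qed
  also have "\<dots> = skew_eval q f (skew_eval q g x)"
    unfolding eval_monom by (simp add: skew_eval_def frob_sum power_mult_distrib frob_frob sum_distrib_left mult.assoc add.commute)
  finally show ?thesis .
qed

text \<open>Evaluation is that of an ordinary polynomial with exponents q^i. These exponents are
  distinct, so the leading coefficient survives and the usual root bound applies.\<close>

lemma card_eval_roots:
  assumes "f \<noteq> 0"
  shows "finite {x::'c. skew_eval q f x = 0}" "card {x::'c. skew_eval q f x = 0} \<le> q ^ degree f"
proof -
  define P where "P = (\<Sum>i\<le>degree f. monom (coeff f i) (q ^ i))"
  have poly_P: "poly P x = skew_eval q f x" for x
    by (simp add: P_def skew_eval_def poly_sum poly_monom)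
  have inj: "q ^ i = q ^ j \<longleftrightarrow> i = j" for i j using q_ge_2 by (intro power_inject_exp) auto
  have "coeff P (q ^ degree f) = lead_coeff f"
    by (simp add: P_def coeff_sum coeff_monom inj)
  then have P0: "P \<noteq> 0" using assms by (metis coeff_0 leading_coeff_0_iff)
  have "degree P \<le> q ^ degree f"
    unfolding P_def
    by (intro degree_sum_le order.trans[OF degree_monom_le] power_increasing) (use q_ge_2 in auto)
  then show "finite {x::'c. skew_eval q f x = 0}" "card {x::'c. skew_eval q f x = 0} \<le> q ^ degree f"
    using card_poly_roots_bound[OF P0] poly_roots_finite[OF P0] by (simp_all add: poly_P)
qed

end

section \<open>The exponent of matrix multiplication is at least 2\<close>

lemma run_slp_unwritten: "k \<notin> fst ` set S \<Longrightarrow> run_slp S \<sigma> k = \<sigma> k"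
proof (induction S arbitrary: \<sigma>)
  case (Cons a S)
  then show ?case by (cases a) (auto simp: run_slp_def)
qed (simp add: run_slp_def)

text \<open>Output registers are pairwise distinct, since a product with a single entry 1 separates
  any two positions. Each of them must be written: an unwritten one would still hold an input entry
  or 0, which is not an entry of the product.\<close>

lemma slp_multiplies_length:
  assumes "slp_multiplies F n (S :: (nat \<times> 'c::field field_op) list)"
  shows "n * n \<le> length S"
proof -
  obtain out :: "nat \<Rightarrow> nat \<Rightarrow> nat" where out: "\<And>A B i j. A \<in> carrier_mat n n \<Longrightarrow> B \<in> carrier_mat n n \<Longrightarrow>
      i < n \<Longrightarrow> j < n \<Longrightarrow> run_slp S (load_mats n A B) (out i j) = (A * B) $$ (i, j)"
    using assms unfolding slp_multiplies_def by blast
  define J :: "'c mat" where "J = mat n n (\<lambda>_. 1)"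
  have J: "J \<in> carrier_mat n n" "\<And>i j. i < n \<Longrightarrow> j < n \<Longrightarrow> J $$ (i, j) = 1" by (auto simp: J_def)
  have inj: "inj_on (\<lambda>(i,j). out i j) ({..<n} \<times> {..<n})"
  proof (rule inj_onI, clarify)
    fix i j i' j' assume *: "i < n" "j < n" "i' < n" "j' < n" "out i j = out i' j'"
    define E :: "'c mat" where "E = mat n n (\<lambda>ab. if ab = (i, j) then 1 else 0)"
    have E: "E \<in> carrier_mat n n" by (simp add: E_def)
    have "(1\<^sub>m n * E) $$ (i, j) = (1\<^sub>m n * E) $$ (i', j')"
      using out[OF _ E, of "1\<^sub>m n"] * by (metis one_carrier_mat)
    then have "(i', j') = (i, j)" using E * by (auto simp: E_def split: if_splits)
    then show "i = i' \<and> j = j'" by simp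
  qed
  have "out i j \<in> fst ` set S" if ij: "i < n" "j < n" for i j
  proof (rule ccontr)
    let ?k = "out i j"
    assume "?k \<notin> fst ` set S"
    then have val: "load_mats n A B ?k = (A * B) $$ (i, j)"
      if "A \<in> carrier_mat n n" "B \<in> carrier_mat n n" for A B :: "'c mat"
      using out[OF that ij] by (simp add: run_slp_unwritten)
    \<comment> \<open>The register belongs to the left factor, to the right factor, or to neither.
      The pairs (J, 0), (0, J) and (1, J) with the all-ones matrix J refute the three cases.\<close>
    consider "?k < n * n" | "n * n \<le> ?k" "?k < 2 * (n * n)" | "2 * (n * n) \<le> ?k" by linarith
    then show False
    proof cases
      case 1
      then have "?k div n < n" "?k mod n < n" using ij by (auto simp: less_mult_imp_div_less)
      then show False using val[OF J(1) zero_carrier_mat] 1 ij J by (simp add: load_mats_def)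
    next
      case 2
      then have "(?k - n * n) div n < n" "(?k - n * n) mod n < n"
        using ij by (auto simp: less_mult_imp_div_less)
      then show False using val[OF zero_carrier_mat J(1)] 2 ij J by (simp add: load_mats_def)
    next
      case 3
      then show False using val[OF one_carrier_mat J(1)] ij J by (simp add: load_mats_def)
    qed
  qed
  then have "(\<lambda>(i,j). out i j) ` ({..<n} \<times> {..<n}) \<subseteq> fst ` set S" by auto
  then have "card ((\<lambda>(i,j). out i j) ` ({..<n} \<times> {..<n})) \<le> card (fst ` set S)"
    by (intro card_mono) auto
  also have "\<dots> \<le> length S" by (meson List.finite_set card_image_le card_length order_trans)
  finally show ?thesis using card_image[OF inj] by simp
qed

text \<open>Schoolbook multiplication: each triple (i, j, k) puts one product into the scratch
  register 3 n^2 and adds it to an accumulator, which \<open>load_mats\<close> has initialised with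
  0. Its existence gives \<open>matmul_cost\<close> a witness for \<open>LEAST\<close> and bounds
  the cost from above.\<close>

definition naive_slp :: "nat \<Rightarrow> (nat \<times> nat \<times> nat) list \<Rightarrow> (nat \<times> 'c field_op) list" where
  "naive_slp n L = concat (map (\<lambda>(i, j, k).
     [(3 * (n * n), Mul (Reg (i * n + k)) (Reg (n * n + (k * n + j)))),
      (2 * (n * n) + (i * n + j), Add (Reg (2 * (n * n) + (i * n + j))) (Reg (3 * (n * n))))]) L)"

lemma index_less: "i < n \<Longrightarrow> j < n \<Longrightarrow> i * n + j < n * (n::nat)"
  by (metis add.commute add_less_mono1 less_le_trans mult_Suc mult_le_mono1 Suc_leI)

lemma index_eq_iff:
  assumes "j < n" "j' < n"
  shows "i * n + j = i' * n + j' \<longleftrightarrow> i = i' \<and> j = (j'::nat)"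
proof
  assume eq: "i * n + j = i' * n + j'"
  have "(i * n + j) mod n = j" "(i' * n + j') mod n = j'" using assms by simp_all
  then have "j = j'" using eq by simp
  then show "i = i' \<and> j = j'" using eq assms by simp
qed simp

text \<open>Stated for an arbitrary list of triples and an arbitrary state so that the induction
  passes. Writes go only to registers from 2 n^2 on, hence the inputs stay intact
  throughout.\<close>

lemma run_naive_slp:
  fixes \<sigma> :: "nat \<Rightarrow> 'c::field"
  assumes "set L \<subseteq> {..<n} \<times> {..<n} \<times> {..<n}" "i < n" "j < n"
  shows "run_slp (naive_slp n L) \<sigma> (2 * (n * n) + (i * n + j)) = \<sigma> (2 * (n * n) + (i * n + j)) +
    (\<Sum>(i', j', k)\<leftarrow>L. if i' = i \<and> j' = j then \<sigma> (i * n + k) * \<sigma> (n * n + (k * n + j)) else 0)"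
  using assms(1)
proof (induction L arbitrary: \<sigma>)
  case (Cons a L)
  obtain i' j' k where a: "a = (i', j', k)" by (cases a)
  from Cons.prems have lt: "i' < n" "j' < n" "k < n" by (auto simp: a)
  define \<sigma>' where "\<sigma>' = (\<sigma>(3 * (n * n) := \<sigma> (i' * n + k) * \<sigma> (n * n + (k * n + j'))))
    (2 * (n * n) + (i' * n + j') := \<sigma> (2 * (n * n) + (i' * n + j')) +
       \<sigma> (i' * n + k) * \<sigma> (n * n + (k * n + j')))"
  have "run_slp (naive_slp n (a # L)) \<sigma> = run_slp (naive_slp n L) \<sigma>'"
    using index_less[OF lt(1,2)]
    by (simp add: run_slp_def naive_slp_def a \<sigma>'_def)
  moreover have "\<sigma>' x = \<sigma> x" if "x < 2 * (n * n)" for x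
    using that by (simp add: \<sigma>'_def)
  then have "\<sigma>' (i * n + k') = \<sigma> (i * n + k')" "\<sigma>' (n * n + (k' * n + j)) = \<sigma> (n * n + (k' * n + j))"
    if "k' < n" for k'
    using index_less[OF assms(2) that] index_less[OF that assms(3)] by auto
  then have "(\<Sum>(i', j', k)\<leftarrow>L. if i' = i \<and> j' = j then \<sigma>' (i * n + k) * \<sigma>' (n * n + (k * n + j)) else 0)
    = (\<Sum>(i', j', k)\<leftarrow>L. if i' = i \<and> j' = j then \<sigma> (i * n + k) * \<sigma> (n * n + (k * n + j)) else 0)"
    using Cons.prems by (intro arg_cong[of _ _ sum_list] map_cong) auto
  moreover have "\<sigma>' (2 * (n * n) + (i * n + j)) = \<sigma> (2 * (n * n) + (i * n + j)) +
     (if i' = i \<and> j' = j then \<sigma> (i * n + k) * \<sigma> (n * n + (k * n + j)) else 0)"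
    using lt assms index_less[OF assms(2,3)] by (auto simp: \<sigma>'_def index_eq_iff)
  ultimately show ?case using Cons.IH[of \<sigma>'] Cons.prems by (simp add: a)
qed (simp add: run_slp_def naive_slp_def)

lemma slp_multiplies_naive:
  defines "S \<equiv> \<lambda>n. naive_slp n (List.product [0..<n] (List.product [0..<n] [0..<n]))"
  shows "slp_multiplies F n (S n :: (nat \<times> 'c::field field_op) list)" "length (S n) = 2 * n ^ 3"
proof -
  let ?L = "List.product [0..<n] (List.product [0..<n] [0..<n])"
  have "length (naive_slp n L :: (nat \<times> 'c field_op) list) = 2 * length L" for L
    by (induction L) (auto simp: naive_slp_def)
  then show "length (S n) = 2 * n ^ 3" by (simp add: S_def length_product power3_eq_cube)
  show "slp_multiplies F n (S n)"
    unfolding slp_multiplies_def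
  proof (intro conjI exI ballI allI impI)
    fix A B :: "'c mat" and i j
    assume AB: "A \<in> carrier_mat n n" "B \<in> carrier_mat n n" and ij: "i < n" "j < n"
    let ?\<sigma> = "load_mats n A B"
    have val: "?\<sigma> (i * n + k) = A $$ (i, k)" "?\<sigma> (n * n + (k * n + j)) = B $$ (k, j)" if "k < n" for k
      using that ij index_less[OF ij(1) that] index_less[OF that ij(2)] by (auto simp: load_mats_def)
    have "run_slp (S n) ?\<sigma> (2 * (n * n) + (i * n + j)) =
      (\<Sum>(i', j', k)\<leftarrow>?L. if i' = i \<and> j' = j then ?\<sigma> (i * n + k) * ?\<sigma> (n * n + (k * n + j)) else 0)"
      unfolding S_def using ij by (subst run_naive_slp) (auto simp: load_mats_def)
    also have "\<dots> = (\<Sum>(i', j', k)\<in>set ?L. if i' = i \<and> j' = j then ?\<sigma> (i * n + k) * ?\<sigma> (n * n + (k * n + j)) else 0)"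
      by (intro sum_list_distinct_conv_sum_set distinct_product) auto
    also have "\<dots> = (\<Sum>x\<in>(\<lambda>k. (i, j, k)) ` {..<n}. case x of (i', j', k) \<Rightarrow>
        if i' = i \<and> j' = j then ?\<sigma> (i * n + k) * ?\<sigma> (n * n + (k * n + j)) else 0)"
      using ij by (intro sum.mono_neutral_right) auto
    also have "\<dots> = (\<Sum>k<n. ?\<sigma> (i * n + k) * ?\<sigma> (n * n + (k * n + j)))"
      by (subst sum.reindex) (auto simp: inj_on_def)
    also have "\<dots> = (\<Sum>k<n. A $$ (i, k) * B $$ (k, j))" by (simp add: val)
    also have "\<dots> = (A * B) $$ (i, j)"
      using AB ij by (auto simp: scalar_prod_def atLeast0LessThan)
    finally show "run_slp (S n) ?\<sigma> (2 * (n * n) + (i * n + j)) = (A * B) $$ (i, j)" .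
  qed (auto simp: S_def naive_slp_def)
qed

lemma matmul_cost_bounds: "n * n \<le> matmul_cost (F :: 'c::field set) n" "matmul_cost F n \<le> 2 * n ^ 3"
proof -
  let ?P = "\<lambda>c. \<exists>S :: (nat \<times> 'c field_op) list. slp_multiplies F n S \<and> length S = c"
  have P: "?P (2 * n ^ 3)" using slp_multiplies_naive by blast
  show "matmul_cost F n \<le> 2 * n ^ 3" unfolding matmul_cost_def by (rule Least_le[of ?P]) fact
  have "?P (matmul_cost F n)" unfolding matmul_cost_def by (rule LeastI[of ?P]) fact
  then obtain S :: "(nat \<times> 'c field_op) list" where "slp_multiplies F n S" "length S = matmul_cost F n"
    by blast
  then show "n * n \<le> matmul_cost F n" using slp_multiplies_length[of F n S] by simp
qed

text \<open>Lower bounds pass to a real infimum only for a nonempty set, so the cubic schoolbook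
  bound is used to exhibit the exponent 3. Every admissible exponent is at least 2 because the cost
  is at least n^2.\<close>

lemma matmul_exponent_ge_2: "matmul_exponent (F :: 'c::field set) \<ge> 2"
  unfolding matmul_exponent_def
proof (rule cInf_greatest)
  have "(\<lambda>n. real (matmul_cost F n)) \<in> O(\<lambda>n. real n powr 3)"
  proof (rule bigoI[of _ 2], rule eventually_mono[OF eventually_gt_at_top[of 0]])
    fix n :: nat assume "n > 0"
    have "real (matmul_cost F n) \<le> real (2 * n ^ 3)" using matmul_cost_bounds(2) of_nat_le_iff by blast
    then show "norm (real (matmul_cost F n)) \<le> 2 * norm (real n powr 3)"
      using \<open>n > 0\<close> by (simp add: powr_numeral)
  qed
  then show "{\<tau>. (\<lambda>n. real (matmul_cost F n)) \<in> O(\<lambda>n. real n powr \<tau>)} \<noteq> {}" by blast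
next
  fix \<tau> assume "\<tau> \<in> {\<tau>. (\<lambda>n. real (matmul_cost F n)) \<in> O(\<lambda>n. real n powr \<tau>)}"
  moreover have "(\<lambda>n. real n powr 2) \<in> O(\<lambda>n. real (matmul_cost F n))"
  proof (rule bigoI[of _ 1], rule eventually_mono[OF eventually_gt_at_top[of 0]])
    fix n :: nat assume "n > 0"
    have "real (n * n) \<le> real (matmul_cost F n)" using matmul_cost_bounds(1) of_nat_le_iff by blast
    then show "norm (real n powr 2) \<le> 1 * norm (real (matmul_cost F n))"
      using \<open>n > 0\<close> by (simp add: powr_numeral power2_eq_square)
  qed
  ultimately have "(\<lambda>n. real n powr 2) \<in> O(\<lambda>n. real n powr \<tau>)"
    using landau_o.big_trans by blast
  then show "2 \<le> \<tau>"
    by (subst (asm) powr_bigo_iff) (auto simp: filterlim_real_sequentially)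
qed

section \<open>Straight-line code into fresh registers\<close>

fun operand_below :: "nat \<Rightarrow> 'a operand \<Rightarrow> bool" where
  "operand_below n (Reg i) \<longleftrightarrow> i < n"
| "operand_below n (Con c) \<longleftrightarrow> True"

fun op_below :: "nat \<Rightarrow> 'a field_op \<Rightarrow> bool" where
  "op_below n (Add x y) \<longleftrightarrow> operand_below n x \<and> operand_below n y"
| "op_below n (Sub x y) \<longleftrightarrow> operand_below n x \<and> operand_below n y"
| "op_below n (Mul x y) \<longleftrightarrow> operand_below n x \<and> operand_below n y"
| "op_below n (Div x y) \<longleftrightarrow> operand_below n x \<and> operand_below n y"
| "op_below n (Frob x) \<longleftrightarrow> operand_below n x"

text \<open>Single-assignment form: the i-th instruction writes register n + i. Everything below n
  survives, so rows computed earlier remain readable in all later states.\<close>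

fun exec :: "nat \<Rightarrow> nat \<Rightarrow> 'a::field field_op list \<Rightarrow> (nat \<Rightarrow> 'a) \<Rightarrow> nat \<Rightarrow> 'a" where
  "exec q n [] \<sigma> = \<sigma>"
| "exec q n (f # fs) \<sigma> = exec q (Suc n) fs (\<sigma>(n := op_val q \<sigma> f))"

fun emit :: "nat \<Rightarrow> 'a field_op list \<Rightarrow> 'a prog \<Rightarrow> 'a prog" where
  "emit n [] P = P"
| "emit n (f # fs) P = Assign n f (emit (Suc n) fs P)"

lemma run_emit: "run q (emit n fs P) \<sigma> = run q P (exec q n fs \<sigma>)"
  by (induction fs arbitrary: n \<sigma>) auto

lemma run_cost_emit: "run_cost q (emit n fs P) \<sigma> = length fs + run_cost q P (exec q n fs \<sigma>)"
  by (induction fs arbitrary: n \<sigma>) auto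

lemma prog_consts_emit: "prog_consts (emit n fs P) = (\<Union>f\<in>set fs. op_consts f) \<union> prog_consts P"
  by (induction fs arbitrary: n) auto

lemma exec_append: "exec q n (fs @ gs) \<sigma> = exec q (n + length fs) gs (exec q n fs \<sigma>)"
  by (induction fs arbitrary: n \<sigma>) auto

lemma exec_below: "k < n \<Longrightarrow> exec q n fs \<sigma> k = \<sigma> k"
  by (induction fs arbitrary: n \<sigma>) auto

lemma operand_below_mono: "operand_below n x \<Longrightarrow> n \<le> n' \<Longrightarrow> operand_below n' x"
  by (cases x) auto

lemma operand_val_exec: "operand_below n x \<Longrightarrow> operand_val (exec q n fs \<sigma>) x = operand_val \<sigma> x"
  by (cases x) (auto simp: exec_below)

lemma operand_val_cong: "operand_below n x \<Longrightarrow> \<forall>i<n. \<sigma> i = \<sigma>' i \<Longrightarrow> operand_val \<sigma> x = operand_val \<sigma>' x"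
  by (cases x) auto

lemma op_val_cong: "op_below n f \<Longrightarrow> \<forall>i<n. \<sigma> i = \<sigma>' i \<Longrightarrow> op_val q \<sigma> f = op_val q \<sigma>' f"
  by (cases f) (simp_all add: operand_val_cong[of n _ \<sigma> \<sigma>'])

text \<open>Instructions that read only below n cannot see each other's results, so each evaluates
  as in the initial state. The write position n' is separate from the read bound n because it
  advances in the induction while n stays.\<close>

lemma exec_parallel:
  assumes "\<forall>f\<in>set fs. op_below n f" "n \<le> n'" "i < length fs" "\<And>j. j < n \<Longrightarrow> \<sigma>' j = \<sigma> j"
  shows "exec q n' fs \<sigma>' (n' + i) = op_val q \<sigma> (fs ! i)"
  using assms
proof (induction fs arbitrary: n' i \<sigma>')
  case (Cons f fs)
  have f: "op_val q \<sigma>' f = op_val q \<sigma> f"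
    using Cons.prems by (intro op_val_cong[of n]) auto
  show ?case
  proof (cases i)
    case 0
    then show ?thesis by (simp add: exec_below f)
  next
    case (Suc j)
    then show ?thesis
      using Cons.IH[of "Suc n'" j "\<sigma>'(n' := op_val q \<sigma>' f)"] Cons.prems by (simp add: fun_upd_def)
  qed
qed simp

section \<open>Rows of the Euclidean scheme as operand lists\<close>

context skew_ring
begin

definition code_ok :: "'c field_op list \<Rightarrow> bool" where
  "code_ok fs \<longleftrightarrow> (\<forall>f\<in>set fs. op_consts f \<subseteq> Fqr)"

text \<open>Entries are operands instead of register contents: known zeros and the coefficients of
  the modulus are constants and cost nothing, and unchanged entries need not be copied.\<close>

definition row_ok :: "nat \<Rightarrow> nat \<Rightarrow> 'c operand list \<Rightarrow> bool" where
  "row_ok L n xs \<longleftrightarrow> length xs = L \<and> (\<forall>x\<in>set xs. operand_below n x \<and> operand_consts x \<subseteq> Fqr)"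

definition row :: "(nat \<Rightarrow> 'c) \<Rightarrow> 'c operand list \<Rightarrow> 'c poly" where
  "row \<sigma> xs = Poly (map (operand_val \<sigma>) xs)"

lemma coeff_row: "coeff (row \<sigma> xs) i = (if i < length xs then operand_val \<sigma> (xs ! i) else 0)"
  by (simp add: row_def nth_default_def)

lemma row_ok_mono: "row_ok L n xs \<Longrightarrow> n \<le> n' \<Longrightarrow> row_ok L n' xs"
  by (auto simp: row_ok_def intro: operand_below_mono)

lemma row_exec: "row_ok L n xs \<Longrightarrow> row (exec q n fs \<sigma>) xs = row \<sigma> xs"
  by (auto simp: row_def row_ok_def operand_val_exec intro!: arg_cong[of _ _ Poly])

lemma operand_val_in: "range \<sigma> \<subseteq> Fqr \<Longrightarrow> operand_consts x \<subseteq> Fqr \<Longrightarrow> operand_val \<sigma> x \<in> Fqr"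
  by (cases x) auto

lemma op_val_in: "range \<sigma> \<subseteq> Fqr \<Longrightarrow> op_consts f \<subseteq> Fqr \<Longrightarrow> op_val q \<sigma> f \<in> Fqr"
  by (cases f) (auto intro!: gf_add gf_diff gf_mult gf_divide gf_power operand_val_in)

lemma exec_in: "range \<sigma> \<subseteq> Fqr \<Longrightarrow> code_ok fs \<Longrightarrow> range (exec q n fs \<sigma>) \<subseteq> Fqr"
proof (induction fs arbitrary: n \<sigma>)
  case (Cons f fs)
  have "range (\<sigma>(n := op_val q \<sigma> f)) \<subseteq> Fqr"
    using Cons.prems op_val_in[of \<sigma> f] by (auto simp: code_ok_def)
  then show ?case using Cons by (simp add: code_ok_def)
qed simp

lemma row_in_R: "range \<sigma> \<subseteq> Fqr \<Longrightarrow> row_ok L n xs \<Longrightarrow> row \<sigma> xs \<in> R"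
  by (auto simp: poly_over_def coeff_row row_ok_def intro!: operand_val_in)

text \<open>Since \<tau> a = a^q \<tau>, a shift applies one Frobenius step per coefficient and puts
  a constant 0 in front. The top entry is dropped; the degree condition guarantees that it is
  0.\<close>

lemma shift_row:
  assumes xs: "row_ok L n xs"
  shows "\<exists>fs ys. length fs \<le> L \<and> code_ok fs \<and> row_ok L (n + length fs) ys \<and>
    (\<forall>\<sigma>. degree (row \<sigma> xs) + 1 < L \<longrightarrow> row (exec q n fs \<sigma>) ys = monom 1 1 \<star> row \<sigma> xs)"
proof (cases "L = 0")
  case True
  then show ?thesis using xs by (intro exI[of _ "[]"] exI[of _ xs]) (auto simp: code_ok_def)
next
  case False
  define fs where "fs = map Frob (butlast xs)"
  define ys :: "'c operand list" where "ys = Con 0 # map Reg [n..<n + (L - 1)]"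
  have len: "length fs = L - 1" "length ys = L" using xs False by (auto simp: fs_def ys_def row_ok_def)
  have below: "\<forall>f\<in>set fs. op_below n f"
    using xs by (auto simp: fs_def row_ok_def dest!: in_set_butlastD)
  have "row (exec q n fs \<sigma>) ys = monom 1 1 \<star> row \<sigma> xs" if deg: "degree (row \<sigma> xs) + 1 < L" for \<sigma>
  proof (rule poly_eqI)
    fix i
    have reg: "exec q n fs \<sigma> (n + j) = operand_val \<sigma> (xs ! j) ^ q" if "j < L - 1" for j
      using exec_parallel[OF below, of n j \<sigma> \<sigma>] that len xs
      by (auto simp: fs_def nth_butlast row_ok_def)
    have top: "coeff (row \<sigma> xs) (i - 1) = 0" if "i \<ge> L"
      using that deg by (intro coeff_eq_0) linarith
    show "coeff (row (exec q n fs \<sigma>) ys) i = coeff (monom 1 1 \<star> row \<sigma> xs) i"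
    proof (cases "i < L \<and> i > 0")
      case True
      then have "coeff (row (exec q n fs \<sigma>) ys) i = exec q n fs \<sigma> (n + (i - 1))"
        by (cases i) (auto simp: coeff_row len(2) ys_def)
      also have "\<dots> = coeff (row \<sigma> xs) (i - 1) ^ q"
        using reg[of "i - 1"] True xs by (auto simp: coeff_row row_ok_def)
      finally show ?thesis using True by (simp add: coeff_monom_skm)
    next
      case False
      then show ?thesis using top len(2) by (auto simp: coeff_monom_skm coeff_row ys_def)
    qed
  qed
  moreover have "code_ok fs"
    using xs by (fastforce simp: code_ok_def fs_def row_ok_def dest!: in_set_butlastD)
  moreover have "row_ok L (n + length fs) ys"
    using len(2) unfolding len(1) by (auto simp: row_ok_def ys_def)
  ultimately show ?thesis using len(1) by (intro exI[of _ fs] exI[of _ ys]) auto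
qed

text \<open>One division for the quotient in register n, L multiplications for the scaled row and L
  subtractions for the difference: this is the count 1 + 2 L. Division by 0 gives 0 on both sides,
  so no condition on the pivot is needed.\<close>

lemma eliminate_row:
  assumes xs: "row_ok L n xs" and ys: "row_ok L n ys" and p: "p < L"
  shows "\<exists>fs zs. length fs = 1 + 2 * L \<and> code_ok fs \<and> row_ok L (n + length fs) zs \<and>
    (\<forall>\<sigma>. row (exec q n fs \<sigma>) zs =
      row \<sigma> ys - monom (coeff (row \<sigma> ys) p / coeff (row \<sigma> xs) p) 0 \<star> row \<sigma> xs)"
proof -
  define f0 where "f0 = Div (ys ! p) (xs ! p)"
  define f1 where "f1 = map (Mul (Reg n)) xs"
  define f2 where "f2 = map2 Sub ys (map Reg [Suc n..<Suc n + L])"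
  define fs where "fs = f0 # f1 @ f2"
  define zs :: "'c operand list" where "zs = map Reg [Suc n + L..<Suc n + L + L]"
  have len: "length f1 = L" "length f2 = L" "length fs = 1 + 2 * L" "length zs = L"
    using xs ys by (auto simp: f1_def f2_def fs_def zs_def row_ok_def)
  have below1: "\<forall>f\<in>set f1. op_below (Suc n) f"
    using row_ok_mono[OF xs, of "Suc n"] by (auto simp: f1_def row_ok_def)
  have below2: "\<forall>f\<in>set f2. op_below (Suc n + L) f"
    using row_ok_mono[OF ys, of "Suc n + L"]
    by (auto simp: f2_def row_ok_def simp del: upt_Suc elim!: in_set_zipE)
  have "row (exec q n fs \<sigma>) zs =
      row \<sigma> ys - monom (coeff (row \<sigma> ys) p / coeff (row \<sigma> xs) p) 0 \<star> row \<sigma> xs" for \<sigma>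
  proof -
    define c where "c = coeff (row \<sigma> ys) p / coeff (row \<sigma> xs) p"
    define \<sigma>1 where "\<sigma>1 = \<sigma>(n := op_val q \<sigma> f0)"
    define \<sigma>2 where "\<sigma>2 = exec q (Suc n) f1 \<sigma>1"
    have ex: "exec q n fs \<sigma> = exec q (Suc n + L) f2 \<sigma>2"
      by (simp add: fs_def exec_append \<sigma>2_def \<sigma>1_def len(1))
    have c: "\<sigma>1 n = c" using p xs ys by (simp add: \<sigma>1_def f0_def c_def coeff_row row_ok_def)
    have old: "operand_val \<sigma>1 x = operand_val \<sigma> x" if "operand_below n x" for x
      using that by (intro operand_val_cong) (auto simp: \<sigma>1_def)
    have v1: "\<sigma>2 (Suc n + j) = c * coeff (row \<sigma> xs) j" if "j < L" for j
      using exec_parallel[OF below1, of "Suc n" j \<sigma>1 \<sigma>1] that len(1) xs old[of "xs ! j"] c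
      by (auto simp: f1_def \<sigma>2_def coeff_row row_ok_def simp del: upt_Suc)
    have old2: "operand_val \<sigma>2 x = operand_val \<sigma> x" if "operand_below n x" for x
      using old[OF that] operand_val_exec[of "Suc n" x q f1 \<sigma>1] operand_below_mono[OF that, of "Suc n"]
      by (simp add: \<sigma>2_def)
    have v2: "exec q n fs \<sigma> (Suc n + L + j) = coeff (row \<sigma> ys) j - c * coeff (row \<sigma> xs) j" if "j < L" for j
      using exec_parallel[OF below2, of "Suc n + L" j \<sigma>2 \<sigma>2] that len(2) ys old2[of "ys ! j"] v1[OF that]
      unfolding ex by (auto simp: f2_def coeff_row row_ok_def simp del: upt_Suc)
    show ?thesis
    proof (rule poly_eqI)
      fix i
      show "coeff (row (exec q n fs \<sigma>) zs) i = coeff (row \<sigma> ys - monom (coeff (row \<sigma> ys) p / coeff (row \<sigma> xs) p) 0 \<star> row \<sigma> xs) i"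
      proof (cases "i < L")
        case True
        then have "coeff (row (exec q n fs \<sigma>) zs) i = exec q n fs \<sigma> (Suc n + L + i)"
          by (simp add: coeff_row len(4)) (simp add: zs_def del: upt_Suc)
        then show ?thesis using v2[OF True] by (simp add: coeff_monom_skm flip: c_def)
      next
        case False
        then show ?thesis using xs ys by (auto simp: coeff_row len(4) coeff_monom_skm row_ok_def)
      qed
    qed
  qed
  moreover have "code_ok fs"
  proof -
    have xs': "operand_consts x \<subseteq> Fqr" if "x \<in> set xs" for x using xs that by (auto simp: row_ok_def)
    have ys': "operand_consts x \<subseteq> Fqr" if "x \<in> set ys" for x using ys that by (auto simp: row_ok_def)
    have "op_consts f0 \<subseteq> Fqr"
      using xs'[of "xs ! p"] ys'[of "ys ! p"] p xs ys by (simp add: f0_def row_ok_def)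
    moreover have "op_consts f \<subseteq> Fqr" if "f \<in> set f1" for f
      using that xs' by (fastforce simp: f1_def)
    moreover have "op_consts f \<subseteq> Fqr" if "f \<in> set f2" for f
    proof -
      from that obtain y i where "y \<in> set ys" "f = Sub y (Reg i)"
        by (auto simp: f2_def simp del: upt_Suc elim!: in_set_zipE)
      then show ?thesis using ys' by simp
    qed
    ultimately show ?thesis by (auto simp: code_ok_def fs_def)
  qed
  moreover have "row_ok L (n + length fs) zs"
    using len(4) unfolding len(3) by (auto simp: row_ok_def zs_def)
  ultimately show ?thesis using len(3) by (intro exI[of _ fs] exI[of _ zs]) auto
qed

text \<open>Long division with the quotient degree k known in advance, hence without tests. The
  recursion divides by \<tau> xs at pivot p + 1 first and eliminates with xs at pivot p afterwards,
  so each shifted divisor is computed once: k shifts and k + 1 eliminations. Positions from W on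
  will hold the cofactor, which is why vanishing is only asked below W.\<close>

lemma divide_row:
  assumes "row_ok L n xs" "row_ok L n ys" "p + k < W" "W \<le> L"
  shows "\<exists>fs zs. length fs \<le> (k + 1) * (1 + 2 * L) + k * L \<and> code_ok fs \<and> row_ok L (n + length fs) zs \<and>
    (\<forall>\<sigma>. range \<sigma> \<subseteq> Fqr \<and> coeff (row \<sigma> xs) p \<noteq> 0 \<and> coeff (row \<sigma> ys) (p + k) \<noteq> 0 \<and>
        (\<forall>i. p < i \<and> i < W \<longrightarrow> coeff (row \<sigma> xs) i = 0) \<and>
        (\<forall>i. p + k < i \<and> i < W \<longrightarrow> coeff (row \<sigma> ys) i = 0) \<and> degree (row \<sigma> xs) + k < L \<longrightarrow>
      (\<exists>s\<in>R. s \<noteq> 0 \<and> degree s = k \<and> row (exec q n fs \<sigma>) zs = row \<sigma> ys - s \<star> row \<sigma> xs \<and>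
        (\<forall>i. p \<le> i \<and> i < W \<longrightarrow> coeff (row \<sigma> ys - s \<star> row \<sigma> xs) i = 0)))"
  using assms
proof (induction k arbitrary: n xs p)
  case 0
  obtain fs zs where fs: "length fs = 1 + 2 * L" "code_ok fs" "row_ok L (n + length fs) zs"
    and run: "\<And>\<sigma>. row (exec q n fs \<sigma>) zs =
      row \<sigma> ys - monom (coeff (row \<sigma> ys) p / coeff (row \<sigma> xs) p) 0 \<star> row \<sigma> xs"
    using eliminate_row[OF 0(1,2), of p] 0(3,4) by auto
  show ?case
  proof (intro exI[of _ fs] exI[of _ zs] conjI allI impI)
    fix \<sigma>
    assume *: "range \<sigma> \<subseteq> Fqr \<and> coeff (row \<sigma> xs) p \<noteq> 0 \<and> coeff (row \<sigma> ys) (p + 0) \<noteq> 0 \<and>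
        (\<forall>i. p < i \<and> i < W \<longrightarrow> coeff (row \<sigma> xs) i = 0) \<and>
        (\<forall>i. p + 0 < i \<and> i < W \<longrightarrow> coeff (row \<sigma> ys) i = 0) \<and> degree (row \<sigma> xs) + 0 < L"
    define c where "c = coeff (row \<sigma> ys) p / coeff (row \<sigma> xs) p"
    have "c \<in> Fqr" unfolding c_def using * 0 by (intro gf_divide R_coeff row_in_R) auto
    moreover have "c \<noteq> 0" using * by (simp add: c_def)
    moreover have "coeff (row \<sigma> ys - monom c 0 \<star> row \<sigma> xs) i = 0" if "p \<le> i" "i < W" for i
      using * that by (cases "i = p") (auto simp: coeff_monom_skm c_def)
    ultimately show "\<exists>s\<in>R. s \<noteq> 0 \<and> degree s = 0 \<and> row (exec q n fs \<sigma>) zs = row \<sigma> ys - s \<star> row \<sigma> xs \<and>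
        (\<forall>i. p \<le> i \<and> i < W \<longrightarrow> coeff (row \<sigma> ys - s \<star> row \<sigma> xs) i = 0)"
      using run[of \<sigma>] by (intro bexI[of _ "monom c 0"]) (auto simp: degree_monom_eq simp flip: c_def)
  qed (use fs in auto)
next
  case (Suc k)
  obtain f1 us where f1: "length f1 \<le> L" "code_ok f1" "row_ok L (n + length f1) us"
    and run1: "\<And>\<sigma>. degree (row \<sigma> xs) + 1 < L \<Longrightarrow> row (exec q n f1 \<sigma>) us = monom 1 1 \<star> row \<sigma> xs"
    using shift_row[OF Suc.prems(1)] by blast
  define n1 where "n1 = n + length f1"
  have ok1: "row_ok L n1 us" "row_ok L n1 ys" "row_ok L n1 xs"
    using f1(3) row_ok_mono[OF Suc.prems(1)] row_ok_mono[OF Suc.prems(2)] by (auto simp: n1_def)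
  have le: "p + 1 + k < W" using Suc.prems(3) by simp
  obtain f2 ws where f2: "length f2 \<le> (k + 1) * (1 + 2 * L) + k * L" "code_ok f2" "row_ok L (n1 + length f2) ws"
    and run2: "\<And>\<sigma>. range \<sigma> \<subseteq> Fqr \<and> coeff (row \<sigma> us) (p + 1) \<noteq> 0 \<and> coeff (row \<sigma> ys) (p + 1 + k) \<noteq> 0 \<and>
        (\<forall>i. p + 1 < i \<and> i < W \<longrightarrow> coeff (row \<sigma> us) i = 0) \<and>
        (\<forall>i. p + 1 + k < i \<and> i < W \<longrightarrow> coeff (row \<sigma> ys) i = 0) \<and> degree (row \<sigma> us) + k < L \<Longrightarrow>
      \<exists>s\<in>R. s \<noteq> 0 \<and> degree s = k \<and> row (exec q n1 f2 \<sigma>) ws = row \<sigma> ys - s \<star> row \<sigma> us \<and>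
        (\<forall>i. p + 1 \<le> i \<and> i < W \<longrightarrow> coeff (row \<sigma> ys - s \<star> row \<sigma> us) i = 0)"
    using Suc.IH[OF ok1(1,2) le Suc.prems(4)] by blast
  define n2 where "n2 = n1 + length f2"
  have ok2: "row_ok L n2 ws" "row_ok L n2 xs"
    using f2(3) row_ok_mono[OF ok1(3)] by (auto simp: n2_def)
  obtain f3 zs where f3: "length f3 = 1 + 2 * L" "code_ok f3" "row_ok L (n2 + length f3) zs"
    and run3: "\<And>\<sigma>. row (exec q n2 f3 \<sigma>) zs =
      row \<sigma> ws - monom (coeff (row \<sigma> ws) p / coeff (row \<sigma> xs) p) 0 \<star> row \<sigma> xs"
    using eliminate_row[OF ok2(2,1), of p] Suc.prems(3,4) by auto
  define fs where "fs = f1 @ f2 @ f3"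
  show ?case
  proof (intro exI[of _ fs] exI[of _ zs] conjI allI impI)
    show "length fs \<le> (Suc k + 1) * (1 + 2 * L) + Suc k * L"
      using f1(1) f2(1) f3(1) by (simp add: fs_def algebra_simps)
    show "code_ok fs" using f1(2) f2(2) f3(2) by (auto simp: fs_def code_ok_def)
    show "row_ok L (n + length fs) zs" using f3(3) by (simp add: fs_def n2_def n1_def add.assoc)
    fix \<sigma>
    assume *: "range \<sigma> \<subseteq> Fqr \<and> coeff (row \<sigma> xs) p \<noteq> 0 \<and> coeff (row \<sigma> ys) (p + Suc k) \<noteq> 0 \<and>
        (\<forall>i. p < i \<and> i < W \<longrightarrow> coeff (row \<sigma> xs) i = 0) \<and>
        (\<forall>i. p + Suc k < i \<and> i < W \<longrightarrow> coeff (row \<sigma> ys) i = 0) \<and> degree (row \<sigma> xs) + Suc k < L"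
    define \<sigma>1 where "\<sigma>1 = exec q n f1 \<sigma>"
    define \<sigma>2 where "\<sigma>2 = exec q n1 f2 \<sigma>1"
    have ex: "exec q n fs \<sigma> = exec q n2 f3 \<sigma>2"
      by (simp add: fs_def exec_append \<sigma>2_def \<sigma>1_def n2_def n1_def)
    have in1: "range \<sigma>1 \<subseteq> Fqr" unfolding \<sigma>1_def using * f1(2) by (intro exec_in) auto
    have us: "row \<sigma>1 us = monom 1 1 \<star> row \<sigma> xs" unfolding \<sigma>1_def using * by (intro run1) auto
    have ys1: "row \<sigma>1 ys = row \<sigma> ys" unfolding \<sigma>1_def by (rule row_exec[OF Suc.prems(2)])
    have xs1: "row \<sigma>1 xs = row \<sigma> xs" unfolding \<sigma>1_def by (rule row_exec[OF Suc.prems(1)])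
    have xs2: "row \<sigma>2 xs = row \<sigma> xs" unfolding \<sigma>2_def using row_exec[OF ok1(3)] xs1 by simp
    have "degree (row \<sigma>1 us) \<le> degree (row \<sigma> xs) + 1"
      unfolding us using degree_skm_le[of "monom 1 1" "row \<sigma> xs"] degree_monom_le[of "1::'c" 1] by linarith
    moreover have "coeff (row \<sigma> xs) (i - 1) = 0" if "p + 1 < i" "i < W" for i
      using * that by (metis less_diff_conv less_imp_diff_less)
    ultimately have "range \<sigma>1 \<subseteq> Fqr \<and> coeff (row \<sigma>1 us) (p + 1) \<noteq> 0 \<and> coeff (row \<sigma>1 ys) (p + 1 + k) \<noteq> 0 \<and>
        (\<forall>i. p + 1 < i \<and> i < W \<longrightarrow> coeff (row \<sigma>1 us) i = 0) \<and>
        (\<forall>i. p + 1 + k < i \<and> i < W \<longrightarrow> coeff (row \<sigma>1 ys) i = 0) \<and> degree (row \<sigma>1 us) + k < L"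
      using * in1 unfolding us ys1 by (auto simp: coeff_monom_skm)
    from run2[OF this] obtain s where s: "s \<in> R" "s \<noteq> 0" "degree s = k"
      "row \<sigma>2 ws = row \<sigma> ys - s \<star> (monom 1 1 \<star> row \<sigma> xs)"
      "\<And>i. p + 1 \<le> i \<Longrightarrow> i < W \<Longrightarrow> coeff (row \<sigma>2 ws) i = 0"
      unfolding us ys1 \<sigma>2_def[symmetric] by auto
    define c where "c = coeff (row \<sigma>2 ws) p / coeff (row \<sigma> xs) p"
    have in2: "range \<sigma>2 \<subseteq> Fqr" unfolding \<sigma>2_def using in1 f2(2) by (intro exec_in) auto
    have c: "c \<in> Fqr" unfolding c_def
      using in2 ok2(1) * Suc.prems(1) by (intro gf_divide R_coeff row_in_R) auto
    \<comment> \<open>The recursive quotient refers to \<tau> xs, so relative to xs it becomes s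
      \<tau>; the last elimination contributes the constant term c.\<close>
    define s' where "s' = s \<star> monom 1 1 + monom c 0"
    have deg1: "degree (s \<star> monom 1 1) = Suc k" using s by (simp add: degree_skm degree_monom_eq)
    then have deg: "degree s' = Suc k"
      unfolding s'_def using degree_monom_le[of c 0] by (subst degree_add_eq_left) auto
    have row_zs: "row (exec q n fs \<sigma>) zs = row \<sigma> ys - s' \<star> row \<sigma> xs"
      unfolding ex run3 xs2 c_def[symmetric] by (simp add: s(4) s'_def skm_add_left skm_assoc algebra_simps)
    have zero: "coeff (row \<sigma> ys - s' \<star> row \<sigma> xs) i = 0" if "p \<le> i" "i < W" for i
    proof -
      have "coeff (row \<sigma> ys - s' \<star> row \<sigma> xs) i = coeff (row \<sigma>2 ws) i - c * coeff (row \<sigma> xs) i"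
        unfolding row_zs[symmetric] ex run3 xs2 c_def[symmetric] by (simp add: coeff_monom_skm)
      then show ?thesis using * s(5)[of i] that by (cases "i = p") (auto simp: c_def)
    qed
    show "\<exists>s\<in>R. s \<noteq> 0 \<and> degree s = Suc k \<and> row (exec q n fs \<sigma>) zs = row \<sigma> ys - s \<star> row \<sigma> xs \<and>
        (\<forall>i. p \<le> i \<and> i < W \<longrightarrow> coeff (row \<sigma> ys - s \<star> row \<sigma> xs) i = 0)"
      using s(1) c deg row_zs zero by (intro bexI[of _ s']) (auto simp: s'_def)
  qed
qed

end

section \<open>Solving the key equation by the Euclidean scheme\<close>

locale key_equation = skew_ring q r ty for q r and ty :: "'c::field itself" +
  fixes qs :: "'c poly list" and d K :: nat
  assumes Pi_in_R: "Pi_mod q r qs \<in> R"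
    and K_pos: "K \<ge> 1"
    and bound: "d + K - 1 < degree (Pi_mod q r qs)"
begin

abbreviation M where "M \<equiv> Pi_mod q r qs"
abbreviation N where "N \<equiv> degree M"
abbreviation W where "W \<equiv> N + 1"
abbreviation L where "L \<equiv> 2 * W"

definition solves :: "'c poly \<Rightarrow> 'c poly \<Rightarrow> 'c poly \<Rightarrow> bool" where
  "solves Y v n \<longleftrightarrow> (\<exists>w\<in>R. v \<star> Y - n = w \<star> M)"

text \<open>A pair \<open>(v, n)\<close> is stored as the single skew polynomial \<open>n + v \<tau>^W\<close>; left multiplication
  respects this as long as the degree of \<open>n\<close> stays below \<open>W\<close>.\<close>
definition enc :: "'c poly \<Rightarrow> 'c poly \<Rightarrow> 'c poly" where
  "enc n v = n + v \<star> monom 1 W"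

text \<open>The two pairs generate the left module of all solutions of the congruence, ignoring
  degree bounds; this is what later justifies failure. The equation degree v1 = N - p2 is the
  classical relation between cofactors and remainders. Here p2 is an exact degree but p1 only a
  bound, lowered by the program as leading zeros are found.\<close>

definition euclid_inv :: "'c poly \<Rightarrow> nat \<Rightarrow> nat \<Rightarrow> 'c poly \<Rightarrow> 'c poly \<Rightarrow> bool" where
  "euclid_inv Y p1 p2 G1 G2 \<longleftrightarrow> (\<exists>v1\<in>R. \<exists>n1\<in>R. \<exists>v2\<in>R. \<exists>n2\<in>R.
     G1 = enc n1 v1 \<and> G2 = enc n2 v2 \<and> degree n1 \<le> p1 \<and> degree n2 = p2 \<and>
     v1 \<noteq> 0 \<and> degree v1 = N - p2 \<and> (v2 = 0 \<or> degree v2 < degree v1) \<and>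
     solves Y v1 n1 \<and> solves Y v2 n2 \<and>
     (\<forall>v\<in>R. \<forall>n\<in>R. solves Y v n \<longrightarrow>
        (\<exists>a\<in>R. \<exists>b\<in>R. v = a \<star> v1 + b \<star> v2 \<and> n = a \<star> n1 + b \<star> n2)))"

lemma N_pos: "N > 0" using bound by simp

lemma coeff_enc_low: "i < W \<Longrightarrow> coeff (enc n v) i = coeff n i"
  by (simp add: enc_def coeff_skm_monom)

lemma coeff_enc_high: "degree n < W \<Longrightarrow> coeff (enc n v) (W + i) = coeff v i"
  by (simp add: enc_def coeff_skm_monom coeff_eq_0)

lemma degree_enc_le: "degree n < W \<Longrightarrow> degree (enc n v) \<le> degree v + W"
  unfolding enc_def using degree_skm_le[of v "monom 1 W"] degree_monom_le[of "1::'c" W]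
  by (intro degree_add_le) linarith+

lemma enc_diff: "enc n2 v2 - s \<star> enc n1 v1 = enc (n2 - s \<star> n1) (v2 - s \<star> v1)"
  by (simp add: enc_def skm_add_right skm_diff_left skm_assoc)

lemma solves_step: "s \<in> R \<Longrightarrow> solves Y v1 n1 \<Longrightarrow> solves Y v2 n2 \<Longrightarrow> solves Y (v2 - s \<star> v1) (n2 - s \<star> n1)"
proof -
  assume s: "s \<in> R" and "solves Y v1 n1" "solves Y v2 n2"
  then obtain w1 w2 where w: "w1 \<in> R" "w2 \<in> R" "v1 \<star> Y - n1 = w1 \<star> M" "v2 \<star> Y - n2 = w2 \<star> M"
    by (auto simp: solves_def)
  have "(v2 - s \<star> v1) \<star> Y - (n2 - s \<star> n1) = (v2 \<star> Y - n2) - s \<star> (v1 \<star> Y - n1)"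
    by (simp add: skm_diff_left skm_diff_right skm_assoc algebra_simps)
  also have "\<dots> = (w2 - s \<star> w1) \<star> M" by (simp add: w skm_diff_left skm_assoc)
  finally show ?thesis using s w(1,2) by (auto simp: solves_def)
qed

text \<open>The scheme starts from (1, Y) and (0, \<Pi>). A solution satisfies n = v Y - w \<Pi>, so
  its coordinates in these generators are v and -w.\<close>

lemma euclid_inv_init:
  assumes "Y \<in> R" "degree Y < N"
  shows "euclid_inv Y (N - 1) N (enc Y 1) (enc M 0)"
  unfolding euclid_inv_def
proof (rule bexI[of _ 1], rule bexI[of _ Y], rule bexI[of _ 0], rule bexI[of _ M], intro conjI)
  show "solves Y 1 Y" by (auto simp: solves_def)
  show "solves Y 0 M" unfolding solves_def
    by (rule bexI[of _ "-1"]) (use skm_diff_left[of 0 1 M] in auto)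
  show "\<forall>v\<in>R. \<forall>n\<in>R. solves Y v n \<longrightarrow> (\<exists>a\<in>R. \<exists>b\<in>R. v = a \<star> 1 + b \<star> 0 \<and> n = a \<star> Y + b \<star> M)"
  proof (intro ballI impI)
    fix v n assume v: "v \<in> R" "n \<in> R" "solves Y v n"
    then obtain w where w: "w \<in> R" "v \<star> Y - n = w \<star> M" by (auto simp: solves_def)
    have "n = v \<star> Y + (- w) \<star> M" using w(2) skm_diff_left[of 0 w M] by (simp add: algebra_simps)
    then show "\<exists>a\<in>R. \<exists>b\<in>R. v = a \<star> 1 + b \<star> 0 \<and> n = a \<star> Y + b \<star> M"
      using v w by (intro bexI[of _ v] bexI[of _ "- w"]) auto
  qed
qed (use assms Pi_in_R in auto)

text \<open>The remainder becomes the first row and the old first row the second. As v2 has smaller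
  degree than s v1, the new cofactor has degree (p2 - p1) + (N - p2) = N - p1.\<close>

lemma euclid_inv_step:
  assumes inv: "euclid_inv Y p1 p2 G1 G2" and p: "p1 < p2" "p2 \<le> N" and p1: "0 < p1"
    and s: "s \<in> R" "s \<noteq> 0" "degree s = p2 - p1"
    and lead: "coeff G1 p1 \<noteq> 0" and zero: "\<And>i. p1 \<le> i \<Longrightarrow> i < W \<Longrightarrow> coeff (G2 - s \<star> G1) i = 0"
  shows "euclid_inv Y (p1 - 1) p1 (G2 - s \<star> G1) G1"
proof -
  obtain v1 n1 v2 n2 where R: "v1 \<in> R" "n1 \<in> R" "v2 \<in> R" "n2 \<in> R"
    and G: "G1 = enc n1 v1" "G2 = enc n2 v2" and deg: "degree n1 \<le> p1" "degree n2 = p2"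
    and v: "v1 \<noteq> 0" "degree v1 = N - p2" "v2 = 0 \<or> degree v2 < degree v1"
    and sol: "solves Y v1 n1" "solves Y v2 n2"
    and gen: "\<forall>v\<in>R. \<forall>n\<in>R. solves Y v n \<longrightarrow>
        (\<exists>a\<in>R. \<exists>b\<in>R. v = a \<star> v1 + b \<star> v2 \<and> n = a \<star> n1 + b \<star> n2)"
    using inv unfolding euclid_inv_def by (elim bexE conjE) (rule that)
  have dn1: "degree n1 = p1"
    using lead deg p coeff_enc_low[of p1 n1 v1] by (intro antisym le_degree) (simp_all add: G)
  define n3 where "n3 = n2 - s \<star> n1"
  define v3 where "v3 = v2 - s \<star> v1"
  have G3: "G2 - s \<star> G1 = enc n3 v3" by (simp add: G enc_diff n3_def v3_def)
  have "degree (s \<star> n1) \<le> p2" using degree_skm_le[of s n1] s dn1 p by simp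
  then have "degree n3 \<le> p2" using deg unfolding n3_def by (intro degree_diff_le) auto
  then have "coeff n3 i = 0" if "i > p1 - 1" for i
  proof (cases "i < W")
    case True
    then show ?thesis using zero[of i] that coeff_enc_low[of i n3 v3] by (simp add: G3)
  next
    case False
    then show ?thesis using \<open>degree n3 \<le> p2\<close> p by (intro coeff_eq_0) simp
  qed
  then have dn3: "degree n3 \<le> p1 - 1" by (intro degree_le) auto
  have dsv: "degree (s \<star> v1) = N - p1" using s v p by (simp add: degree_skm)
  have dv3: "degree v3 = N - p1"
  proof (cases "v2 = 0")
    case True
    then show ?thesis using dsv by (simp add: v3_def)
  next
    case False
    then have "degree v2 < degree (s \<star> v1)" using v p dsv by auto
    then show ?thesis using dsv unfolding v3_def diff_conv_add_uminus
      by (subst degree_add_eq_right) auto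
  qed
  have v3: "v3 \<noteq> 0" using dv3 p by auto
  have gen': "\<exists>a\<in>R. \<exists>b\<in>R. v = a \<star> v3 + b \<star> v1 \<and> n = a \<star> n3 + b \<star> n1"
    if vn: "v \<in> R" "n \<in> R" "solves Y v n" for v n
  proof -
    obtain a b where ab: "a \<in> R" "b \<in> R" "v = a \<star> v1 + b \<star> v2" "n = a \<star> n1 + b \<star> n2"
      using gen[rule_format, OF vn] by (elim bexE conjE) (rule that)
    \<comment> \<open>Substitute v2 = v3 + s v1 and n2 = n3 + s n1 in the old
      representation.\<close>
    have "v = b \<star> v3 + (a + b \<star> s) \<star> v1" "n = b \<star> n3 + (a + b \<star> s) \<star> n1"
      by (simp_all add: ab v3_def n3_def skm_diff_right skm_add_left skm_assoc)
    moreover have "a + b \<star> s \<in> R" using ab s by auto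
    ultimately show ?thesis
      using ab(2) by - (rule bexI[of _ b], rule bexI[of _ "a + b \<star> s"], intro conjI, assumption+)
  qed
  show ?thesis unfolding euclid_inv_def G3
  proof (rule bexI[of _ v3], rule bexI[of _ n3], rule bexI[of _ v1], rule bexI[of _ n1], intro conjI)
    show "G1 = enc n1 v1" "degree n3 \<le> p1 - 1" "degree n1 = p1" "v3 \<noteq> 0" "degree v3 = N - p1"
      "solves Y v1 n1" by fact+
    show "v1 = 0 \<or> degree v1 < degree v3" using dv3 v p by simp
    show "solves Y v3 n3" unfolding v3_def n3_def by (rule solves_step[OF s(1) sol])
    show "\<forall>v\<in>R. \<forall>n\<in>R. solves Y v n \<longrightarrow> (\<exists>a\<in>R. \<exists>b\<in>R. v = a \<star> v3 + b \<star> v1 \<and> n = a \<star> n3 + b \<star> n1)"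
      by (intro ballI impI gen')
    show "v3 \<in> R" "n3 \<in> R" unfolding v3_def n3_def using R s(1) by auto
  qed (use R in auto)
qed

text \<open>Write a bounded solution as v = a v1 + b v2, n = a n1 + b n2. If b is nonzero, b n2 has
  degree at least p2 > d + K - 1 and must be cancelled by a n1, which forces deg(a) > deg(b). Then a
  v1 dominates b v2, so deg(v) \<ge> deg(v1); for b = 0 this is immediate. Thus the first row is a
  solution within the bounds, or there is none.\<close>

lemma euclid_inv_final:
  assumes inv: "euclid_inv Y p1 p2 G1 G2" and p: "p1 \<le> d + K - 1" "d + K - 1 < p2" "p2 \<le> N"
  shows "N - p2 \<le> d \<Longrightarrow> filter_step q r qs d K Y
      (Some (Poly (map (coeff G1) [W..<W + (d + 1)]), Poly (map (coeff G1) [0..<W])))"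
    and "\<not> N - p2 \<le> d \<Longrightarrow> filter_step q r qs d K Y None"
proof -
  obtain v1 n1 v2 n2 where R: "v1 \<in> R" "n1 \<in> R" "v2 \<in> R" "n2 \<in> R"
    and G: "G1 = enc n1 v1" "G2 = enc n2 v2" and deg: "degree n1 \<le> p1" "degree n2 = p2"
    and v: "v1 \<noteq> 0" "degree v1 = N - p2" "v2 = 0 \<or> degree v2 < degree v1"
    and sol: "solves Y v1 n1" "solves Y v2 n2"
    and gen: "\<forall>v\<in>R. \<forall>n\<in>R. solves Y v n \<longrightarrow>
        (\<exists>a\<in>R. \<exists>b\<in>R. v = a \<star> v1 + b \<star> v2 \<and> n = a \<star> n1 + b \<star> n2)"
    using inv unfolding euclid_inv_def by (elim bexE conjE) (rule that)
  show "filter_step q r qs d K Y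
      (Some (Poly (map (coeff G1) [W..<W + (d + 1)]), Poly (map (coeff G1) [0..<W])))"
    if d: "N - p2 \<le> d"
  proof -
    have "coeff (Poly (map (coeff G1) [W..<W + (d + 1)])) i = coeff v1 i" for i
      using v(2) d deg p coeff_enc_high[of n1 v1 i]
      by (auto simp: nth_default_def G coeff_eq_0 simp del: upt_Suc)
    then have "Poly (map (coeff G1) [W..<W + (d + 1)]) = v1" by (intro poly_eqI)
    moreover have "coeff (Poly (map (coeff G1) [0..<W])) i = coeff n1 i" for i
      using deg p coeff_enc_low[of i n1 v1]
      by (auto simp: nth_default_def G coeff_eq_0 simp del: upt_Suc)
    then have "Poly (map (coeff G1) [0..<W]) = n1" by (intro poly_eqI)
    ultimately show ?thesis
      using R v d deg p sol by (auto simp: filter_step_def key_solution_def solves_def)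
  qed
  have "degree v1 \<le> d" if "key_solution q r qs d K Y (v, n)" for v n
  proof -
    have vn: "v \<in> R" "n \<in> R" "v \<noteq> 0 \<or> n \<noteq> 0" "solves Y v n" "degree v \<le> d" "degree n \<le> d + K - 1"
      using that by (auto simp: key_solution_def solves_def)
    obtain a b where ab: "a \<in> R" "b \<in> R" "v = a \<star> v1 + b \<star> v2" "n = a \<star> n1 + b \<star> n2"
      using gen[rule_format, OF vn(1,2,4)] by (elim bexE conjE) (rule that)
    have n2: "n2 \<noteq> 0" using deg p by auto
    show ?thesis
    proof (cases "b = 0")
      case True
      then have "a \<noteq> 0" using vn(3) ab by auto
      then show ?thesis using vn(5) ab True v(1) by (simp add: degree_skm)
    next
      case False
      have dbn: "degree (b \<star> n2) = degree b + p2" using False n2 deg by (simp add: degree_skm)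
      have lt: "degree b < degree a \<and> a \<noteq> 0"
      proof (rule ccontr)
        assume *: "\<not> (degree b < degree a \<and> a \<noteq> 0)"
        have "degree (a \<star> n1) < degree b + p2"
        proof (cases "a = 0")
          case False
          then show ?thesis using degree_skm_le[of a n1] deg p * by simp
        qed (use p in simp)
        then have "degree n = degree b + p2"
          unfolding ab dbn[symmetric] by (intro degree_add_eq_right)
        then show False using vn(6) p by simp
      qed
      have "degree (b \<star> v2) < degree (a \<star> v1)"
      proof (cases "v2 = 0")
        case True
        then show ?thesis using lt v(1) by (simp add: degree_skm)
      next
        case False
        then show ?thesis using lt v \<open>b \<noteq> 0\<close> by (auto simp: degree_skm)
      qed
      then have "degree v = degree (a \<star> v1)" unfolding ab by (intro degree_add_eq_left)
      then show ?thesis using vn(5) lt v(1) by (simp add: degree_skm)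
    qed
  qed
  then show "filter_step q r qs d K Y None" if "\<not> N - p2 \<le> d"
    using that v(2) by (auto simp: filter_step_def)
qed

definition split_output :: "'c list \<Rightarrow> 'c poly \<times> 'c poly" where
  "split_output xs = (Poly (take (d + 1) xs), Poly (drop (d + 1) xs))"

text \<open>Induction on p1: a zero leading coefficient lowers p1 with the same rows, a nonzero one
  triggers a division after which p1 takes the role of p2. The cost bound is a potential: a division
  of quotient degree k is paid for by the drop of p2 by k, a zero test by the drop of p1.\<close>

lemma euclid_program:
  assumes "row_ok L n xs" "row_ok L n ys" "p1 < p2" "p2 \<le> N" "d + K - 1 < p2"
  shows "\<exists>P. prog_consts P \<subseteq> Fqr \<and>
    (\<forall>\<sigma> Y. Y \<in> R \<and> range \<sigma> \<subseteq> Fqr \<and> euclid_inv Y p1 p2 (row \<sigma> xs) (row \<sigma> ys) \<longrightarrow>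
       filter_step q r qs d K Y (map_option split_output (run q P \<sigma>)) \<and>
       run_cost q P \<sigma> \<le> p2 * (2 + 5 * L) + p1)"
  using assms
proof (induction p1 arbitrary: n xs ys p2 rule: less_induct)
  case (less p1)
  note ok = less.prems(1,2) and p = less.prems(3-5)
  show ?case
  proof (cases "p1 \<le> d + K - 1")
    case True
    \<comment> \<open>Scheme finished. Both p2 and d are known when the program is built, so the
      choice between output and failure costs nothing at run time.\<close>
    define P where "P = (if N - p2 \<le> d then Return (map (\<lambda>i. xs ! i) [W..<W + (d + 1)] @ map (\<lambda>i. xs ! i) [0..<W]) else Fail)"
    have dN: "d \<le> N" using bound K_pos by simp
    have len: "length xs = L" using ok by (simp add: row_ok_def)
    have vals: "map (operand_val \<sigma>) (map (\<lambda>i. xs ! i) [a..<b]) = map (coeff (row \<sigma> xs)) [a..<b]" if "b \<le> L" for \<sigma> a b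
      using that by (auto simp: coeff_row len)
    have "prog_consts P \<subseteq> Fqr"
    proof -
      have "operand_consts (xs ! i) \<subseteq> Fqr" if "i < L" for i using ok that len by (simp add: row_ok_def)
      then have *: "x \<in> Fqr" if "x \<in> operand_consts (xs ! i)" "i < L" for x i using that by blast
      then show ?thesis using dN by (auto simp: P_def simp del: upt_Suc elim!: *)
    qed
    moreover have "filter_step q r qs d K Y (map_option split_output (run q P \<sigma>)) \<and> run_cost q P \<sigma> = 0"
      if inv: "euclid_inv Y p1 p2 (row \<sigma> xs) (row \<sigma> ys)" for \<sigma> Y
    proof (cases "N - p2 \<le> d")
      case d: True
      have "run q P \<sigma> = Some (map (coeff (row \<sigma> xs)) [W..<W + (d + 1)] @ map (coeff (row \<sigma> xs)) [0..<W])"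
        using vals[of "W + (d + 1)" \<sigma> W] vals[of W \<sigma> 0] dN d by (simp add: P_def del: upt_Suc)
      then have "map_option split_output (run q P \<sigma>) =
          Some (Poly (map (coeff (row \<sigma> xs)) [W..<W + (d + 1)]), Poly (map (coeff (row \<sigma> xs)) [0..<W]))"
        by (simp add: split_output_def del: upt_Suc)
      then show ?thesis using euclid_inv_final(1)[OF inv True p(3,2) d] d by (simp add: P_def)
    next
      case False
      then show ?thesis using euclid_inv_final(2)[OF inv True p(3,2) False] by (simp add: P_def)
    qed
    ultimately show ?thesis by (intro exI[of _ P]) auto
  next
    case False
    then have p1: "0 < p1" by simp
    define k where "k = p2 - p1"
    have k: "p1 + k = p2" "k \<ge> 1" using p by (auto simp: k_def)
    have "p1 + k < W" using k p by simp
    from divide_row[OF ok this, of] obtain fs zs where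
      fs: "length fs \<le> (k + 1) * (1 + 2 * L) + k * L" "code_ok fs" "row_ok L (n + length fs) zs"
      and run: "\<And>\<sigma>. range \<sigma> \<subseteq> Fqr \<and> coeff (row \<sigma> xs) p1 \<noteq> 0 \<and> coeff (row \<sigma> ys) (p1 + k) \<noteq> 0 \<and>
        (\<forall>i. p1 < i \<and> i < W \<longrightarrow> coeff (row \<sigma> xs) i = 0) \<and>
        (\<forall>i. p1 + k < i \<and> i < W \<longrightarrow> coeff (row \<sigma> ys) i = 0) \<and> degree (row \<sigma> xs) + k < L \<Longrightarrow>
      (\<exists>s\<in>R. s \<noteq> 0 \<and> degree s = k \<and> row (exec q n fs \<sigma>) zs = row \<sigma> ys - s \<star> row \<sigma> xs \<and>
        (\<forall>i. p1 \<le> i \<and> i < W \<longrightarrow> coeff (row \<sigma> ys - s \<star> row \<sigma> xs) i = 0))"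
      by auto
    \<comment> \<open>From k \<ge> 1 follows k + 1 \<le> 2 k, so a division costs at most 2 k (1 + 2
      L) + k L = k (2 + 5 L), linear in the drop of p2.\<close>
    have "(k + 1) * (1 + 2 * L) \<le> (2 * k) * (1 + 2 * L)" using k(2) by (intro mult_le_mono1) simp
    then have len_fs: "length fs \<le> k * (2 + 5 * L)"
      using fs(1) by (simp add: algebra_simps)
    have lt: "p1 - 1 < p1" "p1 - 1 < p2" "p1 \<le> N" "d + K - 1 < p1" using p p1 False by auto
    obtain P1 where P1: "prog_consts P1 \<subseteq> Fqr" and P1_run: "\<And>\<sigma> Y. Y \<in> R \<Longrightarrow> range \<sigma> \<subseteq> Fqr \<Longrightarrow>
        euclid_inv Y (p1 - 1) p2 (row \<sigma> xs) (row \<sigma> ys) \<Longrightarrow>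
       filter_step q r qs d K Y (map_option split_output (run q P1 \<sigma>)) \<and> run_cost q P1 \<sigma> \<le> p2 * (2 + 5 * L) + (p1 - 1)"
      using less.IH[OF lt(1) ok lt(2) p(2,3)] by (elim exE conjE) (rule that, assumption, simp)
    have "row_ok L (n + length fs) xs" by (rule row_ok_mono[OF ok(1)]) simp
    note ok' = fs(3) this
    obtain P2 where P2: "prog_consts P2 \<subseteq> Fqr" and P2_run: "\<And>\<sigma> Y. Y \<in> R \<Longrightarrow> range \<sigma> \<subseteq> Fqr \<Longrightarrow>
        euclid_inv Y (p1 - 1) p1 (row \<sigma> zs) (row \<sigma> xs) \<Longrightarrow>
       filter_step q r qs d K Y (map_option split_output (run q P2 \<sigma>)) \<and> run_cost q P2 \<sigma> \<le> p1 * (2 + 5 * L) + (p1 - 1)"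
      using less.IH[OF lt(1) ok' lt(1) lt(3,4)] by (elim exE conjE) (rule that, assumption, simp)
    define P where "P = If_Zero (xs ! p1) P1 (emit n fs P2)"
    have len: "length xs = L" "length ys = L" using ok by (simp_all add: row_ok_def)
    have "operand_consts (xs ! p1) \<subseteq> Fqr" using ok p len by (auto simp: row_ok_def)
    then have "prog_consts P \<subseteq> Fqr"
      using P1 P2 fs(2) by (auto simp: P_def prog_consts_emit code_ok_def)
    moreover have "filter_step q r qs d K Y (map_option split_output (run q P \<sigma>)) \<and>
       run_cost q P \<sigma> \<le> p2 * (2 + 5 * L) + p1"
      if Y: "Y \<in> R" and \<sigma>: "range \<sigma> \<subseteq> Fqr" and inv: "euclid_inv Y p1 p2 (row \<sigma> xs) (row \<sigma> ys)" for \<sigma> Y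
    proof -
      obtain v1 n1 v2 n2 where G: "row \<sigma> xs = enc n1 v1" "row \<sigma> ys = enc n2 v2"
        and deg: "degree n1 \<le> p1" "degree n2 = p2" "degree v1 = N - p2"
        using inv unfolding euclid_inv_def by (elim bexE conjE) (rule that)
      have test: "operand_val \<sigma> (xs ! p1) = coeff (row \<sigma> xs) p1" using len p by (simp add: coeff_row)
      show ?thesis
      proof (cases "coeff (row \<sigma> xs) p1 = 0")
        case True
        have "euclid_inv Y (p1 - 1) p2 (row \<sigma> xs) (row \<sigma> ys)"
        proof -
          have low: "coeff n p1 = 0 \<Longrightarrow> degree n \<le> p1 \<Longrightarrow> degree n \<le> p1 - 1" for n :: "'c poly"
            using p1 by (metis One_nat_def degree_0 le_Suc_eq leading_coeff_0_iff Suc_pred nat_less_le)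
          have "coeff (enc n v) p1 = coeff n p1" for n v using p by (simp add: coeff_enc_low)
          then show ?thesis using inv True low unfolding euclid_inv_def by metis
        qed
        from P1_run[OF Y \<sigma> this] have
          "filter_step q r qs d K Y (map_option split_output (run q P1 \<sigma>))"
          "Suc (run_cost q P1 \<sigma>) \<le> p2 * (2 + 5 * L) + p1" using p1 by linarith+
        then show ?thesis using True test by (simp only: P_def run.simps run_cost.simps simp_thms if_True)
      next
        case False
        have "degree (row \<sigma> xs) \<le> degree v1 + W" unfolding G using deg p by (intro degree_enc_le) simp
        then have "degree (row \<sigma> xs) + k < L" using deg p k by simp
        moreover have "n2 \<noteq> 0" using deg p by auto
        then have "coeff n2 p2 \<noteq> 0" using deg by auto
        ultimately obtain s where s: "s \<in> R" "s \<noteq> 0" "degree s = k" "row (exec q n fs \<sigma>) zs = row \<sigma> ys - s \<star> row \<sigma> xs"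
          "\<And>i. p1 \<le> i \<Longrightarrow> i < W \<Longrightarrow> coeff (row \<sigma> ys - s \<star> row \<sigma> xs) i = 0"
          using run[of \<sigma>] \<sigma> False deg p k by (auto simp: G coeff_enc_low coeff_eq_0)
        have "euclid_inv Y (p1 - 1) p1 (row (exec q n fs \<sigma>) zs) (row (exec q n fs \<sigma>) xs)"
          unfolding s(4) row_exec[OF ok(1)]
          by (rule euclid_inv_step[OF inv p(1,2) p1 s(1,2) _ False s(5)]) (simp_all add: s(3) k_def)
        from P2_run[OF Y exec_in[OF \<sigma> fs(2)] this]
        have P2': "filter_step q r qs d K Y (map_option split_output (run q P2 (exec q n fs \<sigma>)))"
          "run_cost q P2 (exec q n fs \<sigma>) \<le> p1 * (2 + 5 * L) + (p1 - 1)" by auto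
        have "p2 * (2 + 5 * L) = p1 * (2 + 5 * L) + k * (2 + 5 * L)"
          unfolding k(1)[symmetric] by (rule add_mult_distrib)
        then have "run_cost q P \<sigma> \<le> p2 * (2 + 5 * L) + p1"
          using P2'(2) len_fs p1 False test by (simp add: P_def run_cost_emit)
        then show ?thesis using P2'(1) False test by (simp add: P_def run_emit)
      qed
    qed
    ultimately show ?thesis by (intro exI[of _ P]) blast
  qed
qed

lemma filter_program:
  "\<exists>P. performs_filter_step q r qs d K P \<and>
     (\<forall>Y\<in>carrier (skew_R q r). degree Y < N \<longrightarrow> run_cost q P (coeff Y) \<le> 23 * N ^ 2)"
proof -
  \<comment> \<open>The input registers already hold Y; the constant 1 at position W is the cofactor
    of the pair (1, Y).\<close>
  define xs :: "'c operand list" where "xs = map (\<lambda>i. if i < N then Reg i else if i = W then Con 1 else Con 0) [0..<L]"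
  define ys :: "'c operand list" where "ys = map (\<lambda>i. Con (coeff M i)) [0..<L]"
  have ok: "row_ok L N xs" "row_ok L N ys"
    using Pi_in_R by (auto simp: row_ok_def xs_def ys_def R_coeff split: if_splits simp del: upt_Suc)
  have "N - 1 < N" using N_pos by simp
  from euclid_program[OF ok this order.refl bound] obtain P where P: "prog_consts P \<subseteq> Fqr"
    and run: "\<And>\<sigma> Y. Y \<in> R \<Longrightarrow> range \<sigma> \<subseteq> Fqr \<Longrightarrow> euclid_inv Y (N - 1) N (row \<sigma> xs) (row \<sigma> ys) \<Longrightarrow>
       filter_step q r qs d K Y (map_option split_output (run q P \<sigma>)) \<and>
       run_cost q P \<sigma> \<le> N * (2 + 5 * L) + (N - 1)" by blast
  have "filter_step q r qs d K Y (map_option split_output (run q P (coeff Y))) \<and>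
       run_cost q P (coeff Y) \<le> N * (2 + 5 * L) + (N - 1)" if Y: "Y \<in> R" "degree Y < N" for Y
  proof (rule run)
    have "row (coeff Y) xs = enc Y 1"
      by (rule poly_eqI) (use Y in \<open>auto simp: coeff_row xs_def enc_def coeff_eq_0 simp del: upt_Suc\<close>)
    moreover have "row (coeff Y) ys = enc M 0"
      by (rule poly_eqI) (auto simp: coeff_row ys_def enc_def coeff_eq_0 simp del: upt_Suc)
    ultimately show "euclid_inv Y (N - 1) N (row (coeff Y) xs) (row (coeff Y) ys)"
      using euclid_inv_init[OF Y] by simp
    show "range (coeff Y) \<subseteq> Fqr" using Y R_coeff by auto
  qed fact
  \<comment> \<open>With L = 2 (N + 1) the left side is 10 N^2 + 13 N - 1, and N \<le> N^2 gives the
    constant 10 + 13.\<close>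
  moreover have "N * (2 + 5 * L) + (N - 1) \<le> 23 * N ^ 2"
  proof -
    have "N \<le> N ^ 2" using N_pos by (simp add: power2_eq_square)
    moreover have "N * (2 + 5 * L) + (N - 1) \<le> 10 * N ^ 2 + 13 * N" by (simp add: power2_eq_square algebra_simps)
    ultimately show ?thesis by linarith
  qed
  ultimately show ?thesis
    using P by (intro exI[of _ P]) (fastforce simp: performs_filter_step_def split_output_def[abs_def])
qed

end

section \<open>Counting matrices\<close>

lemma card_carrier_vec:
  assumes "finite (UNIV :: 'e set)"
  shows "finite (carrier_vec n :: 'e vec set)" "card (carrier_vec n :: 'e vec set) = CARD('e) ^ n"
proof -
  have "bij_betw (\<lambda>v. \<lambda>i\<in>{..<n}. v $ i) (carrier_vec n :: 'e vec set) ({..<n} \<rightarrow>\<^sub>E UNIV)"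
  proof (rule bij_betwI[where g = "vec n"])
    fix f :: "nat \<Rightarrow> 'e" assume f: "f \<in> {..<n} \<rightarrow>\<^sub>E UNIV"
    show "(\<lambda>i\<in>{..<n}. vec n f $ i) = f"
      by (rule ext) (use PiE_arb[OF f] in \<open>simp add: restrict_def\<close>)
  qed (simp_all add: vec_eq_iff)
  from bij_betw_same_card[OF this] bij_betw_finite[OF this]
  show "finite (carrier_vec n :: 'e vec set)" "card (carrier_vec n :: 'e vec set) = CARD('e) ^ n"
    using assms by (simp_all add: card_funcsetE finite_PiE)
qed

lemma card_carrier_mat:
  assumes "finite (UNIV :: 'e set)"
  shows "finite (carrier_mat k n :: 'e mat set)" "card (carrier_mat k n :: 'e mat set) = CARD('e) ^ (k * n)"
proof -
  have "bij_betw (\<lambda>M. \<lambda>ij\<in>{..<k} \<times> {..<n}. M $$ ij) (carrier_mat k n :: 'e mat set) ({..<k} \<times> {..<n} \<rightarrow>\<^sub>E UNIV)"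
  proof (rule bij_betwI[where g = "mat k n"])
    fix f :: "nat \<times> nat \<Rightarrow> 'e" assume f: "f \<in> {..<k} \<times> {..<n} \<rightarrow>\<^sub>E UNIV"
    show "(\<lambda>ij\<in>{..<k} \<times> {..<n}. mat k n f $$ ij) = f"
    proof (rule ext)
      fix x :: "nat \<times> nat"
      show "(\<lambda>ij\<in>{..<k} \<times> {..<n}. mat k n f $$ ij) x = f x"
        using PiE_arb[OF f, of x] by (cases x) (simp add: restrict_def)
    qed
  qed (simp_all add: mat_eq_iff)
  from bij_betw_same_card[OF this] bij_betw_finite[OF this]
  show "finite (carrier_mat k n :: 'e mat set)" "card (carrier_mat k n :: 'e mat set) = CARD('e) ^ (k * n)"
    using assms by (simp_all add: card_funcsetE finite_PiE)
qed

text \<open>A maximal independent set of columns has \<open>rank A\<close> elements, and by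
  maximality every further column depends on it.\<close>

lemma (in vec_space) column_basis:
  assumes "A \<in> carrier_mat n nc"
  obtains S where "finite S" "card S = rank A" "S \<subseteq> carrier_vec n" "set (cols A) \<subseteq> span S"
proof -
  have cols: "set (cols A) \<subseteq> carrier_vec n" using cols_dim assms by blast
  let ?P = "\<lambda>T. T \<subseteq> set (cols A) \<and> lin_indpt T"
  have "lin_indpt {}" by (rule finite_lin_indpt2) simp_all
  then obtain S where S: "finite S" "maximal S ?P"
    using maximal_exists_superset[of "set (cols A)" ?P "{}"] by auto
  then have S': "S \<subseteq> set (cols A)" "lin_indpt S" by (simp_all add: maximal_def)
  then have SC: "S \<subseteq> carrier_vec n" using cols by (rule_tac subset_trans)
  have "x \<in> span S" if x: "x \<in> set (cols A)" for x
  proof (cases "x \<in> S")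
    case True
    then show ?thesis by (rule span_mem[rotated]) (use SC in simp)
  next
    case False
    have xC: "x \<in> carrier_vec n" using x cols by (rule_tac subsetD)
    have "lin_dep (S \<union> {x})"
    proof (rule ccontr)
      assume "lin_indpt (S \<union> {x})"
      then have P: "?P (S \<union> {x})" using x S'(1) by simp
      have max: "?P T \<Longrightarrow> S \<subseteq> T \<Longrightarrow> T = S" for T
        using S(2) unfolding maximal_def by simp
      have "S \<union> {x} = S" by (rule max[OF P Un_upper1])
      then show False using False by auto
    qed
    then show ?thesis using lin_dep_iff_in_span[of S x] S'(2) SC xC False by simp
  qed
  then show ?thesis using that[of S] S(1) SC rank_card_indpt[OF assms S(2)] by auto
qed

text \<open>The vectors on which two matrices agree form a submodule, which contains the span as
  soon as it contains the generators.\<close>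

lemma (in vec_space) mult_mat_vec_eq_span:
  assumes "M \<in> carrier_mat k n" "M' \<in> carrier_mat k n" "S \<subseteq> carrier_vec n"
    and "\<And>v. v \<in> S \<Longrightarrow> M *\<^sub>v v = M' *\<^sub>v v" and "w \<in> span S"
  shows "M *\<^sub>v w = M' *\<^sub>v w"
proof -
  define V where "V = {v \<in> carrier_vec n. M *\<^sub>v v = M' *\<^sub>v v}"
  have "submodule class_ring V (module_vec TYPE('a) n)"
  proof
    show "V \<subseteq> carrier (module_vec TYPE('a) n)" by (auto simp: V_def)
    show "\<zero>\<^bsub>module_vec TYPE('a) n\<^esub> \<in> V"
      using assms(1,2) by (auto simp: V_def module_vec_simps)
    fix v w assume "v \<in> V" "w \<in> V"
    then show "v \<oplus>\<^bsub>module_vec TYPE('a) n\<^esub> w \<in> V"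
      using assms(1,2) by (auto simp: V_def module_vec_simps mult_add_distrib_mat_vec)
  next
    fix c :: 'a and v assume "v \<in> V"
    then show "c \<odot>\<^bsub>module_vec TYPE('a) n\<^esub> v \<in> V"
      using assms(1,2) by (auto simp: V_def module_vec_simps mult_mat_vec)
  qed
  moreover have "S \<subseteq> V" using assms(3,4) by (auto simp: V_def)
  ultimately have "span S \<subseteq> V" by (intro span_is_subset)
  then show ?thesis using assms(5) by (auto simp: V_def)
qed

text \<open>A product M E depends only on the values of M on a spanning set of the column space of
  E. There are \<open>rank E\<close> such vectors and each value is one of CARD('e)^n
  vectors.\<close>

lemma card_left_multiples:
  fixes E :: "'e::field mat"
  assumes finE: "finite (UNIV :: 'e set)" and E: "E \<in> carrier_mat n n"
  shows "finite ((\<lambda>M. M * E) ` carrier_mat n n)"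
    and "card ((\<lambda>M. M * E) ` carrier_mat n n) \<le> CARD('e) ^ (n * vec_space.rank n E)"
proof -
  interpret vec_space "TYPE('e)" n .
  obtain S where S: "finite S" "card S = rank E" "S \<subseteq> carrier_vec n" "set (cols E) \<subseteq> span S"
    using column_basis[OF E] .
  define X where "X = (\<lambda>M. M * E) ` carrier_mat n n"
  have "finite X" using card_carrier_mat(1)[OF finE] by (simp add: X_def)
  then show "finite ((\<lambda>M. M * E) ` carrier_mat n n)" by (simp add: X_def)
  \<comment> \<open>A product does not determine its left factor, so one factor is chosen per
    product; the values of that choice on S then identify the product.\<close>
  define rep where "rep Z = (SOME M. M \<in> carrier_mat n n \<and> Z = M * E)" for Z
  have rep: "rep Z \<in> carrier_mat n n" "Z = rep Z * E" if "Z \<in> X" for Z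
  proof -
    have "\<exists>M. M \<in> carrier_mat n n \<and> Z = M * E" using that by (auto simp: X_def)
    from someI_ex[OF this] show "rep Z \<in> carrier_mat n n" "Z = rep Z * E" unfolding rep_def by blast+
  qed
  define f where "f Z = (\<lambda>v\<in>S. rep Z *\<^sub>v v)" for Z
  have "inj_on f X"
  proof (rule inj_onI)
    fix Z Z' assume Z: "Z \<in> X" "Z' \<in> X" "f Z = f Z'"
    have eq: "rep Z *\<^sub>v v = rep Z' *\<^sub>v v" if "v \<in> S" for v
      using fun_cong[OF Z(3), of v] that by (simp add: f_def)
    have "rep Z * E = rep Z' * E"
    proof (rule mat_col_eqI)
      fix j assume "j < dim_col (rep Z' * E)"
      then have j: "j < n" using E by simp
      then have "col E j \<in> span S" using S(4) E by (auto simp: cols_def)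
      from mult_mat_vec_eq_span[OF rep(1)[OF Z(1)] rep(1)[OF Z(2)] S(3) eq this]
      show "col (rep Z * E) j = col (rep Z' * E) j"
        unfolding col_mult2[OF rep(1)[OF Z(1)] E j] col_mult2[OF rep(1)[OF Z(2)] E j] .
    qed (use rep(1) Z in auto)
    then show "Z = Z'" using rep(2) Z by metis
  qed
  moreover have "f ` X \<subseteq> S \<rightarrow>\<^sub>E carrier_vec n"
  proof (rule image_subsetI)
    fix Z assume Z: "Z \<in> X"
    have "rep Z *\<^sub>v v \<in> carrier_vec n" if "v \<in> S" for v
      using mult_mat_vec_carrier[OF rep(1)[OF Z] subsetD[OF S(3) that]] .
    then show "f Z \<in> S \<rightarrow>\<^sub>E carrier_vec n" by (simp add: f_def)
  qed
  ultimately have "card X \<le> card (S \<rightarrow>\<^sub>E (carrier_vec n :: 'e vec set))"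
    using S(1) card_carrier_vec(1)[OF finE] by (intro card_inj_on_le) (auto intro: finite_PiE)
  also have "\<dots> = CARD('e) ^ (n * rank E)"
    using S(1,2) by (simp add: card_funcsetE card_carrier_vec(2)[OF finE] power_mult)
  finally show "card ((\<lambda>M. M * E) ` carrier_mat n n) \<le> CARD('e) ^ (n * vec_space.rank n E)"
    by (simp add: X_def)
qed

section \<open>The matrix representation on the torsion of one modulus\<close>

locale torsion_rep = skew_ring q r ty for q r and ty :: "'c::field itself" +
  fixes a :: "'c poly" and h :: "'c poly \<Rightarrow> 'e::field" and e :: "nat \<Rightarrow> 'c" and m :: nat
  assumes a_in_A: "a \<in> A" and a_nz: "a \<noteq> 0" and deg_a: "degree a = m"
    and card_E: "CARD('e) = q ^ m"
    and residue: "residue_map q a h"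
    and basis: "torsion_basis q r a h e"
begin

abbreviation T where "T \<equiv> torsion q r a"
abbreviation scale where "scale \<equiv> residue_scale q r h"
abbreviation comb where "comb \<equiv> residue_comb q r h e"
abbreviation \<Theta> where "\<Theta> \<equiv> Theta_comp q r h e"

section \<open>The residue field acting on the torsion\<close>

lemma h_add: "x \<in> A \<Longrightarrow> y \<in> A \<Longrightarrow> h (x + y) = h x + h y"
  and h_mult: "x \<in> A \<Longrightarrow> y \<in> A \<Longrightarrow> h (x * y) = h x * h y"
  and h_one: "h 1 = 1"
proof -
  have "h \<in> Ring.ring_hom (poly_A q) class_ring" using residue by (simp add: residue_map_def)
  note hom = ring_hom_add[OF this] ring_hom_mult[OF this] ring_hom_one[OF this]
  show "x \<in> A \<Longrightarrow> y \<in> A \<Longrightarrow> h (x + y) = h x + h y" "x \<in> A \<Longrightarrow> y \<in> A \<Longrightarrow> h (x * y) = h x * h y" "h 1 = 1"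
    using hom(1)[of x y] hom(2)[of x y] hom(3) by (simp_all add: poly_A_def)
qed

lemma h_diff: "x \<in> A \<Longrightarrow> y \<in> A \<Longrightarrow> h (x - y) = h x - h y"
  using h_add[of "x - y" y] by simp

lemma h_surj: "\<exists>b\<in>A. h b = c"
proof -
  have "c \<in> h ` A" using residue by (simp add: residue_map_def)
  then show ?thesis by blast
qed

lemma h_eq_0_iff: "x \<in> A \<Longrightarrow> h x = 0 \<longleftrightarrow> (\<exists>b\<in>A. x = b * a)"
proof -
  assume x: "x \<in> A"
  have "{x \<in> A. h x = 0} = {b * a | b. b \<in> A}"
    using residue by (simp add: residue_map_def a_kernel_def kernel_def cgenideal_def poly_A_def)
  then show ?thesis using x by blast
qed

text \<open>Centrality of \<phi>_a: applying it after f is the same as applying f after it, and the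
  torsion is its kernel.\<close>

lemma torsion_eval: "f \<in> R \<Longrightarrow> x \<in> T \<Longrightarrow> skew_eval q f x \<in> T"
proof -
  assume f: "f \<in> R" and x: "x \<in> T"
  have "skew_eval q (drinfeld r a) (skew_eval q f x) = skew_eval q (f \<star> drinfeld r a) x"
    by (simp add: drinfeld_central[OF a_in_A f] flip: eval_skm)
  then show ?thesis using x by (simp add: eval_skm torsion_def)
qed

lemma torsion_add: "x \<in> T \<Longrightarrow> y \<in> T \<Longrightarrow> x + y \<in> T"
  by (simp add: torsion_def eval_add)

lemma torsion_sum: "(\<And>i. i \<in> I \<Longrightarrow> f i \<in> T) \<Longrightarrow> sum f I \<in> T"
  by (induction I rule: infinite_finite_induct) (auto simp: torsion_def eval_add)

text \<open>Two representatives of a residue class differ by a multiple of a, which acts as 0 on the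
  torsion; this frees the scalar action from the choice made by \<open>SOME\<close>.\<close>

lemma scale_h:
  assumes "b \<in> A" "x \<in> T"
  shows "scale (h b) x = skew_eval q (drinfeld r b) x"
proof -
  define b' where "b' = (SOME b'. b' \<in> A \<and> h b' = h b)"
  have b': "b' \<in> A" "h b' = h b"
    unfolding b'_def using someI_ex[of "\<lambda>b'. b' \<in> A \<and> h b' = h b"] assms by blast+
  then have "h (b' - b) = 0" using assms by (simp add: h_diff)
  then obtain c where c: "c \<in> A" "b' - b = c * a" using h_eq_0_iff[of "b' - b"] b' assms by auto
  have "skew_eval q (drinfeld r b') x - skew_eval q (drinfeld r b) x = skew_eval q (drinfeld r (c * a)) x"
    unfolding c(2)[symmetric] drinfeld_diff eval_diff_left by simp
  also have "\<dots> = 0" using assms(2) c a_in_A by (simp add: drinfeld_mult eval_skm torsion_def)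
  finally show ?thesis by (simp add: residue_scale_def b'_def)
qed

lemma scale_in: "x \<in> T \<Longrightarrow> scale c x \<in> T"
  using h_surj[of c] by (auto simp: scale_h intro!: torsion_eval)

lemma scale_add_left: "x \<in> T \<Longrightarrow> scale (c + d) x = scale c x + scale d x"
proof -
  assume x: "x \<in> T"
  obtain b b' where "b \<in> A" "b' \<in> A" "h b = c" "h b' = d" using h_surj by metis
  then show ?thesis
    using scale_h[of "b + b'" x] x by (auto simp: h_add drinfeld_add eval_add_left scale_h)
qed

lemma scale_mult: "x \<in> T \<Longrightarrow> scale (c * d) x = scale c (scale d x)"
proof -
  assume x: "x \<in> T"
  obtain b b' where b: "b \<in> A" "b' \<in> A" "h b = c" "h b' = d" using h_surj by metis
  then show ?thesis
    using scale_h[of "b * b'" x] x torsion_eval[of "drinfeld r b'" x]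
    by (auto simp: h_mult drinfeld_mult eval_skm scale_h)
qed

text \<open>Scalars act as central elements \<phi>_b, so every element of R acts linearly over the
  residue field and is described by a matrix.\<close>

lemma scale_eval: "f \<in> R \<Longrightarrow> x \<in> T \<Longrightarrow> skew_eval q f (scale c x) = scale c (skew_eval q f x)"
proof -
  assume f: "f \<in> R" and x: "x \<in> T"
  obtain b where b: "b \<in> A" "h b = c" using h_surj by metis
  then show ?thesis
    using x f torsion_eval[of f x] by (auto simp: scale_h drinfeld_central simp flip: eval_skm)
qed

lemma scale_add_right: "x \<in> T \<Longrightarrow> y \<in> T \<Longrightarrow> scale c (x + y) = scale c x + scale c y"
  using h_surj[of c] torsion_add[of x y] by (auto simp: scale_h eval_add)

lemma scale_0_right [simp]: "scale c 0 = 0"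
  by (simp add: residue_scale_def)

lemma scale_sum_right: "(\<And>i. i \<in> I \<Longrightarrow> f i \<in> T) \<Longrightarrow> scale c (sum f I) = (\<Sum>i\<in>I. scale c (f i))"
  by (induction I rule: infinite_finite_induct) (auto simp: scale_add_right torsion_sum)

lemma scale_0_left: "x \<in> T \<Longrightarrow> scale 0 x = 0"
  using scale_add_left[of x 0 0] by (metis add_cancel_right_right add_0)

lemma scale_sum_left: "x \<in> T \<Longrightarrow> scale (sum g I) x = (\<Sum>i\<in>I. scale (g i) x)"
  by (induction I rule: infinite_finite_induct) (auto simp: scale_add_left scale_0_left)

lemma basis_in: "s < r \<Longrightarrow> e s \<in> T"
  using basis by (simp add: torsion_basis_def)

lemma comb_in: "comb v \<in> T"
  by (auto simp: residue_comb_def intro!: torsion_sum scale_in basis_in)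

lemma comb_surj: "x \<in> T \<Longrightarrow> \<exists>v\<in>carrier_vec r. x = comb v"
  using basis unfolding torsion_basis_def by blast

lemma comb_inj: "v \<in> carrier_vec r \<Longrightarrow> w \<in> carrier_vec r \<Longrightarrow> comb v = comb w \<Longrightarrow> v = w"
  using basis comb_in[of v] unfolding torsion_basis_def by metis

lemma finite_E: "finite (UNIV :: 'e set)"
  using card_E by (intro card_ge_0_finite) simp

text \<open>Counted through coordinates in the given basis. The exponent m r is the degree of
  \<phi>_a, so the torsion has as many elements as the root bound permits.\<close>

lemma card_torsion: "card T = q ^ (m * r)"
proof -
  have "bij_betw comb (carrier_vec r) T"
    using comb_in comb_surj comb_inj by (auto simp: bij_betw_def inj_on_def)
  from bij_betw_same_card[OF this] show ?thesis
    by (simp add: card_carrier_vec(2)[OF finite_E] card_E power_mult)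
qed

lemma comb_add: "v \<in> carrier_vec r \<Longrightarrow> w \<in> carrier_vec r \<Longrightarrow> comb (v + w) = comb v + comb w"
  by (simp add: residue_comb_def scale_add_left basis_in sum.distrib)

lemma comb_zero: "comb (0\<^sub>v r) = 0"
  by (simp add: residue_comb_def scale_0_left basis_in)

section \<open>The matrix of a skew polynomial and its kernel\<close>

lemma Theta_unique:
  assumes "M \<in> carrier_mat r r" "\<And>j. j < r \<Longrightarrow> skew_eval q f (e j) = comb (col M j)"
  shows "\<Theta> f = M"
  unfolding Theta_comp_def
proof (rule the_equality)
  fix M' assume M': "M' \<in> carrier_mat r r \<and> (\<forall>j<r. skew_eval q f (e j) = comb (col M' j))"
  show "M' = M"
  proof (rule mat_col_eqI)
    fix j assume "j < dim_col M"
    then have j: "j < r" using assms by simp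
    show "col M' j = col M j"
      by (rule comb_inj) (use assms M' j in \<open>auto simp: carrier_vecI\<close>)
  qed (use assms M' in auto)
qed (use assms in auto)

lemma Theta_spec:
  assumes f: "f \<in> R"
  shows "\<Theta> f \<in> carrier_mat r r" "j < r \<Longrightarrow> skew_eval q f (e j) = comb (col (\<Theta> f) j)"
proof -
  have "\<exists>v. v \<in> carrier_vec r \<and> skew_eval q f (e j) = comb v" if "j < r" for j
    using comb_surj[OF torsion_eval[OF f basis_in[OF that]]] by blast
  then obtain v where v: "\<And>j. j < r \<Longrightarrow> v j \<in> carrier_vec r \<and> skew_eval q f (e j) = comb (v j)"
    by metis
  define M where "M = mat r r (\<lambda>(i, j). v j $ i)"
  have col: "col M j = v j" if "j < r" for j
    using v[OF that] that by (auto simp: M_def)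
  have M: "M \<in> carrier_mat r r" by (simp add: M_def)
  have "\<Theta> f = M" by (rule Theta_unique[OF M]) (use v col in auto)
  then show "\<Theta> f \<in> carrier_mat r r" "j < r \<Longrightarrow> skew_eval q f (e j) = comb (col (\<Theta> f) j)"
    using M v col by auto
qed

lemma comb_mult_mat_vec:
  assumes M: "M \<in> carrier_mat r r" and v: "v \<in> carrier_vec r"
  shows "comb (M *\<^sub>v v) = (\<Sum>s<r. scale (v $ s) (comb (col M s)))"
proof -
  have "comb (M *\<^sub>v v) = (\<Sum>i<r. \<Sum>s<r. scale (v $ s * M $$ (i, s)) (e i))"
    using M v by (auto simp: residue_comb_def scalar_prod_def scale_sum_left basis_in atLeast0LessThan
        mult.commute intro!: sum.cong)
  also have "\<dots> = (\<Sum>s<r. \<Sum>i<r. scale (v $ s) (scale (M $$ (i, s)) (e i)))"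
    by (subst sum.swap) (auto simp: scale_mult basis_in intro!: sum.cong)
  also have "\<dots> = (\<Sum>s<r. scale (v $ s) (comb (col M s)))"
  proof (intro sum.cong refl)
    fix s assume "s \<in> {..<r}"
    then have "comb (col M s) = (\<Sum>i<r. scale (M $$ (i, s)) (e i))"
      using M by (simp add: residue_comb_def)
    moreover have "scale (v $ s) (\<Sum>i<r. scale (M $$ (i, s)) (e i)) =
        (\<Sum>i<r. scale (v $ s) (scale (M $$ (i, s)) (e i)))"
      by (rule scale_sum_right) (auto intro!: scale_in basis_in)
    ultimately show "(\<Sum>i<r. scale (v $ s) (scale (M $$ (i, s)) (e i))) = scale (v $ s) (comb (col M s))"
      by simp
  qed
  finally show ?thesis .
qed

lemma eval_comb:
  assumes f: "f \<in> R" and v: "v \<in> carrier_vec r"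
  shows "skew_eval q f (comb v) = comb (\<Theta> f *\<^sub>v v)"
  unfolding comb_mult_mat_vec[OF Theta_spec(1)[OF f] v]
  by (simp add: residue_comb_def[of q r h e v] eval_sum scale_eval[OF f] basis_in Theta_spec(2)[OF f])

lemma Theta_mult:
  assumes f: "f \<in> R" and g: "g \<in> R"
  shows "\<Theta> (f \<star> g) = \<Theta> f * \<Theta> g"
proof (rule Theta_unique)
  show "\<Theta> f * \<Theta> g \<in> carrier_mat r r" using Theta_spec(1) f g by (intro mult_carrier_mat)
  fix j assume j: "j < r"
  have "col (\<Theta> g) j \<in> carrier_vec r" using Theta_spec(1)[OF g] j by auto
  then show "skew_eval q (f \<star> g) (e j) = comb (col (\<Theta> f * \<Theta> g) j)"
    unfolding col_mult2[OF Theta_spec(1)[OF f] Theta_spec(1)[OF g] j]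
    by (simp add: eval_skm Theta_spec(2)[OF g j] eval_comb[OF f])
qed

lemma Theta_add:
  assumes f: "f \<in> R" and g: "g \<in> R"
  shows "\<Theta> (f + g) = \<Theta> f + \<Theta> g"
proof (rule Theta_unique)
  show "\<Theta> f + \<Theta> g \<in> carrier_mat r r" using Theta_spec(1) f g by auto
  fix j assume j: "j < r"
  have "col (\<Theta> f + \<Theta> g) j = col (\<Theta> f) j + col (\<Theta> g) j"
    using Theta_spec(1)[OF f] Theta_spec(1)[OF g] j by (intro eq_vecI) auto
  then show "skew_eval q (f + g) (e j) = comb (col (\<Theta> f + \<Theta> g) j)"
    using j Theta_spec[OF g] Theta_spec[OF f] by (simp add: eval_add_left comb_add carrier_vecI)
qed

lemma Theta_multiple:
  assumes "g \<in> R"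
  shows "\<Theta> (g \<star> drinfeld r a) = 0\<^sub>m r r"
  by (rule Theta_unique) (use basis_in in \<open>auto simp: eval_skm torsion_def comb_zero\<close>)

text \<open>A polynomial with zero matrix vanishes on all q^(m r) torsion points, and so does its
  remainder modulo \<phi>_a. The remainder has degree below m r, too small for that many roots
  unless it is 0.\<close>

lemma Theta_eq_0:
  assumes f: "f \<in> R" and "\<Theta> f = 0\<^sub>m r r"
  shows "\<exists>g\<in>R. f = g \<star> drinfeld r a"
proof -
  have van: "skew_eval q f x = 0" if x: "x \<in> T" for x
  proof -
    obtain v where v: "v \<in> carrier_vec r" "x = comb v" using comb_surj[OF x] by blast
    have "0\<^sub>m r r *\<^sub>v v = 0\<^sub>v r" using v by (intro eq_vecI) auto
    then show ?thesis using eval_comb[OF f v(1)] assms(2) v(2) comb_zero by simp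
  qed
  obtain g b where gb: "g \<in> R" "b \<in> R" "f = g \<star> drinfeld r a + b" "b = 0 \<or> degree b < degree (drinfeld r a)"
    using right_division[OF f, of "drinfeld r a"] a_in_A a_nz by auto
  have "b = 0"
  proof (rule ccontr)
    assume b: "b \<noteq> 0"
    have "skew_eval q b x = 0" if "x \<in> T" for x
      using van[OF that] that by (simp add: gb(3) eval_add_left eval_skm torsion_def)
    then have "card T \<le> card {x. skew_eval q b x = 0}"
      using card_eval_roots(1)[OF b] by (intro card_mono) auto
    also have "\<dots> \<le> q ^ degree b" by (rule card_eval_roots(2)[OF b])
    finally have "m * r \<le> degree b" using q_ge_2 by (simp add: card_torsion)
    then show False using gb(4) b by (simp add: degree_drinfeld deg_a mult.commute)
  qed
  then show ?thesis using gb by auto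
qed

text \<open>Multiples of \<phi>_a act as 0, so matrices may be computed from the polynomial itself;
  later arguments thereby avoid remainders.\<close>

lemma Theta_right_rem:
  assumes f: "f \<in> R"
  shows "\<Theta> (right_rem q r f (drinfeld r a)) = \<Theta> f"
proof -
  have "drinfeld r a \<noteq> 0" using a_nz by simp
  note rem = right_rem[OF f drinfeld_in_R[OF a_in_A] this]
  obtain g where g: "g \<in> R" "f = g \<star> drinfeld r a + right_rem q r f (drinfeld r a)" using rem(3) by blast
  have "\<Theta> f = \<Theta> (g \<star> drinfeld r a) + \<Theta> (right_rem q r f (drinfeld r a))"
    by (subst g(2)) (intro Theta_add R_closed g rem(1) drinfeld_in_R a_in_A)
  then show ?thesis using Theta_multiple[OF g(1)] Theta_spec(1)[OF rem(1)] by simp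
qed

end

section \<open>Decoding\<close>

lemma (in skew_ring) card_polys:
  assumes "finite Fqr" "card Fqr = q ^ r" "n \<ge> 1"
  shows "finite {f \<in> R. degree f < n}" "card {f \<in> R. degree f < n} = q ^ (r * n)"
proof -
  have "bij_betw (\<lambda>f. \<lambda>i\<in>{..<n}. coeff f i) {f \<in> R. degree f < n} ({..<n} \<rightarrow>\<^sub>E Fqr)"
  proof (rule bij_betwI[where g = "\<lambda>g. Poly (map g [0..<n])"])
    show "(\<lambda>f. \<lambda>i\<in>{..<n}. coeff f i) \<in> {f \<in> R. degree f < n} \<rightarrow> {..<n} \<rightarrow>\<^sub>E Fqr"
      by (simp add: R_coeff)
    have deg: "degree (Poly (map g [0..<n])) < n" for g :: "nat \<Rightarrow> 'c"
      using assms(3) by (intro degree_lessI) (auto simp: nth_default_def)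
    show "(\<lambda>g. Poly (map g [0..<n])) \<in> ({..<n} \<rightarrow>\<^sub>E Fqr) \<rightarrow> {f \<in> R. degree f < n}"
      using deg by (auto simp: poly_over_def nth_default_def)
  next
    fix f assume "f \<in> {f \<in> R. degree f < n}"
    then show "Poly (map (\<lambda>i\<in>{..<n}. coeff f i) [0..<n]) = f"
      by (intro poly_eqI) (auto simp: nth_default_def coeff_eq_0)
  next
    fix g assume g: "g \<in> {..<n} \<rightarrow>\<^sub>E Fqr"
    show "(\<lambda>i\<in>{..<n}. coeff (Poly (map g [0..<n])) i) = g"
    proof (rule ext)
      fix i show "(\<lambda>i\<in>{..<n}. coeff (Poly (map g [0..<n])) i) i = g i"
        using PiE_arb[OF g, of i] by (auto simp: nth_default_def)
    qed
  qed
  from bij_betw_same_card[OF this] bij_betw_finite[OF this]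
  show "finite {f \<in> R. degree f < n}" "card {f \<in> R. degree f < n} = q ^ (r * n)"
    using assms by (simp_all add: card_funcsetE finite_PiE power_mult)
qed

locale skew_crt = skew_ring q r ty for q r and ty :: "'c::alg_closed_field itself" +
  fixes m t :: nat and qs :: "'c poly list" and h :: "nat \<Rightarrow> 'c poly \<Rightarrow> 'e::field" and e :: "nat \<Rightarrow> nat \<Rightarrow> 'c"
  assumes params: "code_params q r m qs t"
    and card_E: "CARD('e) = q ^ m"
    and residue: "i < length qs \<Longrightarrow> residue_map q (qs ! i) (h i)"
    and basis: "i < length qs \<Longrightarrow> torsion_basis q r (qs ! i) (h i) (e i)"
begin

abbreviation l where "l \<equiv> length qs"
abbreviation M where "M \<equiv> Pi_mod q r qs"
abbreviation N where "N \<equiv> degree M"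
abbreviation Th where "Th i \<equiv> Theta_comp q r (h i) (e i)"

lemma pos: "m \<ge> 1" "l \<ge> 1" "t \<ge> 1" "t \<le> l * r"
  using params unfolding code_params_def by simp_all

lemma moduli:
  assumes "a \<in> set qs"
  shows "a \<in> A" "degree a = m" "lead_coeff a = 1" "a \<noteq> 0"
proof -
  have "a \<in> carrier (poly_A q) \<and> lead_coeff a = 1 \<and> degree a = m"
    using params assms unfolding code_params_def by fast
  then show "a \<in> A" "degree a = m" "lead_coeff a = 1" "a \<noteq> 0" by auto
qed

lemma distinct_qs: "distinct qs"
  using params by (simp add: code_params_def)

lemma rep: "i < l \<Longrightarrow> torsion_rep q r (qs ! i) (h i) (e i) m"
  using residue basis card_E moduli nth_mem[of i qs]
  by (intro torsion_rep.intro skew_ring_axioms torsion_rep_axioms.intro) auto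

lemma degree_M: "N = m * l * r"
  using moduli by (intro degree_Pi_mod) auto

lemma N_pos: "N > 0"
proof -
  have "0 < m" "0 < l" "0 < r" using pos r_pos by linarith+
  then show ?thesis unfolding degree_M by (intro mult_pos_pos)
qed

lemma M_eq: "M = drinfeld r (prod_list qs)"
  using moduli by (intro Pi_mod_eq) auto

lemma M_in_R: "M \<in> R"
  unfolding M_eq using moduli by (intro drinfeld_in_R A_prod_list) auto

lemma M_nz: "M \<noteq> 0"
  using N_pos by auto

text \<open>The residue map of one modulus inverts the product of the others, which yields a Bezout
  relation inside \<open>F_q[T]\<close>.\<close>
lemma bezout:
  assumes "i < l" "set as \<subseteq> set qs" "qs ! i \<notin> set as"
  shows "\<exists>b\<in>A. \<exists>c\<in>A. b * prod_list as = 1 + c * (qs ! i)"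
proof -
  interpret torsion_rep q r ty "qs ! i" "h i" "e i" m by (rule rep) fact
  have nz: "h i x \<noteq> 0" if x: "x \<in> set as" for x
  proof
    assume "h i x = 0"
    moreover have xA: "x \<in> A" "x \<in> set qs" using x assms(2) moduli by auto
    ultimately obtain b where b: "b \<in> A" "x = b * (qs ! i)" using h_eq_0_iff by auto
    have "b \<noteq> 0" using moduli(4)[OF xA(2)] b by auto
    then have "degree x = degree b + m" using b a_nz deg_a by (simp add: degree_mult_eq)
    then have "degree b = 0" using moduli(2)[OF xA(2)] by simp
    moreover have "lead_coeff b = 1"
      using moduli(3)[OF xA(2)] moduli(3)[of "qs ! i"] assms(1) b by (simp add: lead_coeff_mult)
    ultimately have "b = 1" by (metis degree_eq_zeroE coeff_pCons_0 one_pCons)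
    then show False using b x assms(3) by simp
  qed
  have "h i (prod_list as) \<noteq> 0 \<and> prod_list as \<in> A"
    using assms(2) nz moduli(1) by (induction as) (auto simp: h_one h_mult)
  then have P: "h i (prod_list as) \<noteq> 0" "prod_list as \<in> A" by auto
  obtain b where b: "b \<in> A" "h i b = inverse (h i (prod_list as))" using h_surj by blast
  then have "h i (b * prod_list as - 1) = 0" using P by (simp add: h_diff h_mult h_one)
  then obtain c where "c \<in> A" "b * prod_list as - 1 = c * (qs ! i)"
    using h_eq_0_iff[of "b * prod_list as - 1"] b P by auto
  then show ?thesis using b(1) by (intro bexI[of _ b] bexI[of _ c]) (auto simp: algebra_simps)
qed

text \<open>With f = g1 P = g2 a and 1 = b P - c a, the identity f = f b P - f c a exhibits a P as a
  right factor of both terms. The elements of F_q[T] involved may be reordered before they are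
  mapped into R.\<close>

lemma divisible_by_product:
  assumes "f \<in> R" "\<And>a. a \<in> set qs \<Longrightarrow> \<exists>g\<in>R. f = g \<star> drinfeld r a"
  shows "\<exists>g\<in>R. f = g \<star> M"
proof -
  have "\<exists>g\<in>R. f = g \<star> drinfeld r (prod_list as)" if "set as \<subseteq> set qs" "distinct as" for as
    using that
  proof (induction as)
    case Nil
    then show ?case using assms(1) by (intro bexI[of _ f]) auto
  next
    case (Cons a as)
    obtain i where i: "i < l" "a = qs ! i" using Cons.prems by (auto simp: in_set_conv_nth)
    let ?P = "prod_list as"
    have A: "a \<in> A" "?P \<in> A" using Cons.prems moduli(1) by (auto intro!: A_prod_list)
    obtain g1 where g1: "g1 \<in> R" "f = g1 \<star> drinfeld r ?P" using Cons by auto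
    obtain g2 where g2: "g2 \<in> R" "f = g2 \<star> drinfeld r a" using assms(2) Cons.prems by auto
    obtain b c where bc: "b \<in> A" "c \<in> A" "b * ?P = 1 + c * a"
      using bezout[OF i(1), of as] Cons.prems i(2) by auto
    have "b * ?P - c * a = 1" using bc(3) by simp
    then have "f = f \<star> (drinfeld r (b * ?P) - drinfeld r (c * a))"
      by (simp flip: drinfeld_diff)
    also have "\<dots> = f \<star> drinfeld r (b * ?P) - f \<star> drinfeld r (c * a)"
      by (rule skm_diff_right)
    also have "f \<star> drinfeld r (b * ?P) = g2 \<star> drinfeld r (a * (b * ?P))"
      unfolding g2(2) skm_assoc using A bc(1,2) by (simp add: drinfeld_mult[of a])
    also have "\<dots> = g2 \<star> drinfeld r b \<star> drinfeld r (a * ?P)"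
      unfolding skm_assoc using A bc(1,2) by (simp add: mult.left_commute[of a b] drinfeld_mult[of b])
    also have "f \<star> drinfeld r (c * a) = g1 \<star> drinfeld r (?P * (c * a))"
      unfolding g1(2) skm_assoc using A bc(1,2) by (simp add: drinfeld_mult[of ?P])
    also have "\<dots> = g1 \<star> drinfeld r c \<star> drinfeld r (a * ?P)"
      unfolding skm_assoc using A bc(1,2) by (simp add: mult.left_commute[of ?P c] mult.commute[of ?P a] drinfeld_mult[of c])
    finally have "f = (g2 \<star> drinfeld r b - g1 \<star> drinfeld r c) \<star> drinfeld r (a * ?P)"
      by (simp only: skm_diff_left)
    then show ?case using g1(1) g2(1) bc
      by (intro bexI[of _ "g2 \<star> drinfeld r b - g1 \<star> drinfeld r c"]) auto
  qed
  from this[OF order.refl distinct_qs] show ?thesis by (simp add: M_eq)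
qed

section \<open>The joint matrix representation of all moduli\<close>

lemma Th_carrier: "i < l \<Longrightarrow> f \<in> R \<Longrightarrow> Th i f \<in> carrier_mat r r"
  by (rule torsion_rep.Theta_spec(1)[OF rep])

lemma Th_mult: "i < l \<Longrightarrow> f \<in> R \<Longrightarrow> g \<in> R \<Longrightarrow> Th i (f \<star> g) = Th i f * Th i g"
  by (rule torsion_rep.Theta_mult[OF rep])

lemma Th_add: "i < l \<Longrightarrow> f \<in> R \<Longrightarrow> g \<in> R \<Longrightarrow> Th i (f + g) = Th i f + Th i g"
  by (rule torsion_rep.Theta_add[OF rep])

lemma Th_diff:
  assumes "i < l" "f \<in> R" "g \<in> R"
  shows "Th i (f - g) = Th i f - Th i g"
proof -
  have fg: "f - g \<in> R" using assms by auto
  have "Th i f = Th i (f - g) + Th i g"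
    using Th_add[OF assms(1) fg assms(3)] by simp
  moreover have "Th i (f - g) \<in> carrier_mat r r" "Th i g \<in> carrier_mat r r"
    using Th_carrier assms fg by auto
  ultimately show ?thesis by (intro eq_matI) auto
qed

lemma Th_multiple_M:
  assumes i: "i < l" and g: "g \<in> R"
  shows "Th i (g \<star> M) = 0\<^sub>m r r"
proof -
  let ?a = "qs ! i"
  have a: "?a \<in> A" using i moduli by auto
  obtain xs ys where split: "qs = xs @ ?a # ys" using split_list[of ?a qs] i by auto
  define P where "P = prod_list xs * prod_list ys"
  have "set qs = set xs \<union> insert ?a (set ys)" by (subst split) simp
  then have "set xs \<subseteq> A" "set ys \<subseteq> A" using moduli(1) by blast+
  then have P: "P \<in> A" unfolding P_def by (intro A_closed A_prod_list)
  have "prod_list qs = P * ?a" by (subst split) (simp add: P_def)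
  then have "g \<star> M = (g \<star> drinfeld r P) \<star> drinfeld r ?a"
    using P a by (simp add: M_eq drinfeld_mult skm_assoc)
  then show ?thesis using torsion_rep.Theta_multiple[OF rep[OF i], of "g \<star> drinfeld r P"] g P by simp
qed

lemma Th_all_zero:
  assumes f: "f \<in> R" and "\<And>i. i < l \<Longrightarrow> Th i f = 0\<^sub>m r r"
  shows "\<exists>g\<in>R. f = g \<star> M"
proof (rule divisible_by_product[OF f])
  fix a assume "a \<in> set qs"
  then obtain i where "i < l" "a = qs ! i" by (auto simp: in_set_conv_nth)
  then show "\<exists>g\<in>R. f = g \<star> drinfeld r a"
    using torsion_rep.Theta_eq_0[OF rep f] assms(2) by auto
qed

definition polys :: "nat \<Rightarrow> 'c poly set" where "polys n = {f \<in> R. degree f < n}"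
text \<open>Extensional functions on \<open>{..<l}\<close> make equality of tuples equality of
  functions and allow counting in dependent function sets.\<close>

definition Tup :: "'c poly \<Rightarrow> nat \<Rightarrow> 'e mat" where "Tup f = (\<lambda>i\<in>{..<l}. Th i f)"

lemma card_Fqr: "finite Fqr" "card Fqr = q ^ r"
proof -
  obtain n where n: "n \<ge> 1" "q = CHAR('c) ^ n" using q_eq by blast
  then have "q ^ r = CHAR('c) ^ (n * r)" "n * r \<ge> 1" using r_pos by (auto simp: power_mult)
  then show "finite Fqr" "card Fqr = q ^ r" using card_gf[OF char_pos] by auto
qed

lemma card_polys': "n \<ge> 1 \<Longrightarrow> finite (polys n)" "n \<ge> 1 \<Longrightarrow> card (polys n) = q ^ (r * n)"
  unfolding polys_def using card_polys[OF card_Fqr] by auto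

lemma polys_diff: "f \<in> polys n \<Longrightarrow> g \<in> polys n \<Longrightarrow> f - g \<in> polys n"
  by (auto simp: polys_def intro!: degree_diff_less)

lemma Tup_eq_diff:
  assumes "Tup f = Tup g" "f \<in> R" "g \<in> R" "i < l"
  shows "Th i (f - g) = 0\<^sub>m r r"
proof -
  have "Th i f = Th i g" using fun_cong[OF assms(1), of i] assms(4) by (simp add: Tup_def)
  then show ?thesis using assms Th_carrier[of i g] by (simp add: Th_diff)
qed

lemma Tup_inj: "inj_on Tup (polys N)"
proof (rule inj_onI)
  fix f g assume *: "f \<in> polys N" "g \<in> polys N" "Tup f = Tup g"
  then have d: "f - g \<in> R" "degree (f - g) < N" using polys_diff[OF *(1,2)] by (auto simp: polys_def)
  obtain w where w: "w \<in> R" "f - g = w \<star> M"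
    using Th_all_zero[OF d(1)] Tup_eq_diff[OF *(3)] * by (auto simp: polys_def)
  have "w = 0"
  proof (rule ccontr)
    assume "w \<noteq> 0"
    then have "degree (f - g) \<ge> N" using M_nz by (simp add: w(2) degree_skm)
    then show False using d by simp
  qed
  then show "f = g" using w by simp
qed

lemma finite_E: "finite (UNIV :: 'e set)"
  using card_E by (intro card_ge_0_finite) simp

text \<open>An injection between finite sets of equal size: r N = r (m l r) coefficients over F_q on
  one side, l r^2 matrix entries of m coefficients each on the other. This contains both the Chinese
  remainder theorem and the surjectivity of \<Theta>.\<close>

lemma Tup_surj: "Tup ` polys N = ({..<l} \<rightarrow>\<^sub>E carrier_mat r r)"
proof (rule card_subset_eq)
  note cm = card_carrier_mat[OF finite_E, of r r]
  show "finite ({..<l} \<rightarrow>\<^sub>E (carrier_mat r r :: 'e mat set))" using cm by (intro finite_PiE) auto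
  show "Tup ` polys N \<subseteq> ({..<l} \<rightarrow>\<^sub>E carrier_mat r r)"
    by (auto simp: Tup_def polys_def intro!: Th_carrier)
  have "card (Tup ` polys N) = q ^ (r * N)"
    using card_image[OF Tup_inj] card_polys'[of N] N_pos by simp
  also have "\<dots> = card ({..<l} \<rightarrow>\<^sub>E (carrier_mat r r :: 'e mat set))"
    by (simp add: card_funcsetE cm card_E degree_M ac_simps flip: power_mult)
  finally show "card (Tup ` polys N) = card ({..<l} \<rightarrow>\<^sub>E (carrier_mat r r :: 'e mat set))" .
qed

lemma wt_SR_sum: "wt_SR r Xs = (\<Sum>i<length Xs. vec_space.rank r (Xs ! i))"
  unfolding wt_SR_def by (simp add: sum_list_sum_nth atLeast0LessThan)

text \<open>The left ideal generated by the error tuple in the product of matrix rings. All left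
  multiples of a polynomial representing the error land in it.\<close>

definition multiples :: "'e mat list \<Rightarrow> (nat \<Rightarrow> 'e mat) set" where
  "multiples Es = (\<Pi>\<^sub>E i\<in>{..<l}. (\<lambda>X. X * Es ! i) ` carrier_mat r r)"

lemma card_multiples:
  assumes "Es \<in> mat_tuples r l"
  shows "finite (multiples Es)" "card (multiples Es) \<le> q ^ (m * r * wt_SR r Es)"
proof -
  have Es: "length Es = l" "i < l \<Longrightarrow> Es ! i \<in> carrier_mat r r" for i
    using assms by (auto simp: mat_tuples_def)
  note cl = card_left_multiples[OF finite_E Es(2)]
  show "finite (multiples Es)" unfolding multiples_def by (intro finite_PiE cl) auto
  have "card (multiples Es) = (\<Prod>i<l. card ((\<lambda>X. X * Es ! i) ` carrier_mat r r))"
    by (simp add: multiples_def card_PiE)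
  also have "\<dots> \<le> (\<Prod>i<l. CARD('e) ^ (r * vec_space.rank r (Es ! i)))"
    by (intro prod_mono conjI cl) auto
  also have "\<dots> = CARD('e) ^ (\<Sum>i<l. r * vec_space.rank r (Es ! i))"
    by (simp add: power_sum)
  also have "\<dots> = q ^ (m * r * wt_SR r Es)"
    by (simp add: card_E wt_SR_sum Es(1) mult.assoc flip: sum_distrib_left power_mult)
  finally show "card (multiples Es) \<le> q ^ (m * r * wt_SR r Es)" .
qed

section \<open>Remainders, lifts and the maps inverted by the decoder\<close>

lemma Theta_CRT:
  assumes "f \<in> R"
  shows "Theta q r h e (CRT q r qs f) = map (\<lambda>i. Th i f) [0..<l]"
  using torsion_rep.Theta_right_rem[OF rep assms] by (simp add: Theta_def CRT_def)

lemma CRT_in_R_Gamma: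
  assumes "f \<in> R"
  shows "CRT q r qs f \<in> R_Gamma q r qs"
  using right_rem(1,2)[OF assms] moduli by (simp add: R_Gamma_def CRT_def)

text \<open>Lets \<open>inv_into\<close> return the intended remainders. Two remainders with the
  same matrix differ by a multiple of Q_i of degree below that of Q_i.\<close>

lemma Theta_inj: "inj_on (Theta q r h e) (R_Gamma q r qs)"
proof (rule inj_onI)
  fix ys ys' assume ys: "ys \<in> R_Gamma q r qs" "ys' \<in> R_Gamma q r qs" "Theta q r h e ys = Theta q r h e ys'"
  have len: "length ys = l" "length ys' = l" using ys by (auto simp: R_Gamma_def)
  show "ys = ys'"
  proof (rule nth_equalityI)
    fix i assume "i < length ys"
    then have i: "i < l" using len by simp
    let ?Q = "drinfeld r (qs ! i)"
    have Q: "?Q \<noteq> 0" "degree ?Q > 0" using moduli i pos r_pos by (auto simp: degree_drinfeld)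
    have R: "ys ! i \<in> R" "ys' ! i \<in> R" and "degree (ys ! i) < degree ?Q" "degree (ys' ! i) < degree ?Q"
      using ys(1,2) i Q(2) by (auto simp: R_Gamma_def)
    then have deg: "degree (ys ! i - ys' ! i) < degree ?Q" by (intro degree_diff_less)
    have "Theta q r h e ys ! i = Theta q r h e ys' ! i" using ys(3) by simp
    then have "Th i (ys ! i) = Th i (ys' ! i)" using i len by (simp add: Theta_def)
    then have "Th i (ys ! i - ys' ! i) = 0\<^sub>m r r"
      using R Th_carrier[OF i R(2)] by (simp add: Th_diff[OF i])
    then obtain g where g: "ys ! i - ys' ! i = g \<star> ?Q"
      using torsion_rep.Theta_eq_0[OF rep[OF i]] R by auto
    have "g = 0"
      using deg degree_skm[of g ?Q] Q(1) by (cases "g = 0") (auto simp: g)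
    then show "ys ! i = ys' ! i" using g by simp
  qed (simp add: len)
qed

lemma CRT_lift_CRT:
  assumes Y: "Y \<in> polys N"
  shows "CRT_lift q r qs (CRT q r qs Y) = Y"
  unfolding CRT_lift_def
proof (rule the_equality)
  fix Y' assume "Y' \<in> carrier (skew_R q r) \<and> degree Y' < N \<and> CRT q r qs Y' = CRT q r qs Y"
  then have Y': "Y' \<in> polys N" "CRT q r qs Y' = CRT q r qs Y" by (auto simp: polys_def)
  then have "map (\<lambda>i. Th i Y') [0..<l] = map (\<lambda>i. Th i Y) [0..<l]"
    using Theta_CRT[of Y] Theta_CRT[of Y'] Y by (simp add: polys_def)
  then have "Tup Y' = Tup Y" by (auto simp: Tup_def fun_eq_iff)
  then show "Y' = Y" using Tup_inj Y Y'(1) by (simp add: inj_on_eq_iff)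
qed (use Y in \<open>auto simp: polys_def\<close>)

lemma Tup_mult_in_multiples:
  assumes w: "w \<in> R" and D: "D \<in> R" and Es: "Es \<in> mat_tuples r l"
    and Th_D: "\<And>i. i < l \<Longrightarrow> \<exists>X\<in>carrier_mat r r. Th i D = X * Es ! i"
  shows "Tup (w \<star> D) \<in> multiples Es"
  unfolding multiples_def
proof (rule PiE_I)
  fix i assume "i \<in> {..<l}"
  then have i: "i < l" by simp
  have E: "Es ! i \<in> carrier_mat r r" using Es i by (auto simp: mat_tuples_def)
  obtain X where X: "X \<in> carrier_mat r r" "Th i D = X * Es ! i" using Th_D[OF i] by blast
  have "Tup (w \<star> D) i = (Th i w * X) * Es ! i"
    using i w D X(2) assoc_mult_mat[OF Th_carrier[OF i w] X(1) E] by (simp add: Tup_def Th_mult)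
  moreover have "Th i w * X \<in> carrier_mat r r"
    by (rule mult_carrier_mat[OF Th_carrier[OF i w] X(1)])
  ultimately show "Tup (w \<star> D) i \<in> (\<lambda>X. X * Es ! i) ` carrier_mat r r" by blast
qed (simp add: Tup_def)

lemma error_annihilator:
  assumes D: "D \<in> R" and Es: "Es \<in> mat_tuples r l" and Th_D: "\<And>i. i < l \<Longrightarrow> Th i D = Es ! i"
    and wt: "wt_SR r Es \<le> k"
  shows "\<exists>v\<in>R. v \<noteq> 0 \<and> degree v \<le> m * k \<and> (\<exists>w\<in>R. v \<star> D = w \<star> M)"
proof -
  let ?V = "polys (m * k + 1)"
  have "\<exists>X\<in>carrier_mat r r. Th i D = X * Es ! i" if i: "i < l" for i
  proof -
    have "Es ! i \<in> carrier_mat r r" using Es i by (auto simp: mat_tuples_def)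
    then show ?thesis using Th_D[OF i] by (intro bexI[of _ "1\<^sub>m r"]) auto
  qed
  then have sub: "(\<lambda>v. Tup (v \<star> D)) ` ?V \<subseteq> multiples Es"
    using Tup_mult_in_multiples[OF _ D Es] by (auto simp: polys_def)
  \<comment> \<open>Degree at most m k leaves m k + 1 free coefficients; the extra one makes the
    pigeonhole inequality strict even when the weight equals k.\<close>
  have "m * r * wt_SR r Es \<le> m * r * k" using wt by simp
  also have "\<dots> < r * (m * k + 1)" using r_pos by (simp add: algebra_simps)
  finally have "q ^ (m * r * wt_SR r Es) < q ^ (r * (m * k + 1))"
    using q_ge_2 by (intro power_strict_increasing) auto
  then have "card (multiples Es) < card ?V"
    using card_multiples(2)[OF Es] card_polys'(2)[of "m * k + 1"] by simp
  then have "\<not> inj_on (\<lambda>v. Tup (v \<star> D)) ?V"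
    using card_inj_on_le[OF _ sub card_multiples(1)[OF Es]] by linarith
  then obtain v1 v2 where v: "v1 \<in> ?V" "v2 \<in> ?V" "v1 \<noteq> v2" "Tup (v1 \<star> D) = Tup (v2 \<star> D)"
    by (auto simp: inj_on_def)
  have R: "v1 \<in> R" "v2 \<in> R" using v by (auto simp: polys_def)
  have "\<exists>w\<in>R. v1 \<star> D - v2 \<star> D = w \<star> M"
    using R D Tup_eq_diff[OF v(4)] by (intro Th_all_zero) auto
  moreover have "degree (v1 - v2) \<le> m * k" using polys_diff[OF v(1,2)] by (simp add: polys_def)
  ultimately show ?thesis using R v(3) by (intro bexI[of _ "v1 - v2"]) (auto simp: skm_diff_left)
qed

lemma small_degree_multiple_eq_0:
  assumes D: "D \<in> R" and Es: "Es \<in> mat_tuples r l"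
    and Th_D: "\<And>i. i < l \<Longrightarrow> \<exists>X\<in>carrier_mat r r. Th i D = X * Es ! i"
    and deg: "degree D + m * wt_SR r Es < N"
  shows "D = 0"
proof (rule ccontr)
  assume nz: "D \<noteq> 0"
  \<comment> \<open>The largest n for which all w D with deg(w) < n stay below degree N, where
    tuples separate polynomials.\<close>
  define n where "n = N - degree D"
  have n: "n \<ge> 1" "m * wt_SR r Es < n" using deg by (auto simp: n_def)
  have in_polys: "w \<star> D \<in> polys N" if "w \<in> polys n" for w
    using that D degree_skm_le[of w D] by (auto simp: polys_def n_def)
  have "inj_on (\<lambda>w. Tup (w \<star> D)) (polys n)"
  proof (rule inj_onI)
    fix w w' assume w: "w \<in> polys n" "w' \<in> polys n" "Tup (w \<star> D) = Tup (w' \<star> D)"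
    then have "w \<star> D = w' \<star> D" using inj_onD[OF Tup_inj w(3)] in_polys by blast
    then have "(w - w') \<star> D = 0" by (simp add: skm_diff_left)
    then show "w = w'" using nz by simp
  qed
  moreover have "(\<lambda>w. Tup (w \<star> D)) ` polys n \<subseteq> multiples Es"
    using Tup_mult_in_multiples[OF _ D Es Th_D] by (auto simp: polys_def)
  ultimately have "card (polys n) \<le> card (multiples Es)"
    using card_multiples(1)[OF Es] by (rule card_inj_on_le)
  then have "q ^ (r * n) \<le> q ^ (m * r * wt_SR r Es)"
    using card_polys'(2)[OF n(1)] card_multiples(2)[OF Es] by linarith
  then have "r * n \<le> r * (m * wt_SR r Es)"
    using q_ge_2 by (simp add: ac_simps)
  then show False using n(2) r_pos by simp
qed

text \<open>Equality with a singleton says two things: some run exists that returns u, and no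
  admissible choice in the filter step leads to failure or to another message.\<close>

lemma decoder_correct:
  assumes u: "u \<in> R" "degree u < m * t" and Es: "Es \<in> mat_tuples r l"
    and k: "k = (l * r - t) div 2" and wt: "wt_SR r Es \<le> k"
  shows "decoder_outputs q r m qs h e k (m * t)
    (map2 (+) (Theta q r h e (CRT q r qs u)) Es) = {Some u}"
proof -
  define Ys where "Ys = map2 (+) (Theta q r h e (CRT q r qs u)) Es"
  have Es': "length Es = l" "\<And>i. i < l \<Longrightarrow> Es ! i \<in> carrier_mat r r"
    using Es by (auto simp: mat_tuples_def)
  have Ys: "length Ys = l" "\<And>i. i < l \<Longrightarrow> Ys ! i = Th i u + Es ! i"
    using Es' by (simp_all add: Ys_def Theta_CRT[OF u(1)])
  \<comment> \<open>The lift of the received word is first produced by surjectivity and only then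
    identified with the result of \<open>inv_into\<close> and \<open>CRT_lift\<close>.\<close>
  have "(\<lambda>i\<in>{..<l}. Ys ! i) \<in> ({..<l} \<rightarrow>\<^sub>E carrier_mat r r)"
    using Ys(2) Es'(2) Th_carrier[OF _ u(1)] by auto
  then obtain Y where Y: "Y \<in> polys N" "Tup Y = (\<lambda>i\<in>{..<l}. Ys ! i)"
    unfolding Tup_surj[symmetric] by (metis imageE)
  have YR: "Y \<in> R" using Y by (simp add: polys_def)
  have Th_Y: "Th i Y = Th i u + Es ! i" if "i < l" for i
    using fun_cong[OF Y(2), of i] that Ys(2)[OF that] by (simp add: Tup_def)
  have "Theta q r h e (CRT q r qs Y) = Ys"
    unfolding Theta_CRT[OF YR] using Ys Th_Y by (intro nth_equalityI) auto
  then have inv: "inv_into (R_Gamma q r qs) (Theta q r h e) Ys = CRT q r qs Y"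
    using Theta_inj CRT_in_R_Gamma[OF YR] by (intro inv_into_f_eq) auto
  have outputs: "decoder_outputs q r m qs h e k (m * t) Ys =
      {Option.bind (Option.bind res (message_recovery q r (m * t))) (verification q r qs h e k Ys)
            | res. filter_step q r qs (m * k) (m * t) Y res}"
    by (simp add: decoder_outputs_def inv CRT_lift_CRT[OF Y(1)])
  have Th_D: "Th i (Y - u) = Es ! i" if "i < l" for i
  proof -
    have "Th i (Y - u) = (Th i u + Es ! i) - Th i u" using that YR u by (simp add: Th_diff Th_Y)
    also have "\<dots> = Es ! i" using Th_carrier[OF that u(1)] Es'(2)[OF that] by (intro eq_matI) auto
    finally show ?thesis .
  qed
  have D: "Y - u \<in> R" using YR u by auto
  have mt: "m * t \<ge> 1" using u(2) by linarith
  have solution: "v \<noteq> 0 \<and> n = v \<star> u" if sol: "key_solution q r qs (m * k) (m * t) Y (v, n)" for v n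
  proof -
    obtain w where vn: "v \<in> R" "n \<in> R" "(v, n) \<noteq> (0, 0)" "w \<in> R" "v \<star> Y - n = w \<star> M"
      "degree v \<le> m * k" "degree n \<le> m * k + m * t - 1"
      using sol by (auto simp: key_solution_def)
    \<comment> \<open>Since w \<Pi> acts as 0 and Y - u acts as the error, the left side is
      represented by the left multiples of the E_i by the matrices of v.\<close>
    have "n - v \<star> u = v \<star> (Y - u) - w \<star> M" using vn(5) by (simp add: skm_diff_right algebra_simps)
    moreover have "Th i (v \<star> (Y - u) - w \<star> M) = Th i v * Es ! i" if i: "i < l" for i
    proof -
      have "Th i v * Es ! i \<in> carrier_mat r r" using Th_carrier[OF i vn(1)] Es'(2)[OF i] by auto
      moreover have "X - 0\<^sub>m r r = X" if "X \<in> carrier_mat r r" for X :: "'e mat"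
        using that by (intro eq_matI) auto
      ultimately have "Th i v * Es ! i - 0\<^sub>m r r = Th i v * Es ! i" by blast
      then show ?thesis
        using i vn D M_in_R by (simp add: Th_diff Th_mult[OF i _ D] Th_D[OF i] Th_multiple_M)
    qed
    ultimately have Th_n: "\<exists>X\<in>carrier_mat r r. Th i (n - v \<star> u) = X * Es ! i" if "i < l" for i
      using Th_carrier[OF that vn(1)] that by auto
    have "degree (v \<star> u) \<le> m * k + m * t - 1"
      using degree_skm_le[of v u] vn(6) u(2) by linarith
    then have "degree (n - v \<star> u) \<le> m * k + m * t - 1" using vn(7) by (intro degree_diff_le)
    moreover have "m * k + m * t - 1 + m * wt_SR r Es < N"
    proof -
      \<comment> \<open>The decoding radius enters here: wt(E) \<le> k and 2 k + t \<le> l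
        r.\<close>
      have "k + t + wt_SR r Es \<le> l * r" using wt k pos by linarith
      then have "m * (k + t + wt_SR r Es) \<le> N" unfolding degree_M mult.assoc by (rule mult_le_mono2)
      then have "m * k + m * t + m * wt_SR r Es \<le> N" by (simp only: distrib_left)
      then show ?thesis using mt by linarith
    qed
    ultimately have "degree (n - v \<star> u) + m * wt_SR r Es < N" by linarith
    then have "n - v \<star> u = 0"
      using vn(1,2) u(1) by (intro small_degree_multiple_eq_0[OF _ Es Th_n]) auto
    then show ?thesis using vn(3) by auto
  qed
  obtain v w where v: "v \<in> R" "v \<noteq> 0" "degree v \<le> m * k" "w \<in> R" "v \<star> (Y - u) = w \<star> M"
    using error_annihilator[OF D Es Th_D wt] by blast
  have "degree (v \<star> u) \<le> m * k + m * t - 1"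
    using degree_skm_le[of v u] v(3) u(2) by linarith
  then have exists: "key_solution q r qs (m * k) (m * t) Y (v, v \<star> u)"
    using v u by (auto simp: key_solution_def skm_diff_right)
  \<comment> \<open>A solution with v = 0 would have n = v u = 0, and a solution exists, so both
    failure alternatives of the filter step are excluded.\<close>
  have step: "filter_step q r qs (m * k) (m * t) Y res \<longleftrightarrow>
      (\<exists>v. res = Some (v, v \<star> u) \<and> key_solution q r qs (m * k) (m * t) Y (v, v \<star> u))" for res
    using solution exists unfolding filter_step_def by (cases res) (auto split: prod.splits)
  have "vec_space.rank r (Ys ! i - Theta q r h e (CRT q r qs u) ! i) = vec_space.rank r (Es ! i)" if i: "i < l" for i
  proof -
    have "Ys ! i - Th i u = Es ! i"
      using Ys(2)[OF i] Th_carrier[OF i u(1)] Es'(2)[OF i] by (intro eq_matI) auto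
    then show ?thesis using i by (simp add: Theta_CRT[OF u(1)])
  qed
  then have "wt_SR r (map2 (-) Ys (Theta q r h e (CRT q r qs u))) = wt_SR r Es"
    using Ys(1) Es'(1) by (simp add: wt_SR_sum Theta_CRT[OF u(1)])
  then have verify: "verification q r qs h e k Ys u = Some u"
    using wt by (simp add: verification_def)
  have recover: "message_recovery q r (m * t) (v, v \<star> u) = Some u"
    if "key_solution q r qs (m * k) (m * t) Y (v, v \<star> u)" for v
    using left_divmod_mult[of v u] solution[OF that] that u
    by (simp add: message_recovery_def key_solution_def)
  show ?thesis
    unfolding Ys_def[symmetric] outputs step
  proof (intro equalityI subsetI)
    fix x
    assume "x \<in> {Option.bind (Option.bind res (message_recovery q r (m * t))) (verification q r qs h e k Ys) | res.
      \<exists>v. res = Some (v, v \<star> u) \<and> key_solution q r qs (m * k) (m * t) Y (v, v \<star> u)}"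
    then obtain v where "key_solution q r qs (m * k) (m * t) Y (v, v \<star> u)"
      "x = Option.bind (Option.bind (Some (v, v \<star> u)) (message_recovery q r (m * t))) (verification q r qs h e k Ys)"
      by blast
    then show "x \<in> {Some u}" using recover verify by simp
  next
    fix x assume "x \<in> {Some u}"
    then show "x \<in> {Option.bind (Option.bind res (message_recovery q r (m * t))) (verification q r qs h e k Ys) | res.
      \<exists>v. res = Some (v, v \<star> u) \<and> key_solution q r qs (m * k) (m * t) Y (v, v \<star> u)}"
      using recover[OF exists] verify exists by (intro CollectI exI[of _ "Some (v, v \<star> u)"]) auto
  qed
qed

end

theorem corollary4p10:
  assumes "CHAR('c::alg_closed_field) > 0"
    and "is_algebraic_closure_of TYPE('c) (gf CHAR('c))"
  shows
    "(\<forall>q r m t (qs :: 'c poly list) (h :: nat \<Rightarrow> 'c poly \<Rightarrow> 'e::field) e u Es.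
        code_params q r m qs t \<and>
        CARD('e) = q ^ m \<and>
        (\<forall>i < length qs. residue_map q (qs ! i) (h i) \<and> torsion_basis q r (qs ! i) (h i) (e i)) \<and>
        u \<in> carrier (skew_R q r) \<and> degree u < m * t \<and>
        Es \<in> mat_tuples r (length qs) \<and>
        wt_SR r Es \<le> (length qs * r - t) div 2 \<longrightarrow>
        decoder_outputs q r m qs h e ((length qs * r - t) div 2) (m * t)
          (map2 (+) (Theta q r h e (CRT q r qs u)) Es) = {Some u})
     \<and>
     (\<exists>C :: real. \<forall>q r m t (qs :: 'c poly list).
        code_params q r m qs t \<longrightarrow>
        degree (Pi_mod q r qs) = m * length qs * r \<and>
        (\<exists>P. performs_filter_step q r qs (m * ((length qs * r - t) div 2)) (m * t) P \<and>
          (\<forall>Y \<in> carrier (skew_R q r). degree Y < degree (Pi_mod q r qs) \<longrightarrow>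
             real (run_cost q P (coeff Y))
               \<le> C * real (degree (Pi_mod q r qs)) powr matmul_exponent (gf (q ^ r) :: 'c set))))"
proof (intro conjI allI impI)
  fix q r m t and qs :: "'c poly list" and h :: "nat \<Rightarrow> 'c poly \<Rightarrow> 'e" and e :: "nat \<Rightarrow> nat \<Rightarrow> 'c"
    and u :: "'c poly" and Es :: "'e mat list"
  assume *: "code_params q r m qs t \<and> CARD('e) = q ^ m \<and>
      (\<forall>i < length qs. residue_map q (qs ! i) (h i) \<and> torsion_basis q r (qs ! i) (h i) (e i)) \<and>
      u \<in> carrier (skew_R q r) \<and> degree u < m * t \<and> Es \<in> mat_tuples r (length qs) \<and>
      wt_SR r Es \<le> (length qs * r - t) div 2"
  then interpret skew_crt q r "TYPE('c)" m t qs h e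
    using assms(1) by unfold_locales (auto simp: code_params_def)
  show "decoder_outputs q r m qs h e ((length qs * r - t) div 2) (m * t)
      (map2 (+) (Theta q r h e (CRT q r qs u)) Es) = {Some u}"
    using * by (intro decoder_correct) auto
next
  have "degree (Pi_mod q r qs) = m * length qs * r \<and>
      (\<exists>P. performs_filter_step q r qs (m * ((length qs * r - t) div 2)) (m * t) P \<and>
        (\<forall>Y \<in> carrier (skew_R q r). degree Y < degree (Pi_mod q r qs) \<longrightarrow>
           real (run_cost q P (coeff Y))
             \<le> 23 * real (degree (Pi_mod q r qs)) powr matmul_exponent (gf (q ^ r) :: 'c set)))"
    if params: "code_params q r m qs t" for q r m t and qs :: "'c poly list"
  proof -
    interpret skew_ring q r "TYPE('c)"
      using assms(1) params by unfold_locales (auto simp: code_params_def)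
    let ?l = "length qs" and ?N = "degree (Pi_mod q r qs)"
    define k where "k = (?l * r - t) div 2"
    have moduli: "set qs \<subseteq> A" "\<forall>a\<in>set qs. degree a = m \<and> a \<noteq> 0"
      using params by (auto simp: code_params_def)
    have deg: "?N = m * ?l * r" by (rule degree_Pi_mod[OF moduli])
    have mt: "m \<ge> 1" "t \<ge> 1" "t \<le> ?l * r" using params by (auto simp: code_params_def)
    \<comment> \<open>The Euclidean scheme descends from degree N, so its stopping degree m k + m t
      - 1 must lie below N.\<close>
    have "m * (k + t) \<le> m * (?l * r)" using mt(3) by (intro mult_le_mono2) (simp add: k_def)
    then have "m * k + m * t \<le> ?N" by (simp add: deg distrib_left mult.assoc)
    then have bound: "m * k + m * t - 1 < ?N" and mt1: "m * t \<ge> 1"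
      using mult_le_mono[OF mt(1,2)] by linarith+
    have "Pi_mod q r qs \<in> R" using moduli by (simp add: Pi_mod_eq A_prod_list)
    then interpret key_equation q r "TYPE('c)" qs "m * k" "m * t"
      using bound mt1 by unfold_locales
    obtain P where P: "performs_filter_step q r qs (m * k) (m * t) P"
      and cost: "\<And>Y. Y \<in> carrier (skew_R q r) \<Longrightarrow> degree Y < ?N \<Longrightarrow> run_cost q P (coeff Y) \<le> 23 * ?N ^ 2"
      using filter_program by blast
    have "real (run_cost q P (coeff Y)) \<le> 23 * real ?N powr matmul_exponent (gf (q ^ r) :: 'c set)"
      if "Y \<in> carrier (skew_R q r)" "degree Y < ?N" for Y
    proof -
      have "real (run_cost q P (coeff Y)) \<le> real (23 * ?N ^ 2)"
        using cost[OF that] of_nat_le_iff by blast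
      \<comment> \<open>From the quadratic bound to the exponent of matrix multiplication: N \<ge> 1
        and the exponent is at least 2. The constant is the same for all parameters.\<close>
      also have "\<dots> = 23 * real ?N powr 2" using N_pos by (simp add: powr_numeral)
      also have "\<dots> \<le> 23 * real ?N powr matmul_exponent (gf (q ^ r) :: 'c set)"
        using N_pos matmul_exponent_ge_2 by (intro mult_left_mono powr_mono) auto
      finally show ?thesis .
    qed
    then show ?thesis using P deg unfolding k_def by blast
  qed
  then show "\<exists>C :: real. \<forall>q r m t (qs :: 'c poly list).
        code_params q r m qs t \<longrightarrow>
        degree (Pi_mod q r qs) = m * length qs * r \<and>
        (\<exists>P. performs_filter_step q r qs (m * ((length qs * r - t) div 2)) (m * t) P \<and>
          (\<forall>Y \<in> carrier (skew_R q r). degree Y < degree (Pi_mod q r qs) \<longrightarrow>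
             real (run_cost q P (coeff Y))
               \<le> C * real (degree (Pi_mod q r qs)) powr matmul_exponent (gf (q ^ r) :: 'c set)))"
    by (intro exI[of _ 23] allI impI)
qed

end
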